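(* Let $p(z)=z^m(z^n-1)$ with integers $m\ge 0$ and $n\ge 2$, and let $h\in\mathbb{C}$ with $|h-1|<1$. If the Julia set $\mathcal{J}(N_{h,p})$ of the relaxed Newton map $N_{h,p}(z)=z-h\,p(z)/p'(z)$ is not a line, then $\Sigma p=\Sigma N_{h,p}$.
   Context: For a rational map (or polynomial) $R$ of degree at least two with Julia set $\mathcal{J}(R)$, the symmetry group of $R$ is $\Sigma R=\{\sigma(z)=az+b:\ |a|=1,\ \sigma(\mathcal{J}(R))=\mathcal{J}(R)\}$, the group of Euclidean isometries preserving the Julia set. $N_{h,p}$ is viewed as a rational map of the Riemann sphere. *)

theory Defs
  imports "HOL-Analysis.Analysis" "HOL-Computational_Algebra.Polynomial_Factorial" "HOL-Computational_Algebra.Field_as_Ring"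
begin

text \<open>The Riemann sphere is modelled as complex option, None being the point at infinity.
  It carries the chordal metric, realised via stereographic projection onto the unit
  sphere of R^3 (Euclidean distance there equals the chordal distance).\<close>

definition stereo :: "complex option \<Rightarrow> real \<times> real \<times> real" where
  "stereo w = (case w of
      None \<Rightarrow> (0, 0, 1)
    | Some z \<Rightarrow> (2 * Re z / (1 + (cmod z)^2), 2 * Im z / (1 + (cmod z)^2),
                 ((cmod z)^2 - 1) / (1 + (cmod z)^2)))"

definition chordal :: "complex option \<Rightarrow> complex option \<Rightarrow> real" where
  "chordal z w = dist (stereo z) (stereo w)"

definition sphere_open :: "complex option set \<Rightarrow> bool" where
  "sphere_open U \<longleftrightarrow> (\<forall>z\<in>U. \<exists>r>0. \<forall>w. chordal z w < r \<longrightarrow> w \<in> U)"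

definition sphere_compact :: "complex option set \<Rightarrow> bool" where
  "sphere_compact K \<longleftrightarrow> compact (stereo ` K)"

definition iterates_normal_on :: "(complex option \<Rightarrow> complex option) \<Rightarrow> complex option set \<Rightarrow> bool" where
  "iterates_normal_on f U \<longleftrightarrow>
     (\<forall>k :: nat \<Rightarrow> nat. \<exists>r g. strict_mono r \<and>
        (\<forall>K. K \<subseteq> U \<and> sphere_compact K \<longrightarrow>
           (\<forall>\<epsilon>>0. \<forall>\<^sub>F j in sequentially. \<forall>z\<in>K. chordal ((f ^^ k (r j)) z) (g z) < \<epsilon>)))"

definition fatou :: "(complex option \<Rightarrow> complex option) \<Rightarrow> complex option set" where
  "fatou f = {z. \<exists>U. sphere_open U \<and> z \<in> U \<and> iterates_normal_on f U}"

definition julia :: "(complex option \<Rightarrow> complex option) \<Rightarrow> complex option set" where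
  "julia f = UNIV - fatou f"

text \<open>The map of the sphere induced by P/Q (P, Q assumed coprime).\<close>

definition rat_sphere :: "complex poly \<Rightarrow> complex poly \<Rightarrow> complex option \<Rightarrow> complex option" where
  "rat_sphere P Q w = (case w of
      Some z \<Rightarrow> (if poly Q z = 0 then None else Some (poly P z / poly Q z))
    | None \<Rightarrow> (if degree P > degree Q then None
               else Some (if degree P = degree Q then lead_coeff P / lead_coeff Q else 0)))"

definition poly_sphere :: "complex poly \<Rightarrow> complex option \<Rightarrow> complex option" where
  "poly_sphere p = rat_sphere p 1"

text \<open>Relaxed Newton map N_{h,p}(z) = z - h p(z)/p'(z) = (z p' - h p)/p', reduced to lowest terms.\<close>

definition relaxed_newton :: "complex \<Rightarrow> complex poly \<Rightarrow> complex option \<Rightarrow> complex option" where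
  "relaxed_newton h p =
     (let num = [:0, 1:] * pderiv p - smult h p; den = pderiv p; g = gcd num den
      in rat_sphere (num div g) (den div g))"

definition pmn :: "nat \<Rightarrow> nat \<Rightarrow> complex poly" where
  "pmn m n = monom 1 m * (monom 1 n - 1)"

definition ext_aff :: "(complex \<Rightarrow> complex) \<Rightarrow> complex option \<Rightarrow> complex option" where
  "ext_aff \<sigma> = map_option \<sigma>"

definition sym_group :: "complex option set \<Rightarrow> (complex \<Rightarrow> complex) set" where
  "sym_group J = {\<sigma>. \<exists>a b. cmod a = 1 \<and> \<sigma> = (\<lambda>z. a * z + b) \<and> ext_aff \<sigma> ` J = J}"

definition is_line :: "complex option set \<Rightarrow> bool" where
  "is_line J \<longleftrightarrow> (\<exists>a b. b \<noteq> 0 \<and> Some -` J = {a + of_real t * b | t. True})"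

end

theory Submission
  imports Defs "HOL-Complex_Analysis.Complex_Analysis" "HOL-Computational_Algebra.Fundamental_Theorem_Algebra"
begin

text \<open>
  Both groups consist of the rotations \<open>z \<mapsto> a z\<close> with \<open>a\<^sup>n = 1\<close>.

  For the polynomial \<open>p\<close>, rotation invariance forces every symmetry to fix the centre 0 of the smallest
  disc containing the Julia set. If \<open>z \<mapsto> a z\<close> is a symmetry, then \<open>q(z) = a\<^sup>-\<^sup>d p(a z) = p(z) + \<gamma> z\<^sup>m\<close>
  maps the Julia set into that disc. Averaging \<open>q\<close> over the fibres of \<open>p\<close>, as in the theory of
  Chebyshev polynomials, gives \<open>\<gamma> = 0\<close>.

  The Newton map \<open>N\<close> is asymptotic to \<open>z \<mapsto> \<lambda> z\<close> with \<open>\<lambda> = 1 - h/d\<close>, \<open>0 < |\<lambda>| < 1\<close>, so infinity is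
  repelling. The translations preserving its Julia set form a closed group that is stable under
  multiplication by \<open>\<lambda>\<close>; if it is nontrivial, it contains a line, and then the Julia set is a line.
  Hence all symmetries fix 0. In the coordinate \<open>x = z\<^sup>n\<close> the Newton map becomes \<open>M(x) = \<Lambda> x + \<mu> + O(1/x)\<close>
  with \<open>\<mu> \<noteq> 0\<close>, whose linearisation at infinity is centred at \<open>x\<^sub>0 \<noteq> 0\<close>. A further rotational
  symmetry about 0 composed with its linear part is almost a translation; rescaling by
  powers of \<open>\<Lambda>\<close>, the Julia set is invariant under a translation flow in the linearising coordinate.
  By Picard's theorem this coordinate reaches a multiple preimage of infinity, near which the Julia
  set contains arcs in several directions. Together with the flow they fill an open set, whereas
  the Julia set has empty interior.
\<close>

section \<open>The chordal metric in homogeneous coordinates\<close>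

text \<open>In the coordinate \<open>z\<close> the Newton map has no constant term at infinity:
  \<open>N z = lam * z + O(1 / z)\<close>. The linearising coordinate is then centred at 0 and gives
  no hold on rotations about 0. Dividing by the known rotations, that is passing to
  \<open>x = z^n\<close>, creates the constant term \<open>n * lam^(n-1) * kap / d\<close>. A
  further rotation by \<open>\<alpha>\<close> about 0 now acts on the coordinate centred at
  \<open>x0\<close> as a rotation followed by the translation by \<open>(\<alpha> - 1) * x0\<close>.
  The preimage of infinity has to be multiple because directions are counted: at a point of order D,
  the two opposite flow rays near infinity pull back to arcs whose tangents differ by the angle
  \<open>pi / D\<close>. Both must be parallel to the flow, which is impossible for D >= 2 but
  possible for D = 1. Symmetries fix 0 once translations are excluded, because the commutator of a
  symmetry with a rotation about 0 is a translation. If the translations contain a line, each line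
  of that direction in the Julia set is sent, far out, into a parallel line, and the expansion of
  \<open>N\<close> allows this only for the line through 0.\<close>

definition quot_point :: "complex \<Rightarrow> complex \<Rightarrow> complex option" where
  "quot_point a b = (if b = 0 then None else Some (a / b))"

lemma Some_quot_point: "Some z = quot_point z 1"
  by (simp add: quot_point_def)

lemma None_quot_point: "None = quot_point 1 0"
  by (simp add: quot_point_def)

lemma stereo_quot_point:
  assumes "a \<noteq> 0 \<or> b \<noteq> 0"
  shows "stereo (quot_point a b) =
    (2 * Re (a * cnj b) / ((cmod a)^2 + (cmod b)^2), 2 * Im (a * cnj b) / ((cmod a)^2 + (cmod b)^2),
     ((cmod a)^2 - (cmod b)^2) / ((cmod a)^2 + (cmod b)^2))"
proof (cases "b = 0")
  case True
  with assms show ?thesis by (simp add: stereo_def quot_point_def)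
next
  case False
  define B where "B = (cmod b)^2"
  have B: "B > 0" using False by (simp add: B_def)
  have n: "(cmod (a / b))^2 = (cmod a)^2 / B"
    by (simp add: norm_divide power_divide B_def)
  have d: "1 + (cmod a)^2 / B = ((cmod a)^2 + B) / B" using B by (simp add: field_simps)
  have q: "a / b = a * cnj b / of_real B"
    using False complex_div_cnj[of a b] by (simp add: B_def)
  have re: "Re (a / b) = Re (a * cnj b) / B" and im: "Im (a / b) = Im (a * cnj b) / B"
    unfolding q by (simp_all only: Re_divide_of_real Im_divide_of_real)
  have "stereo (quot_point a b) = (2 * Re (a / b) / (1 + (cmod (a / b))^2), 2 * Im (a / b) / (1 + (cmod (a / b))^2),
     ((cmod (a / b))^2 - 1) / (1 + (cmod (a / b))^2))"
    using False by (simp add: stereo_def quot_point_def)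
  also have "\<dots> = (2 * Re (a * cnj b) / ((cmod a)^2 + B), 2 * Im (a * cnj b) / ((cmod a)^2 + B),
     ((cmod a)^2 - B) / ((cmod a)^2 + B))"
    unfolding re im n d using B by (simp add: field_simps)
  finally show ?thesis by (simp add: B_def)
qed

lemma hom_norm_pos:
  fixes a b :: complex
  assumes "a \<noteq> 0 \<or> b \<noteq> 0"
  shows "(cmod a)^2 + (cmod b)^2 > 0"
  using assms by (auto simp: add_pos_nonneg add_nonneg_pos)

lemma dist_triple_sq:
  fixes x y z x' y' z' :: real
  shows "(dist (x, y, z) (x', y', z'))^2 = (x - x')^2 + (y - y')^2 + (z - z')^2"
  by (simp add: dist_Pair_Pair dist_real_def)

text \<open>Homogeneous coordinates put poles and infinity on the same footing as finite points: the
  distance is the determinant of the two pairs divided by their norms. For unit vectors the squared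
  distance is 2 minus twice the inner product, and the latter is found by a polynomial identity in
  the eight real coordinates.\<close>

lemma chordal_quot_point:
  assumes ab: "a \<noteq> 0 \<or> b \<noteq> 0" and ce: "c \<noteq> 0 \<or> e \<noteq> 0"
  shows "chordal (quot_point a b) (quot_point c e) =
    2 * cmod (a * e - b * c) / (sqrt ((cmod a)^2 + (cmod b)^2) * sqrt ((cmod c)^2 + (cmod e)^2))"
proof -
  obtain a1 a2 b1 b2 c1 c2 e1 e2 where abce: "a = Complex a1 a2" "b = Complex b1 b2"
     "c = Complex c1 c2" "e = Complex e1 e2" by (metis complex.exhaust)
  define S T where "S = (cmod a)^2 + (cmod b)^2" and "T = (cmod c)^2 + (cmod e)^2"
  have S: "S > 0" and T: "T > 0" using hom_norm_pos ab ce by (auto simp: S_def T_def)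
  have S': "S = a1^2 + a2^2 + b1^2 + b2^2" and T': "T = c1^2 + c2^2 + e1^2 + e2^2"
    by (simp_all add: S_def T_def abce cmod_power2)
  define x y z where "x = 2 * Re (a * cnj b)" and "y = 2 * Im (a * cnj b)" and "z = (cmod a)^2 - (cmod b)^2"
  define x' y' z' where "x' = 2 * Re (c * cnj e)" and "y' = 2 * Im (c * cnj e)" and "z' = (cmod c)^2 - (cmod e)^2"
  define D where "D = (cmod (a * e - b * c))^2"
  have 1: "x^2 + y^2 + z^2 = S^2"
    unfolding S' x_def y_def z_def abce cmod_power2 by (simp add: power2_eq_square algebra_simps)
  have 2: "x'^2 + y'^2 + z'^2 = T^2"
    unfolding T' x'_def y'_def z'_def abce cmod_power2 by (simp add: power2_eq_square algebra_simps)
  have 3: "S * T - (x * x' + y * y' + z * z') = 2 * D"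
    unfolding S' T' D_def x_def y_def z_def x'_def y'_def z'_def abce cmod_power2
    by (simp add: power2_eq_square algebra_simps)
  have "(chordal (quot_point a b) (quot_point c e))^2 = (x/S - x'/T)^2 + (y/S - y'/T)^2 + (z/S - z'/T)^2"
    unfolding chordal_def stereo_quot_point[OF ab] stereo_quot_point[OF ce] dist_triple_sq
    by (simp add: x_def y_def z_def x'_def y'_def z'_def S_def T_def)
  also have "\<dots> = (x^2 + y^2 + z^2)/S^2 + (x'^2 + y'^2 + z'^2)/T^2 - 2 * (x * x' + y * y' + z * z') / (S * T)"
    using S T by (simp add: power2_diff power_divide add_divide_distrib diff_divide_distrib algebra_simps)
  also have "\<dots> = 2 * (S * T - (x * x' + y * y' + z * z')) / (S * T)"
    unfolding 1 2 using S T by (simp add: field_simps)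
  also have "\<dots> = 4 * D / (S * T)" unfolding 3 by simp
  finally have sq: "(chordal (quot_point a b) (quot_point c e))^2 = 4 * D / (S * T)" .
  have "chordal (quot_point a b) (quot_point c e) = sqrt (4 * D / (S * T))"
    using sq by (metis chordal_def real_sqrt_abs abs_of_nonneg zero_le_dist)
  also have "\<dots> = 2 * cmod (a * e - b * c) / (sqrt S * sqrt T)"
    by (simp add: real_sqrt_divide real_sqrt_mult D_def)
  finally show ?thesis by (simp add: S_def T_def)
qed

lemma chordal_commute: "chordal x y = chordal y x"
  by (simp add: chordal_def dist_commute)

lemma chordal_triangle: "chordal x z \<le> chordal x y + chordal y z"
  by (simp add: chordal_def dist_triangle)

lemma chordal_nonneg [simp]: "chordal x y \<ge> 0"
  by (simp add: chordal_def)

lemma chordal_refl [simp]: "chordal x x = 0"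
  by (simp add: chordal_def)

lemma chordal_Some_Some:
  "chordal (Some z) (Some w) = 2 * cmod (z - w) / (sqrt (1 + (cmod z)^2) * sqrt (1 + (cmod w)^2))"
  using chordal_quot_point[of z 1 w 1] by (simp add: Some_quot_point add.commute)

lemma chordal_None_Some: "chordal None (Some z) = 2 / sqrt (1 + (cmod z)^2)"
  using chordal_quot_point[of 1 0 z 1] by (simp add: Some_quot_point None_quot_point add.commute)

lemma sqrt_one_plus_sq_ge: "sqrt (1 + x^2) \<ge> 1" "sqrt (1 + x^2) \<ge> \<bar>x\<bar>" "sqrt (1 + x^2) \<le> 1 + \<bar>x\<bar>"
  for x :: real
proof -
  show "sqrt (1 + x^2) \<ge> 1" by simp
  show "sqrt (1 + x^2) \<ge> \<bar>x\<bar>" by (simp add: real_le_rsqrt)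
  have "1 + x^2 \<le> (1 + \<bar>x\<bar>)^2" by (simp add: power2_eq_square algebra_simps)
  then show "sqrt (1 + x^2) \<le> 1 + \<bar>x\<bar>" by (metis abs_ge_zero add_nonneg_nonneg real_sqrt_le_iff real_sqrt_abs abs_of_nonneg zero_le_one)
qed

lemma chordal_Some_le: "chordal (Some z) (Some w) \<le> 2 * cmod (z - w)"
proof -
  have "1 * 1 \<le> sqrt (1 + (cmod z)^2) * sqrt (1 + (cmod w)^2)"
    by (intro mult_mono) auto
  then show ?thesis unfolding chordal_Some_Some
    by (simp add: divide_le_eq mult_le_cancel_left1 mult_left_le)
qed

lemma chordal_None_le:
  assumes "cmod z > 0"
  shows "chordal None (Some z) \<le> 2 / cmod z"
  unfolding chordal_None_Some using assms sqrt_one_plus_sq_ge(2)[of "cmod z"]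
  by (intro divide_left_mono) (auto intro!: mult_pos_pos simp: add_pos_nonneg)

lemma chordal_None_ge: "chordal None (Some z) \<ge> 2 / (1 + cmod z)"
  unfolding chordal_None_Some using sqrt_one_plus_sq_ge(3)[of "cmod z"]
  by (intro divide_left_mono) (auto intro!: mult_pos_pos simp: add_pos_nonneg)

lemma chordal_rotate:
  assumes "cmod a = 1"
  shows "chordal (ext_aff (\<lambda>z. a * z) x) (ext_aff (\<lambda>z. a * z) y) = chordal x y"
proof -
  have *: "cmod (a * z - a * w) = cmod (z - w)" for z w
    using assms by (metis norm_mult mult_1 right_diff_distrib)
  show ?thesis
    using assms
    by (cases x; cases y)
       (simp_all add: ext_aff_def chordal_Some_Some chordal_None_Some chordal_commute[of _ None] norm_mult *)
qed

text \<open>Inverse stereographic projection from the north pole,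
  \<open>(x + i y) / (1 - z)\<close>. It serves to read limits of iterates, obtained in R^3 by
  Arzela-Ascoli, as points of the sphere again.\<close>

lemma stereo_surj:
  assumes "x^2 + y^2 + z^2 = 1"
  shows "\<exists>w. stereo w = (x, y, z)"
proof (cases "z = 1")
  case True
  then have "x = 0" "y = 0" using assms by (simp_all add: sum_power2_eq_zero_iff)
  then have "stereo None = (x, y, z)" using True by (simp add: stereo_def)
  then show ?thesis ..
next
  case False
  have "z^2 \<le> 1" using assms by (metis add.commute le_add_same_cancel1 sum_power2_ge_zero)
  then have "z \<le> 1" by (simp add: power2_le_iff_abs_le abs_square_le_1)
  with False have z: "1 - z > 0" by simp
  define w where "w = quot_point (Complex x y) (of_real (1 - z))"
  have nz: "Complex x y \<noteq> 0 \<or> complex_of_real (1 - z) \<noteq> 0" using z by auto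
  have xy: "x^2 + y^2 = (1 - z) * (1 + z)" using assms by (simp add: algebra_simps power2_eq_square)
  have c: "(cmod (Complex x y))^2 = (1 - z) * (1 + z)" "(cmod (complex_of_real (1 - z)))^2 = (1-z)^2"
    using xy by (simp_all add: cmod_power2 del: of_real_diff)
  have S: "(1 - z) * (1 + z) + (1 - z)^2 = 2 * (1 - z)" by (simp add: algebra_simps power2_eq_square)
  have D: "(1 - z) * (1 + z) - (1 - z)^2 = 2 * (1 - z) * z" by (simp add: algebra_simps power2_eq_square)
  have R: "Re (Complex x y * cnj (of_real (1-z))) = x * (1 - z)" "Im (Complex x y * cnj (of_real (1-z))) = y * (1 - z)"
    by (simp_all add: algebra_simps)
  have "stereo w = (x, y, z)"
    unfolding w_def stereo_quot_point[OF nz] c S D R using z by (auto simp: field_simps)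
  then show ?thesis ..
qed

lemma stereo_sphere: "stereo w = (x, y, z) \<Longrightarrow> x^2 + y^2 + z^2 = 1"
proof -
  assume *: "stereo w = (x, y, z)"
  have "(dist (x, y, z) (0, 0, 0))^2 = 1"
  proof (cases w)
    case None
    with * show ?thesis unfolding dist_triple_sq by (auto simp: stereo_def)
  next
    case (Some v)
    define s where "s = 1 + (cmod v)^2"
    have s: "s > 0" by (simp add: s_def add_pos_nonneg)
    have "x = 2 * Re v / s" "y = 2 * Im v / s" "z = ((cmod v)^2 - 1) / s"
      using * Some by (auto simp: stereo_def s_def)
    moreover have "(2 * Re v)^2 + (2 * Im v)^2 + ((cmod v)^2 - 1)^2 = s^2"
      unfolding s_def cmod_power2 by (simp add: power2_eq_square algebra_simps)
    ultimately show ?thesis unfolding dist_triple_sq using s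
      by (simp add: power_divide add_divide_distrib[symmetric])
  qed
  then show ?thesis unfolding dist_triple_sq by simp
qed

lemma norm_stereo: "norm (stereo w) = 1"
proof -
  obtain x y z where *: "stereo w = (x, y, z)" by (metis prod_cases3)
  then have "x^2 + y^2 + z^2 = 1" by (rule stereo_sphere)
  then show ?thesis unfolding * by (simp add: norm_Pair)
qed

lemma stereo_surj_norm: "norm v = 1 \<Longrightarrow> \<exists>w. stereo w = v"
proof -
  assume "norm v = 1"
  obtain x y z where v: "v = (x, y, z)" by (metis prod_cases3)
  have "x^2 + y^2 + z^2 = (norm v)^2" by (simp add: v norm_Pair)
  then show ?thesis using stereo_surj \<open>norm v = 1\<close> v by simp
qed

lemma continuous_on_stereo_quot_point:
  assumes "continuous_on S a" "continuous_on S b" "\<And>z. z \<in> S \<Longrightarrow> a z \<noteq> 0 \<or> b z \<noteq> 0"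
  shows "continuous_on S (\<lambda>z. stereo (quot_point (a z) (b z)))"
proof -
  have "continuous_on S (\<lambda>z. (2 * Re (a z * cnj (b z)) / ((cmod (a z))^2 + (cmod (b z))^2),
     2 * Im (a z * cnj (b z)) / ((cmod (a z))^2 + (cmod (b z))^2),
     ((cmod (a z))^2 - (cmod (b z))^2) / ((cmod (a z))^2 + (cmod (b z))^2)))"
    using hom_norm_pos assms(3) by (intro continuous_intros assms(1,2)) (metis less_irrefl)+
  then show ?thesis
    by (rule continuous_on_eq) (use stereo_quot_point assms(3) in auto)
qed

lemma continuous_on_stereo_Some: "continuous_on S (\<lambda>z. stereo (Some z))"
  unfolding Some_quot_point by (intro continuous_on_stereo_quot_point continuous_intros) auto

lemma sphere_open_Some_image:
  assumes "open V"
  shows "sphere_open (Some ` V)"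
  unfolding sphere_open_def
proof
  fix x assume "x \<in> Some ` V"
  then obtain z where z: "x = Some z" "z \<in> V" by auto
  from assms z obtain r where r: "r > 0" "ball z r \<subseteq> V" by (meson open_contains_ball)
  define B where "B = 1 + cmod z"
  have B: "B \<ge> 1" by (simp add: B_def)
  \<comment> \<open>A point at Euclidean distance \<open>s >= r\<close> from \<open>z\<close> has
    chordal distance at least \<open>2 * s / (B * (B + s))\<close>, which increases with
    \<open>s\<close>; \<open>\<rho>\<close> is its value at \<open>s = r\<close>. It also stays
    below \<open>2 / B\<close>, a lower bound for the distance to infinity.\<close>
  define \<rho> where "\<rho> = 2 * r / (B * (B + r))"
  have "\<rho> > 0" using r B by (simp add: \<rho>_def)
  moreover have "w \<in> Some ` V" if w: "chordal x w < \<rho>" for w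
  proof (cases w)
    case None
    have "r / (B + r) \<le> 1" using r B by simp
    then have "(2 / B) * (r / (B + r)) \<le> 2 / B * 1" using B by (intro mult_left_mono) auto
    then have "\<rho> \<le> 2 / B" by (simp add: \<rho>_def)
    also have "\<dots> \<le> chordal None (Some z)" using chordal_None_ge[of z] by (simp add: B_def)
    finally show ?thesis using w None z by (simp add: chordal_commute)
  next
    case (Some v)
    define s where "s = cmod (z - v)"
    have "s < r"
    proof (rule ccontr)
      assume "\<not> s < r"
      then have sr: "s \<ge> r" by simp
      have cv: "cmod v \<le> cmod z + s" unfolding s_def by (metis add.commute norm_triangle_sub norm_minus_commute)
      have 1: "sqrt (1 + (cmod z)^2) \<le> B" using sqrt_one_plus_sq_ge(3)[of "cmod z"] by (simp add: B_def)
      have 2: "sqrt (1 + (cmod v)^2) \<le> B + s" using sqrt_one_plus_sq_ge(3)[of "cmod v"] cv by (simp add: B_def)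
      have "r * (B + s) \<le> s * (B + r)" using sr B by (simp add: algebra_simps)
      then have "r / (B + r) \<le> s / (B + s)" using r B sr by (simp add: divide_simps)
      then have "(2 / B) * (r / (B + r)) \<le> (2 / B) * (s / (B + s))" using B by (intro mult_left_mono) auto
      then have "\<rho> \<le> 2 * s / (B * (B + s))" by (simp add: \<rho>_def)
      also have "\<dots> \<le> 2 * s / (sqrt (1 + (cmod z)^2) * sqrt (1 + (cmod v)^2))"
        using 1 2 sr r B by (intro divide_left_mono mult_mono) (auto intro!: mult_pos_pos simp: add_pos_nonneg)
      also have "\<dots> = chordal x w" using z Some by (simp add: chordal_Some_Some s_def)
      finally show False using w by simp
    qed
    then have "v \<in> ball z r" by (simp add: s_def dist_norm)
    then show ?thesis using r Some by auto
  qed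
  ultimately show "\<exists>r>0. \<forall>w. chordal x w < r \<longrightarrow> w \<in> Some ` V" by blast
qed

section \<open>Fatou sets and equicontinuity\<close>

text \<open>Euclidean distance in the source, chordal distance in the target: symmetries move finite
  points by isometries, whereas orbits may pass through infinity.\<close>

definition equicont_at :: "(complex option \<Rightarrow> complex option) \<Rightarrow> complex \<Rightarrow> bool" where
  "equicont_at f z \<longleftrightarrow> (\<forall>\<epsilon>>0. \<exists>\<delta>>0. \<forall>k w. dist w z < \<delta> \<longrightarrow>
     chordal ((f ^^ k) (Some w)) ((f ^^ k) (Some z)) < \<epsilon>)"

definition finite_julia :: "(complex option \<Rightarrow> complex option) \<Rightarrow> complex set" where
  "finite_julia f = {z. Some z \<in> julia f}"

definition iterates_continuous :: "(complex option \<Rightarrow> complex option) \<Rightarrow> bool" where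
  "iterates_continuous f \<longleftrightarrow> (\<forall>k. continuous_on UNIV (\<lambda>z. stereo ((f ^^ k) (Some z))))"

lemma iterates_continuousD:
  assumes "iterates_continuous f" "\<epsilon> > 0"
  shows "\<exists>\<delta>>0. \<forall>w. dist w z < \<delta> \<longrightarrow> chordal ((f ^^ k) (Some w)) ((f ^^ k) (Some z)) < \<epsilon>"
  using assms unfolding iterates_continuous_def continuous_on_iff chordal_def by auto

text \<open>A failure of equicontinuity provides times \<open>k j\<close> and points
  \<open>w j\<close> tending to \<open>z\<close>. Along a subsequence the iterates converge
  uniformly on a disc about \<open>z\<close>, so they inherit the continuity of any single one of
  them at \<open>z\<close>.\<close>

lemma fatou_imp_equicont_at:
  assumes cont: "iterates_continuous f"
    and U: "sphere_open U" "Some z \<in> U" "iterates_normal_on f U"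
  shows "equicont_at f z"
proof (rule ccontr)
  assume "\<not> equicont_at f z"
  then obtain \<epsilon> where \<epsilon>: "\<epsilon> > 0" and
    "\<And>\<delta>. \<delta> > 0 \<Longrightarrow> \<exists>k w. dist w z < \<delta> \<and> \<not> chordal ((f ^^ k) (Some w)) ((f ^^ k) (Some z)) < \<epsilon>"
    unfolding equicont_at_def by blast
  then have "\<forall>j::nat. \<exists>k w. dist w z < 1 / real (Suc j) \<and>
      \<not> chordal ((f ^^ k) (Some w)) ((f ^^ k) (Some z)) < \<epsilon>"
    by (metis zero_less_divide_1_iff of_nat_0_less_iff zero_less_Suc)
  then obtain k w where kw: "\<And>j. dist (w j) z < 1 / real (Suc j)"
      "\<And>j. \<not> chordal ((f ^^ k j) (Some (w j))) ((f ^^ k j) (Some z)) < \<epsilon>" by metis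
  from U obtain r where r: "r > 0" "\<And>x. chordal (Some z) x < r \<Longrightarrow> x \<in> U"
    unfolding sphere_open_def by metis
  define K where "K = Some ` cball z (r/4)"
  have "K \<subseteq> U"
  proof
    fix x assume "x \<in> K"
    then obtain v where v: "x = Some v" "dist z v \<le> r/4" by (auto simp: K_def)
    have "chordal (Some z) (Some v) \<le> 2 * (r/4)"
      using chordal_Some_le[of z v] v by (simp add: dist_norm)
    then show "x \<in> U" using r v by simp
  qed
  moreover have "sphere_compact K" unfolding sphere_compact_def K_def image_image
    by (intro compact_continuous_image continuous_on_stereo_Some) simp
  ultimately have K: "K \<subseteq> U \<and> sphere_compact K" by simp
  from U(3) obtain s g where s: "strict_mono s" and
     *: "\<And>K. K \<subseteq> U \<and> sphere_compact K \<Longrightarrow> (\<forall>\<epsilon>>0. \<forall>\<^sub>F j in sequentially. \<forall>z\<in>K. chordal ((f ^^ k (s j)) z) (g z) < \<epsilon>)"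
    using U(3)[unfolded iterates_normal_on_def, rule_format, of k] by blast
  have conv: "\<forall>\<^sub>F j in sequentially. \<forall>z\<in>K. chordal ((f ^^ k (s j)) z) (g z) < \<epsilon>/6"
    using *[OF K, rule_format, of "\<epsilon>/6"] \<epsilon> by simp
  then obtain J where J: "\<And>j x. j \<ge> J \<Longrightarrow> x \<in> K \<Longrightarrow> chordal ((f ^^ k (s j)) x) (g x) < \<epsilon>/6"
    unfolding eventually_sequentially by blast
  obtain \<delta> where \<delta>: "\<delta> > 0" "\<And>v. dist v z < \<delta> \<Longrightarrow> chordal ((f ^^ k (s J)) (Some v)) ((f ^^ k (s J)) (Some z)) < \<epsilon>/6"
    using iterates_continuousD[OF cont, of "\<epsilon>/6" z "k (s J)"] \<epsilon> by auto
  obtain j where j: "j \<ge> J" "1 / real (Suc j) < min \<delta> (r/4)"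
  proof -
    have "min \<delta> (r/4) > 0" using \<delta> r by simp
    then obtain i where i: "inverse (real (Suc i)) < min \<delta> (r/4)" using reals_Archimedean by blast
    have "1 / real (Suc (max i J)) \<le> inverse (real (Suc i))" by (simp add: field_simps)
    with i show ?thesis by (intro that[of "max i J"]) auto
  qed
  define v where "v = w (s j)"
  have "dist v z < 1 / real (Suc (s j))" using kw(1) v_def by simp
  also have "\<dots> \<le> 1 / real (Suc j)" using seq_suble[OF s, of j] by (simp add: field_simps)
  finally have dv: "dist v z < \<delta>" "dist v z < r/4" using j by auto
  have vK: "Some v \<in> K" "Some z \<in> K" using dv r by (auto simp: K_def dist_commute)
  have "chordal ((f ^^ k (s j)) (Some v)) ((f ^^ k (s j)) (Some z)) < \<epsilon>"
    using J[OF j(1) vK(1)] J[OF j(1) vK(2)] J[OF order_refl vK(1)] J[OF order_refl vK(2)] \<delta>(2)[OF dv(1)] \<epsilon>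
      chordal_triangle[of "(f ^^ k (s j)) (Some v)" "(f ^^ k (s j)) (Some z)" "g (Some v)"]
      chordal_triangle[of "g (Some v)" "(f ^^ k (s j)) (Some z)" "g (Some z)"]
      chordal_triangle[of "g (Some v)" "g (Some z)" "(f ^^ k (s J)) (Some v)"]
      chordal_triangle[of "(f ^^ k (s J)) (Some v)" "g (Some z)" "(f ^^ k (s J)) (Some z)"]
      chordal_commute[of "g (Some z)" "(f ^^ k (s j)) (Some z)"]
      chordal_commute[of "g (Some v)" "(f ^^ k (s J)) (Some v)"]
    by linarith
  then show False using kw(2)[of "s j"] v_def by simp
qed

text \<open>Arzela-Ascoli for the iterates viewed in R^3. Equicontinuity is assumed in a whole
  neighbourhood because the Fatou set is a union of open sets of normality.\<close>

lemma equicont_imp_fatou: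
  assumes r: "r > 0" and eq: "\<And>w. dist w z < r \<Longrightarrow> equicont_at f w"
  shows "Some z \<in> fatou f"
proof -
  define S where "S = cball z (r/2)"
  define U where "U = Some ` ball z (r/2)"
  have "iterates_normal_on f U"
    unfolding iterates_normal_on_def
  proof
    fix k :: "nat \<Rightarrow> nat"
    have A1: "compact S" by (simp add: S_def)
    have A2: "norm (stereo ((f ^^ k n) (Some x))) \<le> 1" for n x by (simp add: norm_stereo)
    have A3: "\<exists>d. 0 < d \<and> (\<forall>n y. y \<in> S \<and> norm (x - y) < d \<longrightarrow>
        norm (stereo ((f ^^ k n) (Some x)) - stereo ((f ^^ k n) (Some y))) < e)" if "x \<in> S" "e > 0" for x e
    proof -
      have "equicont_at f x" using that r by (intro eq) (auto simp: S_def dist_commute)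
      with that obtain d where d: "d > 0" "\<And>j w. dist w x < d \<Longrightarrow> chordal ((f ^^ j) (Some w)) ((f ^^ j) (Some x)) < e"
        unfolding equicont_at_def by metis
      then show ?thesis
        by (intro exI[of _ d]) (auto simp: chordal_def dist_norm norm_minus_commute)
    qed
    obtain g s where g: "strict_mono (s :: nat \<Rightarrow> nat)"
        "\<And>e. 0 < e \<Longrightarrow> \<exists>N. \<forall>n x. n \<ge> N \<and> x \<in> S \<longrightarrow> norm (stereo ((f ^^ k (s n)) (Some x)) - g x) < e"
      by (rule Arzela_Ascoli[of S "\<lambda>n x. stereo ((f ^^ k n) (Some x))" 1, OF A1 A2 A3]) metis+
    \<comment> \<open>The limit stays on the unit sphere, so it comes from a map into
      \<open>complex option\<close>.\<close>
    have "norm (g x) = 1" if "x \<in> S" for x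
    proof -
      have "(\<lambda>n. stereo ((f ^^ k (s n)) (Some x))) \<longlonglongrightarrow> g x"
        unfolding LIMSEQ_iff using g(2) that by blast
      then have "(\<lambda>n. norm (stereo ((f ^^ k (s n)) (Some x)))) \<longlonglongrightarrow> norm (g x)" by (rule tendsto_norm)
      then show ?thesis by (simp add: norm_stereo LIMSEQ_const_iff)
    qed
    then have "\<forall>x\<in>S. \<exists>w. stereo w = g x" using stereo_surj_norm by blast
    then obtain G where G: "\<And>x. x \<in> S \<Longrightarrow> stereo (G x) = g x" by metis
    have "\<forall>\<^sub>F j in sequentially. \<forall>z\<in>K. chordal ((f ^^ k (s j)) z) (G (the z)) < \<epsilon>" if K: "K \<subseteq> U" and \<epsilon>: "\<epsilon> > 0" for K \<epsilon>
    proof -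
      obtain N where N: "\<And>n x. n \<ge> N \<Longrightarrow> x \<in> S \<Longrightarrow> norm (stereo ((f ^^ k (s n)) (Some x)) - g x) < \<epsilon>"
        using g(2)[OF \<epsilon>] by blast
      have "chordal ((f ^^ k (s j)) x) (G (the x)) < \<epsilon>" if "j \<ge> N" "x \<in> K" for j x
      proof -
        from that K obtain v where v: "x = Some v" "v \<in> S" by (force simp: U_def S_def)
        then show ?thesis using N[OF that(1) v(2)] G[OF v(2)] by (simp add: chordal_def dist_norm)
      qed
      then show ?thesis unfolding eventually_sequentially by blast
    qed
    then show "\<exists>r g. strict_mono r \<and>
        (\<forall>K. K \<subseteq> U \<and> sphere_compact K \<longrightarrow>
           (\<forall>\<epsilon>>0. \<forall>\<^sub>F j in sequentially. \<forall>z\<in>K. chordal ((f ^^ k (r j)) z) (g z) < \<epsilon>))"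
      using g(1) by (intro exI[of _ s] exI[of _ "\<lambda>z. G (the z)"]) blast
  qed
  moreover have "sphere_open U" unfolding U_def by (rule sphere_open_Some_image) simp
  moreover have "Some z \<in> U" using r by (simp add: U_def)
  ultimately show ?thesis unfolding fatou_def by blast
qed

text \<open>This serves as the working description of the Julia set: from here on the arguments use
  equicontinuity instead of normality.\<close>

lemma not_finite_julia_iff:
  assumes cont: "iterates_continuous f"
  shows "z \<notin> finite_julia f \<longleftrightarrow> (\<exists>r>0. \<forall>w. dist w z < r \<longrightarrow> equicont_at f w)"
proof
  assume "z \<notin> finite_julia f"
  then obtain U where U: "sphere_open U" "Some z \<in> U" "iterates_normal_on f U"
    by (auto simp: finite_julia_def julia_def fatou_def)
  then obtain r where r: "r > 0" "\<And>x. chordal (Some z) x < r \<Longrightarrow> x \<in> U"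
    unfolding sphere_open_def by metis
  have "equicont_at f w" if "dist w z < r/2" for w
  proof (rule fatou_imp_equicont_at[OF cont U(1) _ U(3)])
    show "Some w \<in> U" using that chordal_Some_le[of z w] by (intro r) (simp add: dist_norm norm_minus_commute)
  qed
  then show "\<exists>r>0. \<forall>w. dist w z < r \<longrightarrow> equicont_at f w" using r by (intro exI[of _ "r/2"]) auto
next
  assume "\<exists>r>0. \<forall>w. dist w z < r \<longrightarrow> equicont_at f w"
  then show "z \<notin> finite_julia f"
    using equicont_imp_fatou by (auto simp: finite_julia_def julia_def)
qed

lemma closed_finite_julia:
  assumes "iterates_continuous f"
  shows "closed (finite_julia f)"
proof -
  have "open (- finite_julia f)"
    unfolding open_dist
  proof
    fix z assume "z \<in> - finite_julia f"
    then obtain r where r: "r > 0" "\<And>w. dist w z < r \<Longrightarrow> equicont_at f w"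
      using not_finite_julia_iff[OF assms] by auto
    have "y \<in> - finite_julia f" if "dist y z < r/2" for y
    proof -
      have "equicont_at f w" if "dist w y < r/2" for w
        using that \<open>dist y z < r/2\<close> dist_triangle[of w z y] by (intro r) simp
      then show ?thesis using not_finite_julia_iff[OF assms] r(1) half_gt_zero by blast
    qed
    then show "\<exists>e>0. \<forall>y. dist y z < e \<longrightarrow> y \<in> - finite_julia f"
      using r(1) half_gt_zero by blast
  qed
  then show ?thesis by (simp add: closed_def)
qed

lemma equicont_at_finite_julia:
  assumes "iterates_continuous f" "z \<notin> finite_julia f"
  shows "equicont_at f z"
  using assms not_finite_julia_iff by (metis dist_self)

text \<open>The tool for basins of attraction: uniform convergence settles all large
  \<open>k\<close> at once, and continuity settles the finitely many others.\<close>

lemma uniform_limit_imp_equicont_at: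
  assumes cont: "iterates_continuous f" and r: "r > 0"
    and lim: "\<And>\<epsilon>. \<epsilon> > 0 \<Longrightarrow> \<exists>k0. \<forall>k\<ge>k0. \<forall>w. dist w z < r \<longrightarrow> chordal ((f ^^ k) (Some w)) l < \<epsilon>"
  shows "equicont_at f z"
  unfolding equicont_at_def
proof (intro allI impI)
  fix \<epsilon> :: real assume \<epsilon>: "\<epsilon> > 0"
  then obtain k0 where k0: "\<And>k w. k \<ge> k0 \<Longrightarrow> dist w z < r \<Longrightarrow> chordal ((f ^^ k) (Some w)) l < \<epsilon>/2"
    using lim[of "\<epsilon>/2"] by auto
  have "\<forall>k. \<exists>\<delta>>0. \<forall>w. dist w z < \<delta> \<longrightarrow> chordal ((f ^^ k) (Some w)) ((f ^^ k) (Some z)) < \<epsilon>"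
    using iterates_continuousD[OF cont \<epsilon>] by blast
  then obtain \<delta> where \<delta>: "\<And>k. \<delta> k > 0" "\<And>k w. dist w z < \<delta> k \<Longrightarrow> chordal ((f ^^ k) (Some w)) ((f ^^ k) (Some z)) < \<epsilon>"
    by metis
  define d where "d = Min (insert r (\<delta> ` {..<k0}))"
  have d: "d > 0" "d \<le> r" "\<And>k. k < k0 \<Longrightarrow> d \<le> \<delta> k"
    unfolding d_def using r \<delta>(1) by auto
  have "chordal ((f ^^ k) (Some w)) ((f ^^ k) (Some z)) < \<epsilon>" if w: "dist w z < d" for k w
  proof (cases "k < k0")
    case True
    then show ?thesis using d(3)[OF True] w by (intro \<delta>) simp
  next
    case False
    then have "chordal ((f ^^ k) (Some w)) l < \<epsilon>/2" "chordal ((f ^^ k) (Some z)) l < \<epsilon>/2"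
      using k0 w d r by auto
    then show ?thesis
      using chordal_triangle[of "(f ^^ k) (Some w)" "(f ^^ k) (Some z)" l] by (simp add: chordal_commute[of l])
  qed
  then show "\<exists>\<delta>>0. \<forall>k w. dist w z < \<delta> \<longrightarrow> chordal ((f ^^ k) (Some w)) ((f ^^ k) (Some z)) < \<epsilon>"
    using d(1) by blast
qed

text \<open>The rotation \<open>b\<close> may vary with \<open>k\<close>: for
  \<open>z^m (z^n - 1)\<close> a rotation by \<open>a\<close> becomes one by \<open>a^(m^k)\<close>
  after \<open>k\<close> steps, while for the Newton map it stays \<open>a\<close>. All of them
  preserve chordal distances.\<close>

lemma equicont_at_rotate:
  assumes "equicont_at f z" and a: "cmod a = 1"
    and sym: "\<And>k. \<exists>b. cmod b = 1 \<and> (\<forall>z. (f ^^ k) (Some (a * z)) = ext_aff (\<lambda>z. b * z) ((f ^^ k) (Some z)))"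
  shows "equicont_at f (a * z)"
  unfolding equicont_at_def
proof (intro allI impI)
  fix \<epsilon> :: real assume "\<epsilon> > 0"
  then obtain \<delta> where \<delta>: "\<delta> > 0" "\<And>k w. dist w z < \<delta> \<Longrightarrow> chordal ((f ^^ k) (Some w)) ((f ^^ k) (Some z)) < \<epsilon>"
    using assms(1) unfolding equicont_at_def by metis
  have "chordal ((f ^^ k) (Some w)) ((f ^^ k) (Some (a * z))) < \<epsilon>" if w: "dist w (a * z) < \<delta>" for k w
  proof -
    have a0: "a \<noteq> 0" using a by auto
    define v where "v = w / a"
    have wv: "w = a * v" using a0 by (simp add: v_def)
    have "dist v z < \<delta>" using w a unfolding wv dist_norm
      by (metis mult_1 norm_mult right_diff_distrib)
    moreover obtain b where "cmod b = 1" "\<And>z. (f ^^ k) (Some (a * z)) = ext_aff (\<lambda>z. b * z) ((f ^^ k) (Some z))"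
      using sym by blast
    ultimately show ?thesis using \<delta>(2) by (simp add: wv chordal_rotate)
  qed
  then show "\<exists>\<delta>>0. \<forall>k w. dist w (a * z) < \<delta> \<longrightarrow> chordal ((f ^^ k) (Some w)) ((f ^^ k) (Some (a * z))) < \<epsilon>"
    using \<delta>(1) by blast
qed

lemma finite_julia_rotate:
  assumes cont: "iterates_continuous f" and a: "cmod a = 1"
    and sym: "\<And>k. \<exists>b. cmod b = 1 \<and> (\<forall>z. (f ^^ k) (Some (a * z)) = ext_aff (\<lambda>z. b * z) ((f ^^ k) (Some z)))"
    and z: "a * z \<in> finite_julia f"
  shows "z \<in> finite_julia f"
proof (rule ccontr)
  assume "z \<notin> finite_julia f"
  then obtain r where r: "r > 0" "\<And>w. dist w z < r \<Longrightarrow> equicont_at f w"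
    using not_finite_julia_iff[OF cont] by auto
  have "equicont_at f w" if w: "dist w (a * z) < r" for w
  proof -
    have a0: "a \<noteq> 0" using a by auto
    define v where "v = w / a"
    have wv: "w = a * v" using a0 by (simp add: v_def)
    have "dist v z < r" using w a unfolding wv dist_norm
      by (metis mult_1 norm_mult right_diff_distrib)
    then show ?thesis unfolding wv using equicont_at_rotate r(2) a sym by blast
  qed
  then show False using z r(1) not_finite_julia_iff[OF cont] by blast
qed

text \<open>An affine map with nonzero slope permutes the finite points and fixes infinity, so
  invariance can be tested on the finite points alone.\<close>

lemma sym_group_julia:
  "(\<lambda>z. a * z + b) \<in> sym_group (julia f) \<longleftrightarrow>
     cmod a = 1 \<and> (\<forall>z. z \<in> finite_julia f \<longleftrightarrow> a * z + b \<in> finite_julia f)"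
proof -
  have *: "ext_aff (\<lambda>z. a * z + b) ` J = J \<longleftrightarrow> (\<forall>z. Some z \<in> J \<longleftrightarrow> Some (a * z + b) \<in> J)" if "a \<noteq> 0" for J a b
  proof
    assume L: "ext_aff (\<lambda>z. a * z + b) ` J = J"
    show "\<forall>z. Some z \<in> J \<longleftrightarrow> Some (a * z + b) \<in> J"
    proof
      fix z
      have "ext_aff (\<lambda>z. a * z + b) (Some z) = Some (a * z + b)" by (simp add: ext_aff_def)
      moreover have "x = Some z" if "ext_aff (\<lambda>z. a * z + b) x = Some (a * z + b)" for x
        using that \<open>a \<noteq> 0\<close> by (auto simp: ext_aff_def)
      ultimately show "Some z \<in> J \<longleftrightarrow> Some (a * z + b) \<in> J" using L by (metis imageE imageI)
    qed
  next
    assume R: "\<forall>z. Some z \<in> J \<longleftrightarrow> Some (a * z + b) \<in> J"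
    show "ext_aff (\<lambda>z. a * z + b) ` J = J"
    proof
      show "ext_aff (\<lambda>z. a * z + b) ` J \<subseteq> J"
      proof
        fix x assume "x \<in> ext_aff (\<lambda>z. a * z + b) ` J"
        then obtain y where "y \<in> J" "x = ext_aff (\<lambda>z. a * z + b) y" by auto
        then show "x \<in> J" using R by (cases y) (auto simp: ext_aff_def)
      qed
      show "J \<subseteq> ext_aff (\<lambda>z. a * z + b) ` J"
      proof
        fix x assume x: "x \<in> J"
        show "x \<in> ext_aff (\<lambda>z. a * z + b) ` J"
        proof (cases x)
          case None
          then show ?thesis using x by (intro image_eqI[of _ _ None]) (auto simp: ext_aff_def)
        next
          case (Some w)
          have w: "a * ((w - b) / a) + b = w" using that by simp
          then have "Some ((w - b) / a) \<in> J" using R x Some by metis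
          then show ?thesis using w Some by (intro image_eqI[of _ _ "Some ((w - b) / a)"]) (auto simp: ext_aff_def)
        qed
      qed
    qed
  qed
  have uniq: "a' = a \<and> b' = b" if "(\<lambda>z. a * z + b) = (\<lambda>z. a' * z + b')" for a' b'
  proof -
    have "b = b'" using fun_cong[OF that, of 0] by simp
    then show ?thesis using fun_cong[OF that, of 1] by simp
  qed
  show ?thesis
  proof
    assume "(\<lambda>z. a * z + b) \<in> sym_group (julia f)"
    then have "cmod a = 1" "ext_aff (\<lambda>z. a * z + b) ` julia f = julia f"
      using uniq unfolding sym_group_def by blast+
    moreover from this have "a \<noteq> 0" by auto
    ultimately show "cmod a = 1 \<and> (\<forall>z. z \<in> finite_julia f \<longleftrightarrow> a * z + b \<in> finite_julia f)"
      using *[of a b "julia f"] by (simp add: finite_julia_def)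
  next
    assume R: "cmod a = 1 \<and> (\<forall>z. z \<in> finite_julia f \<longleftrightarrow> a * z + b \<in> finite_julia f)"
    then have "a \<noteq> 0" by auto
    then have "ext_aff (\<lambda>z. a * z + b) ` julia f = julia f"
      using *[of a b "julia f"] R by (simp add: finite_julia_def)
    then show "(\<lambda>z. a * z + b) \<in> sym_group (julia f)" using R unfolding sym_group_def by blast
  qed
qed

section \<open>Iterates of rational maps\<close>

text \<open>Homogenisation of \<open>p\<close> in degree \<open>D\<close>, by which
  \<open>P / Q\<close> acts on homogeneous coordinates. Being a sum of monomials, it is holomorphic
  in \<open>a\<close> and \<open>b\<close> also where \<open>b = 0\<close>.\<close>

definition hom_eval :: "complex poly \<Rightarrow> nat \<Rightarrow> complex \<Rightarrow> complex \<Rightarrow> complex" where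
  "hom_eval p D a b = (\<Sum>i\<le>D. coeff p i * a ^ i * b ^ (D - i))"

lemma hom_eval_nonzero:
  assumes "b \<noteq> 0" "degree p \<le> D"
  shows "hom_eval p D a b = b ^ D * poly p (a / b)"
proof -
  have "poly p (a / b) = (\<Sum>i\<le>D. coeff p i * (a / b) ^ i)"
    unfolding poly_altdef using assms(2)
    by (intro sum.mono_neutral_left) (auto simp: coeff_eq_0)
  then have "b ^ D * poly p (a / b) = (\<Sum>i\<le>D. b ^ D * (coeff p i * (a / b) ^ i))"
    by (simp add: sum_distrib_left)
  also have "\<dots> = hom_eval p D a b"
    unfolding hom_eval_def
  proof (rule sum.cong)
    fix i assume "i \<in> {..D}"
    then have "b ^ D = b ^ i * b ^ (D - i)" by (simp flip: power_add)
    then show "b ^ D * (coeff p i * (a / b) ^ i) = coeff p i * a ^ i * b ^ (D - i)"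
      using assms(1) by (simp add: power_divide)
  qed simp
  finally show ?thesis by simp
qed

lemma hom_eval_zero: "hom_eval p D a 0 = coeff p D * a ^ D"
proof -
  have "hom_eval p D a 0 = (\<Sum>i\<le>D. if i = D then coeff p i * a ^ i else 0)"
    unfolding hom_eval_def by (intro sum.cong) (auto simp: power_0_left)
  then show ?thesis by simp
qed

lemma holomorphic_on_hom_eval [holomorphic_intros]:
  assumes "a holomorphic_on S" "b holomorphic_on S"
  shows "(\<lambda>z. hom_eval p D (a z) (b z)) holomorphic_on S"
  unfolding hom_eval_def by (intro holomorphic_intros assms)

locale rational_map =
  fixes P Q :: "complex poly"
  assumes no_common_zero: "\<And>z. poly P z \<noteq> 0 \<or> poly Q z \<noteq> 0"
    and not_constant: "\<And>c. P \<noteq> smult c Q" "Q \<noteq> 0"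
begin

definition "D = max (degree P) (degree Q)"

abbreviation "f \<equiv> rat_sphere P Q"
abbreviation "J \<equiv> finite_julia f"

lemma rat_sphere_quot_point:
  assumes "a \<noteq> 0 \<or> b \<noteq> 0"
  shows "f (quot_point a b) = quot_point (hom_eval P D a b) (hom_eval Q D a b)"
    and "hom_eval P D a b \<noteq> 0 \<or> hom_eval Q D a b \<noteq> 0"
proof -
  have P0: "P \<noteq> 0" using not_constant(1)[of 0] by simp
  have *: "f (quot_point a b) = quot_point (hom_eval P D a b) (hom_eval Q D a b) \<and>
    (hom_eval P D a b \<noteq> 0 \<or> hom_eval Q D a b \<noteq> 0)"
  proof (cases "b = 0")
    case False
    have "degree P \<le> D" "degree Q \<le> D" by (auto simp: D_def)
    then show ?thesis
      using False no_common_zero[of "a / b"]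
      by (auto simp: hom_eval_nonzero rat_sphere_def quot_point_def)
  next
    case True
    then have a: "a \<noteq> 0" using assms by simp
    have lead: "coeff P (degree P) \<noteq> 0" "coeff Q (degree Q) \<noteq> 0"
      using P0 not_constant(2) by auto
    consider "degree P > degree Q" | "degree P = degree Q" | "degree P < degree Q" by linarith
    then show ?thesis
      by cases (use True a lead in \<open>auto simp: hom_eval_zero rat_sphere_def quot_point_def D_def coeff_eq_0 max_def\<close>)
  qed
  from * show "f (quot_point a b) = quot_point (hom_eval P D a b) (hom_eval Q D a b)"
    and "hom_eval P D a b \<noteq> 0 \<or> hom_eval Q D a b \<noteq> 0" by auto
qed

text \<open>A common zero never arises along the induction. So every iterate is globally a quotient
  of two entire functions, however often the orbit passes through infinity.\<close>

lemma iterate_quot_point: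
  "\<exists>a b. a holomorphic_on UNIV \<and> b holomorphic_on UNIV \<and>
     (\<forall>z. (a z \<noteq> 0 \<or> b z \<noteq> 0) \<and> (f ^^ k) (Some z) = quot_point (a z) (b z))"
proof (induction k)
  case 0
  show ?case
    by (intro exI[of _ "\<lambda>z. z"] exI[of _ "\<lambda>_. 1"]) (auto simp: quot_point_def intro: holomorphic_intros)
next
  case (Suc k)
  then obtain a b where ab: "a holomorphic_on UNIV" "b holomorphic_on UNIV"
    "\<And>z. a z \<noteq> 0 \<or> b z \<noteq> 0" "\<And>z. (f ^^ k) (Some z) = quot_point (a z) (b z)" by blast
  show ?case
    by (intro exI[of _ "\<lambda>z. hom_eval P D (a z) (b z)"] exI[of _ "\<lambda>z. hom_eval Q D (a z) (b z)"] conjI allI)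
       (use ab rat_sphere_quot_point in \<open>auto intro!: holomorphic_intros\<close>)
qed

lemma iterates_continuous: "iterates_continuous f"
  unfolding iterates_continuous_def
proof
  fix k
  obtain a b where ab: "a holomorphic_on UNIV" "b holomorphic_on UNIV"
    "\<And>z. a z \<noteq> 0 \<or> b z \<noteq> 0" "\<And>z. (f ^^ k) (Some z) = quot_point (a z) (b z)"
    using iterate_quot_point by blast
  show "continuous_on UNIV (\<lambda>z. stereo ((f ^^ k) (Some z)))"
    unfolding ab(4) using ab by (intro continuous_on_stereo_quot_point holomorphic_on_imp_continuous_on) auto
qed

lemmas closed_J = closed_finite_julia[OF iterates_continuous]

lemma Some_nonpole: "poly Q z \<noteq> 0 \<Longrightarrow> f (Some z) = Some (poly P z / poly Q z)"
  by (simp add: rat_sphere_def)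

lemma Some_pole: "poly Q z = 0 \<Longrightarrow> f (Some z) = None"
  by (simp add: rat_sphere_def)

lemma finite_fibre: "finite {z. poly P z = c * poly Q z}"
proof -
  have "P - smult c Q \<noteq> 0" using not_constant by simp
  then have "finite {z. poly (P - smult c Q) z = 0}" by (rule poly_roots_finite)
  then show ?thesis by simp
qed

text \<open>A nonconstant holomorphic map is open, and constancy on a disc would contradict the
  finiteness of the fibres. Openness is what allows equicontinuity to be pushed forward.\<close>

lemma nonpole_ball:
  assumes "poly Q z \<noteq> 0" "r > 0"
  obtains s where "0 < s" "s \<le> r" "\<And>w. w \<in> ball z s \<Longrightarrow> poly Q w \<noteq> 0"
    "(\<lambda>w. poly P w / poly Q w) holomorphic_on ball z s" "open ((\<lambda>w. poly P w / poly Q w) ` ball z s)"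
proof -
  have "open {w. poly Q w \<noteq> 0}" by (intro open_Collect_neq continuous_intros)
  then obtain t where t: "t > 0" "ball z t \<subseteq> {w. poly Q w \<noteq> 0}"
    using assms(1) by (auto elim!: openE[of _ z])
  define s where "s = min r t"
  have s: "s > 0" "s \<le> r" "\<And>w. w \<in> ball z s \<Longrightarrow> poly Q w \<noteq> 0"
    using t assms by (auto simp: s_def)
  have hol: "(\<lambda>w. poly P w / poly Q w) holomorphic_on ball z s"
    using s(3) by (intro holomorphic_intros) auto
  have "\<not> (\<lambda>w. poly P w / poly Q w) constant_on ball z s"
  proof
    assume "(\<lambda>w. poly P w / poly Q w) constant_on ball z s"
    then obtain c where c: "\<And>w. w \<in> ball z s \<Longrightarrow> poly P w / poly Q w = c" unfolding constant_on_def by auto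
    have "ball z s \<subseteq> {w. poly P w = c * poly Q w}"
    proof
      fix w assume w: "w \<in> ball z s"
      show "w \<in> {w. poly P w = c * poly Q w}" using c[OF w] s(3)[OF w] by (simp add: field_simps)
    qed
    then have "finite (ball z s)" using finite_fibre finite_subset by blast
    then show False using s(1) uncountable_ball countable_finite by blast
  qed
  then have "open ((\<lambda>w. poly P w / poly Q w) ` ball z s)"
    by (intro open_mapping_thm[OF hol]) auto
  with s hol show ?thesis by (intro that) auto
qed

text \<open>Equicontinuity of the iterates at \<open>g w\<close> is composed with the continuity of
  \<open>g\<close> at \<open>w\<close>.\<close>

lemma julia_backward:
  assumes Q: "poly Q z \<noteq> 0" and F: "poly P z / poly Q z \<notin> J"
  shows "z \<notin> J"
proof -
  define g where "g = (\<lambda>w. poly P w / poly Q w)"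
  obtain s where s: "0 < s" "\<And>w. w \<in> ball z s \<Longrightarrow> poly Q w \<noteq> 0" "g holomorphic_on ball z s"
    using nonpole_ball[OF Q zero_less_one] unfolding g_def by metis
  have cont: "continuous_on (ball z s) g" by (rule holomorphic_on_imp_continuous_on[OF s(3)])
  obtain r where r: "r > 0" "\<And>w. dist w (g z) < r \<Longrightarrow> equicont_at f w"
    using F not_finite_julia_iff[OF iterates_continuous] unfolding g_def by metis
  have step: "(f ^^ Suc k) (Some w) = (f ^^ k) (Some (g w))" if "w \<in> ball z s" for k w
    using Some_nonpole[OF s(2)[OF that]] by (simp add: funpow_Suc_right g_def del: funpow.simps)
  have "g \<midarrow>z\<rightarrow> g z" using cont s(1)
    by (metis centre_in_ball continuous_on_eq_continuous_at isCont_def open_ball)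
  then obtain t where t: "t > 0" "\<And>w. w \<noteq> z \<Longrightarrow> dist w z < t \<Longrightarrow> dist (g w) (g z) < r"
    using r(1) by (metis LIM_def)
  have "equicont_at f w" if w: "dist w z < min s t" for w
    unfolding equicont_at_def
  proof (intro allI impI)
    fix \<epsilon> :: real assume \<epsilon>: "\<epsilon> > 0"
    have wb: "w \<in> ball z s" using w by (simp add: dist_commute)
    have "equicont_at f (g w)" using t(2)[of w] r w by (cases "w = z") auto
    then obtain \<delta> where \<delta>: "\<delta> > 0" "\<And>k v. dist v (g w) < \<delta> \<Longrightarrow> chordal ((f ^^ k) (Some v)) ((f ^^ k) (Some (g w))) < \<epsilon>"
      using \<epsilon> unfolding equicont_at_def by metis
    have "open (ball z s)" by simp
    then have "g \<midarrow>w\<rightarrow> g w" using cont wb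
      by (metis continuous_on_eq_continuous_at isCont_def)
    then obtain u where u: "u > 0" "\<And>v. v \<noteq> w \<Longrightarrow> dist v w < u \<Longrightarrow> dist (g v) (g w) < \<delta>"
      using \<delta>(1) by (metis LIM_def)
    obtain e where e: "e > 0" "ball w e \<subseteq> ball z s" using wb by (metis open_ball open_contains_ball)
    \<comment> \<open>The bound \<open>\<epsilon>/4\<close> is for the iterate \<open>k = 0\<close>,
      the only one that does not factor through \<open>g\<close>.\<close>
    have "chordal ((f ^^ k) (Some v)) ((f ^^ k) (Some w)) < \<epsilon>" if v: "dist v w < min (min u e) (\<epsilon>/4)" for k v
    proof (cases k)
      case 0
      then show ?thesis using chordal_Some_le[of v w] v \<epsilon> by (simp add: dist_norm)
    next
      case (Suc j)
      have vb: "v \<in> ball z s" using v by (intro subsetD[OF e(2)]) (simp add: dist_commute)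
      show ?thesis unfolding Suc step[OF vb] step[OF wb]
        using u(2)[of v] v \<delta> by (cases "v = w") (auto intro!: \<delta>(2) simp: \<epsilon>)
    qed
    then show "\<exists>\<delta>>0. \<forall>k v. dist v w < \<delta> \<longrightarrow> chordal ((f ^^ k) (Some v)) ((f ^^ k) (Some w)) < \<epsilon>"
      using u(1) e(1) \<epsilon> by (intro exI[of _ "min (min u e) (\<epsilon>/4)"]) auto
  qed
  then show ?thesis using not_finite_julia_iff[OF iterates_continuous] s(1) t(1)
    by (metis min_less_iff_conj)
qed

text \<open>The open map \<open>g\<close> covers a neighbourhood of \<open>g w\<close>, so orbits
  starting there are orbits of points near \<open>w\<close> with the first step removed.\<close>

lemma julia_forward:
  assumes Q: "poly Q z \<noteq> 0" and F: "z \<notin> J"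
  shows "poly P z / poly Q z \<notin> J"
proof -
  define g where "g = (\<lambda>w. poly P w / poly Q w)"
  obtain r where r: "r > 0" "\<And>w. dist w z < r \<Longrightarrow> equicont_at f w"
    using F not_finite_julia_iff[OF iterates_continuous] by metis
  obtain s where s: "0 < s" "s \<le> r" "\<And>w. w \<in> ball z s \<Longrightarrow> poly Q w \<noteq> 0" "open (g ` ball z s)"
    using nonpole_ball[OF Q r(1)] unfolding g_def by metis
  have step: "(f ^^ Suc k) (Some w) = (f ^^ k) (Some (g w))" if "w \<in> ball z s" for k w
    using Some_nonpole[OF s(3)[OF that]] by (simp add: funpow_Suc_right g_def del: funpow.simps)
  have eq: "equicont_at f (g w)" if w: "w \<in> ball z s" for w
    unfolding equicont_at_def
  proof (intro allI impI)
    fix \<epsilon> :: real assume \<epsilon>: "\<epsilon> > 0"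
    have "equicont_at f w" using r w s by (simp add: dist_commute)
    then obtain \<delta> where \<delta>: "\<delta> > 0" "\<And>k v. dist v w < \<delta> \<Longrightarrow> chordal ((f ^^ k) (Some v)) ((f ^^ k) (Some w)) < \<epsilon>"
      using \<epsilon> unfolding equicont_at_def by metis
    obtain e where e: "e > 0" "ball w e \<subseteq> ball z s" using w by (metis open_ball open_contains_ball)
    obtain t where t: "0 < t" "t \<le> min \<delta> e" "open (g ` ball w t)"
    proof -
      have "min \<delta> e > 0" using \<delta> e by simp
      from nonpole_ball[OF s(3)[OF w] this] show ?thesis using that unfolding g_def by metis
    qed
    then obtain u where u: "u > 0" "ball (g w) u \<subseteq> g ` ball w t"
      by (metis centre_in_ball image_eqI open_contains_ball)
    have "chordal ((f ^^ k) (Some v)) ((f ^^ k) (Some (g w))) < \<epsilon>" if "dist v (g w) < u" for k v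
    proof -
      have "v \<in> g ` ball w t" using that by (intro subsetD[OF u(2)]) (simp add: dist_commute)
      then obtain v' where v': "v = g v'" "v' \<in> ball w t" by blast
      have "v' \<in> ball z s" using v'(2) t(2) by (intro subsetD[OF e(2)]) simp
      then show ?thesis using \<delta>(2)[of v' "Suc k"] step[OF w] step[of v'] v' t(2) by (simp add: dist_commute)
    qed
    then show "\<exists>\<delta>>0. \<forall>k v. dist v (g w) < \<delta> \<longrightarrow> chordal ((f ^^ k) (Some v)) ((f ^^ k) (Some (g w))) < \<epsilon>"
      using u(1) by blast
  qed
  obtain u where u: "u > 0" "ball (g z) u \<subseteq> g ` ball z s"
    using s(1,4) by (metis centre_in_ball image_eqI open_contains_ball)
  have "equicont_at f v" if "dist v (g z) < u" for v
  proof -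
    have "v \<in> g ` ball z s" using that by (intro subsetD[OF u(2)]) (simp add: dist_commute)
    then obtain v' where "v = g v'" "v' \<in> ball z s" by blast
    then show ?thesis using eq by simp
  qed
  then have "g z \<notin> J" using not_finite_julia_iff[OF iterates_continuous] u(1) by blast
  then show ?thesis by (simp add: g_def)
qed

lemma julia_invariant: "poly Q z \<noteq> 0 \<Longrightarrow> z \<in> J \<longleftrightarrow> poly P z / poly Q z \<in> J"
  using julia_backward julia_forward by blast

text \<open>If the iterates avoid a disc about \<open>w\<close>, then \<open>1 / (f\<^sup>k - w)\<close> is a uniformly bounded sequence of
  holomorphic functions, hence uniformly Lipschitz by Cauchy's estimate.\<close>

lemma julia_orbits_dense:
  assumes z: "z \<in> J" and \<rho>: "\<rho> > 0" and \<epsilon>: "\<epsilon> > 0"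
  shows "\<exists>u k x. dist u z < \<rho> \<and> (f ^^ k) (Some u) = Some x \<and> dist x w < \<epsilon>"
proof (rule ccontr)
  assume no: "\<not> ?thesis"
  have "equicont_at f v" if v: "dist v z < \<rho>/2" for v
    unfolding equicont_at_def
  proof (intro allI impI)
    fix \<eta> :: real assume \<eta>: "\<eta> > 0"
    \<comment> \<open>Cauchy's estimate on discs of radius \<open>\<rho>/8\<close>; these remain in
      \<open>ball z \<rho>\<close> because 1/2 + 1/4 + 1/8 < 1.\<close>
    define C where "C = (1/\<epsilon>) / (\<rho>/8)"
    define W where "W = 1 + cmod w"
    have C: "C > 0" using \<epsilon> \<rho> by (simp add: C_def)
    have W: "W \<ge> 1" by (simp add: W_def)
    define \<delta> where "\<delta> = min (\<rho>/4) (\<eta> / (4 * C * W^2))"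
    have \<delta>: "\<delta> > 0" using \<rho> \<eta> C W by (simp add: \<delta>_def)
    have "chordal ((f ^^ k) (Some u)) ((f ^^ k) (Some v)) < \<eta>" if u: "dist u v < \<delta>" for k u
    proof -
      obtain a b where ab: "a holomorphic_on UNIV" "b holomorphic_on UNIV"
        "\<And>z. a z \<noteq> 0 \<or> b z \<noteq> 0" "\<And>z. (f ^^ k) (Some z) = quot_point (a z) (b z)"
        using iterate_quot_point by blast
      have far: "a x - w * b x \<noteq> 0 \<and> cmod (b x) * \<epsilon> \<le> cmod (a x - w * b x)" if x: "dist x z < \<rho>" for x
      proof (cases "b x = 0")
        case True
        then show ?thesis using ab(3)[of x] by simp
      next
        case False
        then have "\<not> dist (a x / b x) w < \<epsilon>" using no x ab(4)[of x] by (auto simp: quot_point_def)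
        then have "cmod (a x / b x - w) \<ge> \<epsilon>" by (simp add: dist_norm)
        moreover have "a x - w * b x = b x * (a x / b x - w)" using False by (simp add: field_simps)
        ultimately have "cmod (b x) * \<epsilon> \<le> cmod (a x - w * b x)"
          by (simp add: norm_mult mult_left_mono)
        moreover have "cmod (b x) * \<epsilon> > 0" using False \<epsilon> by simp
        ultimately show ?thesis by auto
      qed
      \<comment> \<open>This is \<open>1 / (f^k - w)\<close>, with the value 0 at poles of the
        iterate; by \<open>far\<close> its denominator has no zero.\<close>
      define F where "F = (\<lambda>x. b x / (a x - w * b x))"
      have hol: "F holomorphic_on ball z \<rho>"
        unfolding F_def using far
        by (intro holomorphic_intros holomorphic_on_subset[OF ab(1)] holomorphic_on_subset[OF ab(2)])
           (auto simp: dist_commute)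
      have bd: "cmod (F x) \<le> 1/\<epsilon>" if "dist x z < \<rho>" for x
      proof -
        have "cmod (a x - w * b x) > 0" using far[OF that] by simp
        then show ?thesis using far[OF that] \<epsilon> by (simp add: F_def norm_divide divide_simps)
      qed
      have der: "cmod (deriv F x) \<le> C" if x: "x \<in> ball v (\<rho>/4)" for x
      proof -
        have sub: "cball x (\<rho>/8) \<subseteq> ball z \<rho>"
        proof
          fix y assume "y \<in> cball x (\<rho>/8)"
          then show "y \<in> ball z \<rho>" using x v \<rho> dist_triangle[of z y x] dist_triangle[of z x v]
            by (simp add: dist_commute)
        qed
        have "cmod ((deriv ^^ 1) F x) \<le> fact 1 * (1/\<epsilon>) / (\<rho>/8)^1"
        proof (rule Cauchy_inequality)
          show "F holomorphic_on ball x (\<rho>/8)" using hol sub holomorphic_on_subset ball_subset_cball by blast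
          show "continuous_on (cball x (\<rho>/8)) F"
            using hol sub holomorphic_on_subset holomorphic_on_imp_continuous_on by blast
          show "0 < \<rho>/8" using \<rho> by simp
          fix y assume "cmod (x - y) = \<rho>/8"
          then have "y \<in> cball x (\<rho>/8)" by (simp add: dist_norm)
          then show "cmod (F y) \<le> 1/\<epsilon>" using sub bd by (auto simp: dist_commute)
        qed
        then show ?thesis by (simp add: C_def)
      qed
      have ub: "u \<in> ball v (\<rho>/4)" using u by (simp add: \<delta>_def dist_commute)
      have bsub: "ball v (\<rho>/4) \<subseteq> ball z \<rho>"
      proof
        fix y assume "y \<in> ball v (\<rho>/4)"
        then show "y \<in> ball z \<rho>" using v \<rho> dist_triangle[of z y v] by (simp add: dist_commute)
      qed
      have Lip: "cmod (F u - F v) \<le> C * cmod (u - v)"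
      proof (rule field_differentiable_bound[of "ball v (\<rho>/4)" F "deriv F"])
        show "(F has_field_derivative deriv F x) (at x within ball v (\<rho>/4))" if "x \<in> ball v (\<rho>/4)" for x
          using hol that bsub by (metis has_field_derivative_at_within holomorphic_derivI open_ball subsetD)
      qed (use der ub \<rho> in auto)
      define A where "A = (\<lambda>x. sqrt ((cmod (a x))^2 + (cmod (b x))^2))"
      have A: "cmod (a x - w * b x) \<le> W * A x" "A x > 0" for x
      proof -
        have 1: "cmod (a x) \<le> A x" "cmod (b x) \<le> A x" by (auto simp: A_def real_le_rsqrt)
        have "cmod (a x - w * b x) \<le> cmod (a x) + cmod w * cmod (b x)"
          by (metis norm_mult norm_triangle_ineq4)
        also have "\<dots> \<le> A x + cmod w * A x" using 1 by (intro add_mono mult_left_mono) auto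
        finally show "cmod (a x - w * b x) \<le> W * A x" by (simp add: W_def algebra_simps)
        show "A x > 0" using hom_norm_pos[OF ab(3)] by (simp add: A_def)
      qed
      have du: "dist u z < \<rho>" "dist v z < \<rho>" using subsetD[OF bsub ub] v \<rho> by (auto simp: dist_commute)
      \<comment> \<open>The determinant in the chordal distance is the difference of two values of
        \<open>F\<close> times the two denominators, and these are at most \<open>W\<close> times
        the norms of the pairs. So the Lipschitz bound for \<open>F\<close> carries over.\<close>
      have num: "a u * b v - b u * a v = (F v - F u) * ((a u - w * b u) * (a v - w * b v))"
        unfolding F_def using far[OF du(1)] far[OF du(2)] by (simp add: divide_simps) (simp add: algebra_simps)
      have "chordal ((f ^^ k) (Some u)) ((f ^^ k) (Some v)) = 2 * cmod (a u * b v - b u * a v) / (A u * A v)"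
        unfolding ab(4) A_def using chordal_quot_point[OF ab(3) ab(3)] by simp
      also have "\<dots> \<le> 2 * (C * cmod (u - v) * ((W * A u) * (W * A v))) / (A u * A v)"
        unfolding num norm_mult using Lip A C W
        by (intro divide_right_mono mult_left_mono mult_mono) (auto simp: norm_minus_commute less_imp_le)
      also have "\<dots> = 2 * C * W^2 * cmod (u - v)"
        using A(2)[of u] A(2)[of v] by (simp add: power2_eq_square field_simps)
      also have "\<dots> < 2 * C * W^2 * (\<eta> / (2 * C * W^2))"
      proof (rule mult_strict_left_mono)
        have "cmod (u - v) < \<eta> / (4 * C * W^2)" using u by (simp add: \<delta>_def dist_norm)
        also have "\<dots> \<le> \<eta> / (2 * C * W^2)" using C W \<eta> by (intro divide_left_mono) auto
        finally show "cmod (u - v) < \<eta> / (2 * C * W^2)" .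
        show "0 < 2 * C * W^2" using C W by simp
      qed
      also have "\<dots> = \<eta>" using C W by simp
      finally show ?thesis .
    qed
    then show "\<exists>\<delta>>0. \<forall>k u. dist u v < \<delta> \<longrightarrow> chordal ((f ^^ k) (Some u)) ((f ^^ k) (Some v)) < \<eta>"
      using \<delta> by blast
  qed
  then show False
    using z \<rho> not_finite_julia_iff[OF iterates_continuous] half_gt_zero by blast
qed

text \<open>An orbit that starts in the Julia set stays there as long as it is finite, and it cannot
  return from the fixed point infinity. Yet every open part of the Julia set contains starting
  points whose orbits come arbitrarily close to \<open>x\<close>.\<close>

lemma julia_empty_interior:
  assumes inf: "f None = None" and x: "x \<notin> J"
  shows "interior J = {}"
proof (rule ccontr)
  assume "interior J \<noteq> {}"
  then obtain z r where zr: "r > 0" "ball z r \<subseteq> J" by (metis ex_in_conv mem_interior)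
  obtain \<epsilon> where \<epsilon>: "\<epsilon> > 0" "ball x \<epsilon> \<subseteq> - J" using closed_J x
    by (metis ComplI closed_def open_contains_ball)
  have orbit: "(f ^^ k) (Some u) = Some y \<Longrightarrow> u \<in> J \<Longrightarrow> y \<in> J" for k u y
  proof (induction k arbitrary: y)
    case (Suc k)
    show ?case
    proof (cases "(f ^^ k) (Some u)")
      case None
      then show ?thesis using Suc.prems inf by simp
    next
      case (Some v)
      then have v: "v \<in> J" using Suc by simp
      have fv: "f (Some v) = Some y" using Suc.prems Some by simp
      then have Qv: "poly Q v \<noteq> 0" using Some_pole by force
      then show ?thesis using Some_nonpole[OF Qv] fv julia_invariant[OF Qv] v by simp
    qed
  qed simp
  have "z \<in> J" using zr by auto
  then obtain u k y where "dist u z < r" "(f ^^ k) (Some u) = Some y" "dist y x < \<epsilon>"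
    using julia_orbits_dense[OF _ zr(1) \<epsilon>(1)] by blast
  then show False using orbit[of k u y] zr \<epsilon> by (auto simp: dist_commute subset_iff)
qed

text \<open>A disc about the pole covers a neighbourhood of infinity, hence contains a preimage of
  \<open>y k\<close> for some large \<open>k\<close>. This point reaches the fixed value
  \<open>y0\<close> after \<open>k + 1\<close> steps, while the pole itself stays at infinity, so
  equicontinuity fails. In the application \<open>y\<close> is a backward orbit tending to the
  repelling point infinity.\<close>

lemma pole_in_julia:
  assumes inf: "f None = None" and pole: "poly Q z = 0"
    and orb: "\<And>k. (f ^^ k) (Some (y k)) = Some y0" and lim: "filterlim y at_infinity sequentially"
  shows "z \<in> J"
proof (rule ccontr)
  assume "z \<notin> J"
  then have eq: "equicont_at f z" by (rule equicont_at_finite_julia[OF iterates_continuous])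
  define \<epsilon> where "\<epsilon> = chordal None (Some y0)"
  have \<epsilon>: "\<epsilon> > 0" unfolding \<epsilon>_def using chordal_None_ge[of y0]
    by (rule less_le_trans[rotated]) (simp add: add_pos_nonneg)
  then obtain \<delta> where \<delta>: "\<delta> > 0" "\<And>k w. dist w z < \<delta> \<Longrightarrow> chordal ((f ^^ k) (Some w)) ((f ^^ k) (Some z)) < \<epsilon>"
    using eq unfolding equicont_at_def by metis
  have Pz: "poly P z \<noteq> 0" using no_common_zero pole by auto
  have "open {w. poly P w \<noteq> 0}" by (intro open_Collect_neq continuous_intros)
  then obtain t where t: "t > 0" "ball z t \<subseteq> {w. poly P w \<noteq> 0}"
    using Pz by (auto elim!: openE[of _ z])
  define s where "s = min \<delta> t"
  have s: "s > 0" "s \<le> \<delta>" "\<And>w. w \<in> ball z s \<Longrightarrow> poly P w \<noteq> 0"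
    using t \<delta> by (auto simp: s_def)
  \<comment> \<open>The reciprocal of the map is holomorphic at the pole, so the open mapping
    theorem applies there.\<close>
  define u where "u = (\<lambda>w. poly Q w / poly P w)"
  have hol: "u holomorphic_on ball z s"
    unfolding u_def using s(3) by (intro holomorphic_intros) auto
  have "\<not> u constant_on ball z s"
  proof
    assume "u constant_on ball z s"
    then obtain c where c: "\<And>w. w \<in> ball z s \<Longrightarrow> u w = c" unfolding constant_on_def by auto
    have "c = 0" using c[of z] s(1) pole by (simp add: u_def)
    then have "ball z s \<subseteq> {w. poly Q w = 0}" using c s(3) by (auto simp: u_def)
    then have "finite (ball z s)" using poly_roots_finite[OF not_constant(2)] finite_subset by blast
    then show False using s(1) uncountable_ball countable_finite by blast
  qed
  then have "open (u ` ball z s)" by (intro open_mapping_thm[OF hol]) auto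
  moreover have "0 \<in> u ` ball z s" using s(1) pole by (intro image_eqI[of _ _ z]) (auto simp: u_def)
  ultimately obtain e where e: "e > 0" "ball 0 e \<subseteq> u ` ball z s" by (meson open_contains_ball)
  have "\<forall>\<^sub>F k in sequentially. norm (y k) \<ge> 2 / e"
    using lim e(1) unfolding filterlim_at_infinity[OF order_refl] by simp
  then obtain k where k: "norm (y k) \<ge> 2 / e" unfolding eventually_sequentially by blast
  then have y0: "y k \<noteq> 0" using e(1) by (metis norm_zero divide_pos_pos linorder_not_less zero_less_numeral)
  have "norm (1 / y k) < e"
  proof -
    have "2 \<le> norm (y k) * e" using k e(1) by (simp add: field_simps)
    then show ?thesis using y0 by (simp add: norm_divide divide_simps mult.commute)
  qed
  then obtain w where w: "w \<in> ball z s" "u w = 1 / y k" using e(2) by (force simp: dist_norm)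
  then have "poly Q w \<noteq> 0" using y0 by (auto simp: u_def)
  moreover have "poly P w / poly Q w = y k"
    using w(2) y0 s(3)[OF w(1)] \<open>poly Q w \<noteq> 0\<close> by (simp add: u_def field_simps)
  ultimately have "f (Some w) = Some (y k)" using Some_nonpole by simp
  then have 1: "(f ^^ Suc k) (Some w) = Some y0"
    using orb[of k] by (simp add: funpow_Suc_right del: funpow.simps)
  have "(f ^^ j) None = None" for j by (induction j) (simp_all add: inf)
  then have 2: "(f ^^ Suc k) (Some z) = None"
    using Some_pole[OF pole] by (simp add: funpow_Suc_right del: funpow.simps)
  have "chordal ((f ^^ Suc k) (Some w)) ((f ^^ Suc k) (Some z)) < \<epsilon>"
    using w(1) s(2) by (intro \<delta>) (auto simp: dist_commute)
  then show False unfolding 1 2 \<epsilon>_def by (simp add: chordal_commute)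
qed

end

section \<open>The polynomial \<open>z\<^sup>m (z\<^sup>n - 1)\<close>\<close>

lemma poly_pmn: "poly (pmn m n) z = z ^ m * (z ^ n - 1)"
  by (simp add: pmn_def poly_monom)

lemma rational_map_pmn:
  assumes "n \<ge> 2"
  shows "rational_map (pmn m n) 1"
proof
  fix c
  show "pmn m n \<noteq> smult c 1"
  proof
    assume *: "pmn m n = smult c 1"
    have "poly (pmn m n) 1 = 0" by (simp add: poly_pmn)
    then have "c = 0" by (simp add: *)
    then have "poly (pmn m n) 2 = 0" using * by simp
    then have "(2::complex) ^ n = 1" by (simp add: poly_pmn)
    then have "(2::real) ^ n = 1" by (metis norm_numeral norm_power norm_one)
    then show False using assms by (metis numeral_One one_less_numeral_iff one_less_power order.strict_trans2 pos2 semiring_norm(76) less_irrefl)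
  qed
qed auto

abbreviation julia_pmn :: "nat \<Rightarrow> nat \<Rightarrow> complex set" where
  "julia_pmn m n \<equiv> finite_julia (poly_sphere (pmn m n))"

lemma poly_sphere_iterate: "(poly_sphere p ^^ k) (Some z) = Some ((poly p ^^ k) z)"
proof (induction k)
  case (Suc k)
  have "poly_sphere p (Some w) = Some (poly p w)" for w by (simp add: poly_sphere_def rat_sphere_def)
  then show ?case using Suc by simp
qed simp

context
  fixes m n :: nat
  assumes n: "n \<ge> 2"
begin

interpretation rational_map "pmn m n" 1 by (rule rational_map_pmn[OF n])

lemma J_eq: "J = julia_pmn m n" by (simp add: poly_sphere_def)

lemma continuous_iterates_pmn: "iterates_continuous (poly_sphere (pmn m n))"
  using iterates_continuous by (simp add: poly_sphere_def)

lemma closed_julia_pmn: "closed (julia_pmn m n)"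
  using closed_J by (simp add: J_eq)

lemma julia_pmn_invariant: "z \<in> julia_pmn m n \<longleftrightarrow> poly (pmn m n) z \<in> julia_pmn m n"
  using julia_invariant[of z] by (simp add: J_eq)

text \<open>Escape radius 3: beyond it, \<open>cmod (z^n - 1) >= (cmod z)^2 - 1 >= 3 * cmod z - 1 >=
  2 * cmod z\<close>.\<close>

lemma pmn_expands:
  assumes "cmod z > 3"
  shows "cmod (poly (pmn m n) z) \<ge> 2 * cmod z"
proof -
  have "(cmod z)^2 \<le> cmod z ^ n" using assms n by (intro power_increasing) auto
  also have "\<dots> \<le> cmod (z ^ n - 1) + 1"
    using norm_triangle_ineq[of "z^n - 1" 1] by (simp add: norm_power)
  finally have 1: "cmod (z ^ n - 1) \<ge> (cmod z)^2 - 1" by simp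
  have "3 * cmod z \<le> (cmod z)^2" unfolding power2_eq_square using assms by (intro mult_right_mono) auto
  with 1 assms have 2: "cmod (z ^ n - 1) \<ge> 2 * cmod z" by simp
  have "1 \<le> cmod (z ^ m)" using assms by (simp add: norm_power)
  then have "cmod (z ^ n - 1) \<le> cmod (z^m) * cmod (z ^ n - 1)"
    by (simp add: mult_le_cancel_right1)
  with 2 show ?thesis by (simp add: poly_pmn norm_mult)
qed

lemma pmn_iterates_expand:
  assumes "cmod z > 3"
  shows "cmod ((poly (pmn m n) ^^ k) z) \<ge> 2 ^ k * cmod z"
proof (induction k)
  case (Suc k)
  have "1 * 3 < (2::real) ^ k * cmod z" using assms by (intro mult_le_less_imp_less) auto
  then have "cmod ((poly (pmn m n) ^^ k) z) > 3" using Suc by simp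
  then show ?case using pmn_expands[of "(poly (pmn m n) ^^ k) z"] Suc by simp
qed simp

lemma julia_pmn_bounded:
  assumes "z \<in> julia_pmn m n"
  shows "cmod z \<le> 3"
proof (rule ccontr)
  assume z: "\<not> cmod z \<le> 3"
  define f where "f = poly_sphere (pmn m n)"
  have "equicont_at f w" if w: "dist w z < cmod z - 3" for w
  proof (rule uniform_limit_imp_equicont_at)
    show "iterates_continuous f" unfolding f_def by (rule continuous_iterates_pmn)
    have w3: "cmod w > 3" using w norm_triangle_ineq3[of w z] by (simp add: dist_norm)
    then show "cmod w - 3 > 0" by simp
    fix \<epsilon> :: real assume \<epsilon>: "\<epsilon> > 0"
    obtain k0 where k0: "1 / \<epsilon> < 2 ^ k0" using real_arch_pow[of 2 "1/\<epsilon>"] by auto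
    have "chordal ((f ^^ k) (Some v)) None < \<epsilon>" if k: "k \<ge> k0" and v: "dist v w < cmod w - 3" for k v
    proof -
      have v3: "cmod v > 3" using v norm_triangle_ineq3[of v w] by (simp add: dist_norm)
      define u where "u = (poly (pmn m n) ^^ k) v"
      have k1: "(2::real) ^ k0 \<le> 2 ^ k" using k by (intro power_increasing) auto
      have e1: "1 < \<epsilon> * 2 ^ k" using k0 k1 \<epsilon> by (auto simp: field_simps intro: less_le_trans)
      have "2 ^ k * 3 \<le> 2 ^ k * cmod v" using v3 by simp
      also have "\<dots> \<le> cmod u" unfolding u_def by (rule pmn_iterates_expand[OF v3])
      finally have u: "2 ^ k * 3 \<le> cmod u" .
      have u0: "cmod u > 0" using u by (smt (verit) zero_less_power)
      have "2 / cmod u < \<epsilon>"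
      proof -
        have "2 < \<epsilon> * (2 ^ k * 3)" using e1 by simp
        also have "\<dots> \<le> \<epsilon> * cmod u" using u \<epsilon> by (intro mult_left_mono) auto
        finally show ?thesis using u0 by (simp add: field_simps)
      qed
      then show ?thesis using chordal_None_le[OF u0]
        by (simp add: f_def poly_sphere_iterate u_def[symmetric] chordal_commute)
    qed
    then show "\<exists>k0. \<forall>k\<ge>k0. \<forall>v. dist v w < cmod w - 3 \<longrightarrow> chordal ((f ^^ k) (Some v)) None < \<epsilon>" by blast
  qed
  then have "z \<notin> finite_julia f"
    using not_finite_julia_iff[OF continuous_iterates_pmn] z unfolding f_def
    by (intro iffD2[OF not_finite_julia_iff[OF continuous_iterates_pmn]] exI[of _ "cmod z - 3"]) auto
  then show False using assms f_def by simp
qed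

text \<open>Boundary points of the filled Julia set \<open>K\<close> are Julia points, since bounded
  and escaping orbits start arbitrarily close together there. The boundary is nonempty because
  \<open>K\<close> contains a fixed point and misses 4.\<close>

lemma julia_pmn_nonempty: "julia_pmn m n \<noteq> {}"
proof -
  define p where "p = poly (pmn m n)"
  define K where "K = {z. \<forall>k. cmod ((p ^^ k) z) \<le> 3}"
  have cont: "continuous_on UNIV (p ^^ k)" for k
    by (induction k) (auto simp: p_def intro!: continuous_intros continuous_on_compose2[of UNIV "poly (pmn m n)" UNIV])
  have "closed K" unfolding K_def
    by (intro closed_Collect_all closed_Collect_le continuous_intros cont)
  have "K \<noteq> {}"
  proof -
    have deg: "\<not> constant (poly (pmn m n - [:0, 1:]))"
    proof
      assume "constant (poly (pmn m n - [:0, 1:]))"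
      then have "poly (pmn m n - [:0, 1:]) 4 = poly (pmn m n - [:0, 1:]) 1" by (metis constant_def)
      then have "poly (pmn m n) 4 = 3" by (simp add: poly_pmn)
      then show False using pmn_expands[of 4] by simp
    qed
    obtain z where "poly (pmn m n - [:0, 1:]) z = 0" using fundamental_theorem_of_algebra[OF deg] by blast
    then have pz: "p z = z" by (simp add: p_def)
    then have "(p ^^ k) z = z" for k by (induction k) auto
    moreover have "cmod z \<le> 3" using pmn_expands[of z] pz by (cases "cmod z > 3") (auto simp: p_def)
    ultimately have "z \<in> K" by (simp add: K_def)
    then show ?thesis by auto
  qed
  moreover have "4 \<notin> K" by (auto simp: K_def intro!: exI[of _ 0])
  ultimately have "frontier K \<noteq> {}" by (auto simp: frontier_eq_empty)
  then obtain z where z: "z \<in> frontier K" by auto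
  have zK: "z \<in> K" using z \<open>closed K\<close> by (simp add: frontier_def)
  have "z \<in> julia_pmn m n"
  proof (rule ccontr)
    assume "z \<notin> julia_pmn m n"
    then have "equicont_at (poly_sphere (pmn m n)) z"
      by (rule equicont_at_finite_julia[OF continuous_iterates_pmn])
    then obtain \<delta> where \<delta>: "\<delta> > 0"
      "\<And>k w. dist w z < \<delta> \<Longrightarrow> chordal (Some ((p ^^ k) w)) (Some ((p ^^ k) z)) < 1/4"
      unfolding equicont_at_def poly_sphere_iterate p_def by (metis zero_less_divide_1_iff zero_less_numeral)
    obtain w where w: "dist w z < \<delta>" "w \<notin> K"
      using z \<delta>(1) unfolding frontier_straddle by (metis dist_commute)
    then obtain k where k: "cmod ((p ^^ k) w) > 3" by (auto simp: K_def not_le)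
    \<comment> \<open>Four further steps multiply the modulus by at least 16. This brings
      \<open>u\<close> within chordal distance 1/8 of infinity, while points of modulus at most 3
      have distance at least 1/2 from it.\<close>
    define u where "u = (p ^^ (4 + k)) w"
    have "2 ^ 4 * cmod ((p ^^ k) w) \<le> cmod u"
      using pmn_iterates_expand[OF k, of 4] by (simp add: u_def p_def funpow_add)
    then have u: "cmod u \<ge> 16" using k by simp
    define v where "v = (p ^^ (4 + k)) z"
    have v: "cmod v \<le> 3" using zK by (simp add: K_def v_def)
    have 1: "chordal None (Some u) \<le> 1/8"
    proof -
      have "2 / cmod u \<le> 2 / 16" using u by (intro divide_left_mono) auto
      moreover have "chordal None (Some u) \<le> 2 / cmod u" using u by (intro chordal_None_le) linarith
      ultimately show ?thesis by linarith
    qed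
    have 2: "chordal None (Some v) \<ge> 1/2"
    proof -
      have "2 / 4 \<le> 2 / (1 + cmod v)" using v by (intro divide_left_mono) (auto simp: add_pos_nonneg)
      then show ?thesis using chordal_None_ge[of v] by simp
    qed
    have "chordal (Some u) (Some v) < 1/4" unfolding u_def v_def using \<delta>(2) w by blast
    then show False using 1 2 chordal_triangle[of None "Some v" "Some u"] by simp
  qed
  then show ?thesis by auto
qed

lemma pmn_rotate:
  assumes "a ^ n = 1"
  shows "poly (pmn m n) (a * z) = a ^ m * poly (pmn m n) z"
  using assms by (simp add: poly_pmn power_mult_distrib)

lemma julia_pmn_rotate:
  assumes a: "a ^ n = 1"
  shows "z \<in> julia_pmn m n \<longleftrightarrow> a * z \<in> julia_pmn m n"
proof -
  have rot: "z \<in> julia_pmn m n" if z: "a * z \<in> julia_pmn m n" and a: "a ^ n = 1" for a z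
  proof (rule finite_julia_rotate[OF continuous_iterates_pmn _ _ z])
    have an: "cmod a ^ n = 1" using a by (metis norm_one norm_power)
    then show a1: "cmod a = 1" using n power_eq_imp_eq_base[of "cmod a" n 1] by simp
    fix k
    have "(poly (pmn m n) ^^ k) (a * z) = a ^ (m ^ k) * (poly (pmn m n) ^^ k) z" for z
    proof (induction k)
      case (Suc k)
      have "(a ^ (m ^ k)) ^ n = 1" using a by (metis mult.commute power_mult power_one)
      then show ?case using Suc by (simp add: pmn_rotate power_mult[symmetric] mult.commute)
    qed simp
    then show "\<exists>b. cmod b = 1 \<and> (\<forall>z. (poly_sphere (pmn m n) ^^ k) (Some (a * z)) =
        ext_aff (\<lambda>z. b * z) ((poly_sphere (pmn m n) ^^ k) (Some z)))"
      using a1 by (intro exI[of _ "a ^ (m ^ k)"]) (simp add: poly_sphere_iterate ext_aff_def norm_power)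
  qed
  have a0: "a \<noteq> 0" using a n by (auto simp: power_0_left)
  have "inverse a * (a * z) = z" using a0 by simp
  moreover have "inverse a ^ n = 1" using a by (simp add: power_inverse)
  ultimately show ?thesis using rot[of a z] rot[of "inverse a" "a * z"] a by metis
qed

end

lemma root_of_unity_exists:
  assumes "n \<ge> (2::nat)"
  obtains \<omega> :: complex where "\<omega> ^ n = 1" "\<omega> \<noteq> 1" "cmod \<omega> = 1"
proof -
  define \<omega> where "\<omega> = cis (2 * pi / n)"
  have "real n * (2 * pi / real n) = 2 * pi" using assms by simp
  then have "\<omega> ^ n = 1" unfolding \<omega>_def using Complex.DeMoivre[of "2 * pi / real n" n] by (metis cis_2pi)
  moreover have "\<omega> \<noteq> 1"
  proof
    assume "\<omega> = 1"
    then have "cos (2 * pi / n) = 1" by (simp add: \<omega>_def complex_eq_iff)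
    moreover have "cos (2 * pi / n) < 1"
    proof -
      have "2 * pi / n \<le> pi" "0 < 2 * pi / n" using assms by (auto simp: field_simps)
      then have "cos (2 * pi / n) < cos 0" by (intro cos_monotone_0_pi) auto
      then show ?thesis by simp
    qed
    ultimately show False by simp
  qed
  ultimately show ?thesis by (intro that) (auto simp: \<omega>_def)
qed

text \<open>The smallest disc enclosing a rotation-invariant set is centred at 0: average \<open>|z + b|\<^sup>2\<close> over an orbit.\<close>

lemma rotation_invariant_centre:
  fixes S :: "complex set"
  assumes \<omega>: "\<omega> ^ n = 1" "\<omega> \<noteq> 1" "cmod \<omega> = 1" and n: "n > 0"
    and inv: "\<And>z. z \<in> S \<Longrightarrow> \<omega> * z \<in> S" and w: "w \<in> S"
    and b: "\<And>z. z \<in> S \<Longrightarrow> cmod (z + b) \<le> cmod w"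
  shows "b = 0"
proof -
  have S: "\<omega> ^ j * w \<in> S" for j by (induction j) (auto simp: w mult.assoc intro: inv)
  have sum0: "(\<Sum>j<n. \<omega> ^ j) = 0" using \<omega> by (simp add: sum_gp_strict)
  have sq: "(cmod (x + y))^2 = (cmod x)^2 + (cmod y)^2 + 2 * Re (x * cnj y)" for x y :: complex
    unfolding cmod_power2 by (simp add: power2_eq_square algebra_simps)
  have "(\<Sum>j<n. (cmod (\<omega> ^ j * w + b))^2) = (\<Sum>j<n. (cmod w)^2 + (cmod b)^2 + 2 * Re (\<omega> ^ j * w * cnj b))"
    unfolding sq using \<omega>(3) by (simp add: norm_mult norm_power)
  also have "\<dots> = n * ((cmod w)^2 + (cmod b)^2) + 2 * Re ((\<Sum>j<n. \<omega> ^ j) * w * cnj b)"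
    by (simp only: sum.distrib sum_distrib_right sum_distrib_left Re_sum) (simp add: distrib_left)
  finally have "(\<Sum>j<n. (cmod (\<omega> ^ j * w + b))^2) = n * ((cmod w)^2 + (cmod b)^2)" by (simp add: sum0)
  moreover have "(\<Sum>j<n. (cmod (\<omega> ^ j * w + b))^2) \<le> (\<Sum>j<n. (cmod w)^2)"
    using b[OF S] by (intro sum_mono power_mono) auto
  ultimately have "n * ((cmod w)^2 + (cmod b)^2) \<le> n * (cmod w)^2" by simp
  then have "(cmod b)^2 \<le> 0" using n by (simp add: mult_le_cancel_left)
  then show ?thesis by simp
qed

subsection \<open>Power sums of the roots of \<open>z\<^sup>m (z\<^sup>n - 1) = w\<close>\<close>

lemma norm_sum_mset_le:
  fixes g :: "complex \<Rightarrow> complex" and r :: real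
  assumes "\<And>x. x \<in># A \<Longrightarrow> cmod (g x) \<le> r"
  shows "cmod (\<Sum>x\<in>#A. g x) \<le> size A * r"
  using assms
proof (induction A)
  case (add x A)
  have "cmod (g x + (\<Sum>x\<in>#A. g x)) \<le> r + size A * r"
    using add by (intro order_trans[OF norm_triangle_ineq] add_mono) auto
  then show ?case by (simp add: algebra_simps)
qed simp

lemma sum_mset_member_le:
  fixes g :: "complex \<Rightarrow> real"
  assumes "\<And>x. g x \<ge> 0" "y \<in># A"
  shows "g y \<le> (\<Sum>x\<in>#A. g x)"
proof -
  have nn: "(\<Sum>x\<in>#B. g x) \<ge> 0" for B by (induction B) (auto simp: assms(1))
  obtain B where "A = add_mset y B" using multi_member_split[OF assms(2)] by blast
  then show ?thesis using nn[of B] by simp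
qed

text \<open>Newton's identities as a logarithmic derivative: \<open>E x\<close> is the geometric
  series \<open>x / (1 - x X)\<close>, so the sum of the \<open>E x\<close> is the generating series
  of the power sums.\<close>

lemma fps_deriv_prod_linear:
  fixes A :: "complex multiset"
  defines "E \<equiv> (\<lambda>x. Abs_fps (\<lambda>k. x ^ Suc k))"
  shows "fps_deriv (\<Prod>x\<in>#A. 1 - fps_const x * fps_X) = - (\<Sum>x\<in>#A. E x) * (\<Prod>x\<in>#A. 1 - fps_const x * fps_X)"
proof (induction A)
  case (add x A)
  have E: "E x * (1 - fps_const x * fps_X) = fps_const x" for x
  proof (rule fps_ext)
    fix k show "(E x * (1 - fps_const x * fps_X)) $ k = fps_const x $ k"
      by (cases k) (auto simp: E_def right_diff_distrib fps_mult_right_const_nth mult.assoc[symmetric])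
  qed
  define R where "R = (\<Prod>x\<in>#A. 1 - fps_const x * fps_X)"
  define T where "T = (\<Sum>x\<in>#A. E x)"
  have IH: "fps_deriv R = - T * R" using add unfolding R_def T_def .
  have d: "fps_deriv (1 - fps_const x * fps_X) = - (E x * (1 - fps_const x * fps_X))"
    unfolding E by simp
  have "fps_deriv ((1 - fps_const x * fps_X) * R) = - (E x + T) * ((1 - fps_const x * fps_X) * R)"
    unfolding fps_deriv_mult IH d by (simp add: algebra_simps)
  then show ?case by (simp add: R_def T_def)
qed simp

text \<open>The reversed polynomial is \<open>1 - X^n - w X^(m+n)\<close>, so \<open>w\<close>
  enters its logarithmic derivative only from degree \<open>m + n - 1\<close> on. The power sum of
  order \<open>m\<close> is the coefficient in degree \<open>m - 1\<close>.\<close>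

lemma power_sum_independent:
  assumes "m \<ge> 1" "n \<ge> 1"
  obtains s where "\<And>w A. pmn m n - [:w:] = (\<Prod>x\<in>#A. [:-x, 1:]) \<Longrightarrow> size A = m + n \<Longrightarrow> (\<Sum>x\<in>#A. x ^ m) = s"
proof
  fix w A assume A: "pmn m n - [:w:] = (\<Prod>x\<in>#A. [:-x, 1:])" and sz: "size A = m + n"
  define E where "E = (\<lambda>x::complex. Abs_fps (\<lambda>k. x ^ Suc k))"
  define R where "R = (\<Prod>x\<in>#A. 1 - fps_const x * fps_X)"
  define T where "T = (\<Sum>x\<in>#A. E x)"
  have R': "R = fps_of_poly (reflect_poly (\<Prod>x\<in>#A. [:-x, 1:]))"
    unfolding R_def
  proof (induction A)
    case (add x A)
    have "reflect_poly [:-x, 1:] = [:1, -x:]" by (simp add: reflect_poly_pCons' monom_Suc monom_0)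
    moreover have "fps_of_poly [:1, -x:] = 1 - fps_const x * fps_X" by (simp add: fps_of_poly_pCons)
    ultimately show ?case using add by (simp only: image_mset_add_mset prod_mset.add_mset reflect_poly_mult fps_of_poly_mult)
  qed simp
  have q: "coeff (pmn m n - [:w:]) j = (if j = m + n then 1 else 0) - (if j = m then 1 else 0) - (if j = 0 then w else 0)" for j
    by (auto simp: pmn_def right_diff_distrib mult_monom coeff_pCons split: nat.splits)
  have deg: "degree (pmn m n - [:w:]) = m + n"
    using assms by (intro antisym degree_le le_degree) (auto simp: q simp del: coeff_diff)
  have R: "R = 1 - fps_X ^ n - fps_const w * fps_X ^ (m + n)"
  proof (rule fps_ext)
    fix i
    have "R $ i = coeff (reflect_poly (pmn m n - [:w:])) i" by (simp add: R' A)
    also have "\<dots> = (if i = 0 then 1 else 0) - (if i = n then 1 else 0) - (if i = m + n then w else 0)"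
      unfolding coeff_reflect_poly deg q using assms by auto
    finally show "R $ i = (1 - fps_X ^ n - fps_const w * fps_X ^ (m + n)) $ i"
      using assms by auto
  qed
  have "fps_deriv R = - T * R" unfolding R_def T_def E_def by (rule fps_deriv_prod_linear)
  moreover have "fps_deriv R = - (of_nat n * fps_X ^ (n - 1)) - fps_const w * of_nat (m + n) * fps_X ^ (m + n - 1)"
    unfolding R by (simp add: fps_deriv_power mult.assoc fps_of_nat del: of_nat_add)
  ultimately have TR: "T * (1 - fps_X ^ n - fps_const w * fps_X ^ (m + n)) =
      of_nat n * fps_X ^ (n - 1) + fps_const w * of_nat (m + n) * fps_X ^ (m + n - 1)"
    unfolding R by (simp add: algebra_simps)
  have X: "fps_X ^ (m + n) = fps_X * fps_X ^ (m + n - 1)" using assms by (simp flip: power_Suc)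
  define I where "I = inverse (1 - fps_X ^ n :: complex fps)"
  have I: "(1 - fps_X ^ n) * I = 1" unfolding I_def using assms
    by (intro inverse_mult_eq_1') (simp add: fps_X_power_nth)
  \<comment> \<open>\<open>U\<close> collects all terms that contain \<open>w\<close> explicitly;
    its factor \<open>X^(m+n-1)\<close> removes it from the coefficient in degree
    \<open>m - 1\<close>.\<close>
  define U where "U = (fps_const w * of_nat (m + n) + fps_const w * fps_X * T) * I"
  have "T * (1 - fps_X ^ n) = of_nat n * fps_X ^ (n - 1) + fps_X ^ (m + n - 1) * (fps_const w * of_nat (m + n) + fps_const w * fps_X * T)"
    using TR unfolding X by (simp add: algebra_simps)
  then have "T * (1 - fps_X ^ n) * I = of_nat n * fps_X ^ (n - 1) * I + fps_X ^ (m + n - 1) * U"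
    by (simp only: U_def distrib_right mult.assoc)
  then have "T = of_nat n * fps_X ^ (n - 1) * I + fps_X ^ (m + n - 1) * U"
    using I by (simp add: mult.assoc)
  then have "T $ (m - 1) = (of_nat n * fps_X ^ (n - 1) * I) $ (m - 1)"
    using assms by (simp add: fps_X_power_mult_nth)
  moreover have "T $ k = (\<Sum>x\<in>#A. x ^ Suc k)" for k
    unfolding T_def by (induction A) (auto simp: E_def)
  ultimately show "(\<Sum>x\<in>#A. x ^ m) = (of_nat n * fps_X ^ (n - 1) * inverse (1 - fps_X ^ n :: complex fps)) $ (m - 1)"
    using assms(1) by (simp add: I_def)
qed

theorem sym_group_pmn:
  assumes n: "n \<ge> 2"
  shows "(\<lambda>z. a * z + b) \<in> sym_group (julia (poly_sphere (pmn m n))) \<longleftrightarrow> b = 0 \<and> a ^ n = 1"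
proof
  assume "b = 0 \<and> a ^ n = 1"
  moreover from this have "cmod a ^ n = 1" by (metis norm_one norm_power)
  then have "cmod a = 1" using n power_eq_imp_eq_base[of "cmod a" n 1] by simp
  ultimately show "(\<lambda>z. a * z + b) \<in> sym_group (julia (poly_sphere (pmn m n)))"
    unfolding sym_group_julia using julia_pmn_rotate[OF n] by simp
next
  assume "(\<lambda>z. a * z + b) \<in> sym_group (julia (poly_sphere (pmn m n)))"
  then have a: "cmod a = 1" and ab: "\<And>z. z \<in> julia_pmn m n \<longleftrightarrow> a * z + b \<in> julia_pmn m n"
    unfolding sym_group_julia by auto
  define S where "S = julia_pmn m n"
  have a0: "a \<noteq> 0" using a by auto
  have "compact S" unfolding compact_eq_bounded_closed S_def
    using closed_julia_pmn[OF n] julia_pmn_bounded[OF n] by (auto simp: bounded_iff)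
  then obtain w0 where w0: "w0 \<in> S" "\<And>z. z \<in> S \<Longrightarrow> cmod z \<le> cmod w0"
    using continuous_attains_sup[of S cmod] julia_pmn_nonempty[OF n] unfolding S_def
    by (auto intro: continuous_on_norm_id)
  obtain \<omega> where \<omega>: "\<omega> ^ n = 1" "\<omega> \<noteq> 1" "cmod \<omega> = 1" using root_of_unity_exists[OF n] .
  \<comment> \<open>Used twice: for the translation part of the symmetry, and for the mean over a
    fibre of the polynomial.\<close>
  have centre: "c = 0" if "\<And>z. z \<in> S \<Longrightarrow> cmod (z + c) \<le> cmod w0" for c
  proof (rule rotation_invariant_centre[OF \<omega> _ _ w0(1) that])
    show "\<omega> * z \<in> S" if "z \<in> S" for z using that julia_pmn_rotate[OF n \<omega>(1)] unfolding S_def by blast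
  qed (use n in auto)
  have "b / a = 0"
  proof (rule centre)
    fix z assume "z \<in> S"
    then have "cmod (a * z + b) \<le> cmod w0" using ab w0(2) unfolding S_def by blast
    moreover have "a * z + b = a * (z + b / a)" using a0 by (simp add: distrib_left)
    ultimately show "cmod (z + b / a) \<le> cmod w0" using a by (simp add: norm_mult)
  qed
  then have b: "b = 0" using a0 by simp
  \<comment> \<open>Chosen so that \<open>p(a z) = a^(m+n) * (p(z) + \<gamma> z^m)\<close>; the goal
    \<open>a^n = 1\<close> means \<open>\<gamma> = 0\<close>.\<close>
  define \<gamma> where "\<gamma> = 1 - inverse (a ^ n)"
  have key: "cmod (poly (pmn m n) z + \<gamma> * z ^ m) \<le> cmod w0" if "z \<in> S" for z
  proof -
    have "poly (pmn m n) (a * z) \<in> S"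
      using that ab[of z] b julia_pmn_invariant[OF n] unfolding S_def by (metis add.right_neutral)
    then have "cmod (poly (pmn m n) (a * z)) \<le> cmod w0" by (rule w0)
    moreover have "poly (pmn m n) (a * z) = a ^ m * a ^ n * (poly (pmn m n) z + \<gamma> * z ^ m)"
      using a0 by (simp add: poly_pmn \<gamma>_def power_mult_distrib field_simps)
    ultimately show ?thesis using a by (simp add: norm_mult norm_power)
  qed
  have roots: "\<exists>A. pmn m n - [:w:] = (\<Prod>x\<in>#A. [:-x, 1:]) \<and> size A = m + n \<and> (\<forall>x\<in>#A. poly (pmn m n) x = w)" for w
  proof -
    define q where "q = pmn m n - [:w:]"
    have q: "coeff q j = (if j = m + n then 1 else 0) - (if j = m then 1 else 0) - (if j = 0 then w else 0)" for j
      unfolding q_def by (auto simp: pmn_def right_diff_distrib mult_monom coeff_pCons split: nat.splits)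
    have deg: "degree q = m + n"
      using n by (intro antisym degree_le le_degree) (auto simp: q simp del: coeff_diff)
    then have lead: "lead_coeff q = 1" using n by (simp add: q)
    then have "q \<noteq> 0" by auto
    from alg_closed_imp_factorization[OF this]
    obtain A where A: "size A = degree q" "q = smult (lead_coeff q) (\<Prod>x\<in>#A. [:-x, 1:])"
      by (elim exE conjE)
    have qA: "q = (\<Prod>x\<in>#A. [:-x, 1:])"
      by (rule trans[OF A(2)]) (simp only: lead smult_1_left)
    have "poly (\<Prod>x\<in>#A. [:-x, 1:]) x = 0" if x: "x \<in># A" for x
    proof -
      obtain B where B: "A = add_mset x B" using multi_member_split[OF x] by blast
      have "poly ([:-x, 1:] * r) x = 0" for r by (simp only: poly_mult poly_pCons poly_0) simp
      then show ?thesis unfolding B by (simp only: image_mset_add_mset prod_mset.add_mset)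
    qed
    then have "\<forall>x\<in>#A. poly q x = 0" using qA by simp
    then have "\<forall>x\<in>#A. poly (pmn m n) x = w" by (simp add: q_def)
    then show ?thesis using A(1) deg qA unfolding q_def by (intro exI[of _ A] conjI) simp_all
  qed
  have "\<exists>s. \<forall>w A. pmn m n - [:w:] = (\<Prod>x\<in>#A. [:-x, 1:]) \<longrightarrow> size A = m + n \<longrightarrow> (\<Sum>x\<in>#A. x ^ m) = s"
  proof (cases "m = 0")
    case True
    then show ?thesis by (intro exI[of _ "of_nat n"]) auto
  next
    case False
    then have mn: "m \<ge> 1" "n \<ge> 1" using n by auto
    show ?thesis by (rule power_sum_independent[OF mn]) (rule exI, intro allI impI)
  qed
  then obtain s where s: "\<And>w A. pmn m n - [:w:] = (\<Prod>x\<in>#A. [:-x, 1:]) \<Longrightarrow> size A = m + n \<Longrightarrow> (\<Sum>x\<in>#A. x ^ m) = s"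
    by blast
  \<comment> \<open>The mean of \<open>w + \<gamma> x^m\<close> over the fibre above
    \<open>w\<close> is \<open>w\<close> plus a constant, because the power sum \<open>s\<close>
    does not depend on \<open>w\<close>. A mean of points of the disc lies in the disc, so
    \<open>centre\<close> applies to that constant.\<close>
  have "\<gamma> * s / of_nat (m + n) = 0"
  proof (rule centre)
    fix w assume w: "w \<in> S"
    obtain A where A: "pmn m n - [:w:] = (\<Prod>x\<in>#A. [:-x, 1:])" "size A = m + n" "\<And>x. x \<in># A \<Longrightarrow> poly (pmn m n) x = w"
      using roots by blast
    have "cmod (w + \<gamma> * x ^ m) \<le> cmod w0" if "x \<in># A" for x
      using key[of x] w julia_pmn_invariant[OF n, of x m] unfolding S_def A(3)[OF that] by simp
    then have "cmod (\<Sum>x\<in>#A. w + \<gamma> * x ^ m) \<le> size A * cmod w0" by (rule norm_sum_mset_le)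
    moreover have "(\<Sum>x\<in>#A. w + \<gamma> * x ^ m) = of_nat (size A) * w + \<gamma> * (\<Sum>x\<in>#A. x ^ m)"
      by (induction A) (auto simp: algebra_simps)
    ultimately have "cmod (of_nat (m + n) * w + \<gamma> * s) \<le> real (m + n) * cmod w0"
      using s[OF A(1,2)] A(2) by simp
    moreover have "of_nat (m + n) * w + \<gamma> * s = of_nat (m + n) * (w + \<gamma> * s / of_nat (m + n))"
      using n by (simp add: distrib_left del: of_nat_add)
    ultimately have "real (m + n) * cmod (w + \<gamma> * s / of_nat (m + n)) \<le> real (m + n) * cmod w0"
      by (metis norm_mult norm_of_nat)
    then show "cmod (w + \<gamma> * s / of_nat (m + n)) \<le> cmod w0" using n by (simp del: of_nat_add)
  qed
  then have \<gamma>s: "\<gamma> * s = 0" using n by (metis add_gr_0 divide_eq_0_iff less_le_trans not_gr_zero of_nat_eq_0_iff pos2)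
  obtain A where A: "pmn m n - [:w0:] = (\<Prod>x\<in>#A. [:-x, 1:])" "size A = m + n" "\<And>x. x \<in># A \<Longrightarrow> poly (pmn m n) x = w0"
    using roots by blast
  define g where "g = (\<lambda>x. \<gamma> * x ^ m)"
  \<comment> \<open>Above the extremal value \<open>w0\<close> each perturbation \<open>g x\<close>
    must point into the disc, while their sum \<open>\<gamma> * s\<close> vanishes. Adding these
    inequalities over the fibre forces every \<open>g x\<close> to be 0.\<close>
  have small: "(cmod (g x))^2 \<le> - 2 * Re (g x * cnj w0)" if "x \<in># A" for x
  proof -
    have "cmod (w0 + g x) \<le> cmod w0"
      using key[of x] w0(1) julia_pmn_invariant[OF n, of x m] unfolding S_def g_def A(3)[OF that] by simp
    then have "(cmod (w0 + g x))^2 \<le> (cmod w0)^2" by (intro power_mono) auto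
    then show ?thesis unfolding cmod_power2 by (simp add: power2_eq_square algebra_simps)
  qed
  have "(\<Sum>x\<in>#B. (cmod (g x))^2) \<le> - 2 * Re ((\<Sum>x\<in>#B. g x) * cnj w0)" if "\<And>x. x \<in># B \<Longrightarrow> (cmod (g x))^2 \<le> - 2 * Re (g x * cnj w0)" for B
    using that
  proof (induction B)
    case (add x B)
    then have "(\<Sum>x\<in>#B. (cmod (g x))^2) \<le> - 2 * Re ((\<Sum>x\<in>#B. g x) * cnj w0)" by simp
    moreover have "(cmod (g x))^2 \<le> - 2 * Re (g x * cnj w0)" using add.prems by simp
    moreover have "Re ((\<Sum>x\<in>#add_mset x B. g x) * cnj w0) = Re (g x * cnj w0) + Re ((\<Sum>x\<in>#B. g x) * cnj w0)"
      by (simp add: algebra_simps)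
    ultimately show ?case by simp
  qed simp
  from this[OF small] have "(\<Sum>x\<in>#A. (cmod (g x))^2) \<le> - 2 * Re ((\<Sum>x\<in>#A. g x) * cnj w0)" .
  moreover have "(\<Sum>x\<in>#A. g x) = \<gamma> * s"
    using s[OF A(1,2)] by (simp add: g_def flip: sum_mset_distrib_left)
  ultimately have sum0: "(\<Sum>x\<in>#A. (cmod (g x))^2) \<le> 0" using \<gamma>s by simp
  have "A \<noteq> {#}" using A(2) n by auto
  then obtain x where x: "x \<in># A" by auto
  have "(cmod (g x))^2 \<le> 0" using sum_mset_member_le[of "\<lambda>x. (cmod (g x))^2" x A, OF _ x] sum0
    by (meson order_trans zero_le_power2)
  then have gx: "\<gamma> * x ^ m = 0" by (simp add: g_def)
  \<comment> \<open>Otherwise a point of the fibre satisfies \<open>x^m = 0\<close>, hence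
    \<open>w0 = 0\<close> and the Julia set lies in \<open>{0}\<close>. But \<open>p(1) = 0\<close>
    would then put 1 into it.\<close>
  have "\<gamma> = 0"
  proof (rule ccontr)
    assume "\<gamma> \<noteq> 0"
    then have "x ^ m = 0" using gx by simp
    then have "w0 = 0" using A(3)[OF x] unfolding poly_pmn by (metis mult_zero_left)
    then have "S \<subseteq> {0}" using w0(2) by auto
    moreover have "1 \<in> S" using w0(1) \<open>w0 = 0\<close> julia_pmn_invariant[OF n, of 1 m] by (simp add: S_def poly_pmn)
    ultimately show False by auto
  qed
  then show "b = 0 \<and> a ^ n = 1" using b by (simp add: \<gamma>_def)
qed

section \<open>The relaxed Newton map of \<open>z\<^sup>m (z\<^sup>n - 1)\<close>\<close>

lemma coprime_poly_complexI:
  fixes P Q :: "complex poly"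
  assumes "Q \<noteq> 0" "\<And>z. poly P z \<noteq> 0 \<or> poly Q z \<noteq> 0"
  shows "coprime P Q"
proof (rule coprimeI)
  fix c assume c: "c dvd P" "c dvd Q"
  have c0: "c \<noteq> 0" using c(2) assms(1) by auto
  have "degree c = 0"
  proof (rule ccontr)
    assume "degree c \<noteq> 0"
    then obtain z where "poly c z = 0" using alg_closed_imp_poly_has_root[of c] by auto
    then have "poly P z = 0" "poly Q z = 0" using c by (auto elim!: dvdE)
    then show False using assms(2) by auto
  qed
  then show "is_unit c" using c0 by (simp add: is_unit_iff_degree)
qed

lemma rat_sphere_smult:
  assumes "c \<noteq> 0"
  shows "rat_sphere (smult c P) (smult c Q) = rat_sphere P Q"
  using assms by (intro ext) (auto simp: rat_sphere_def split: option.split)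

text \<open>The \<open>gcd\<close> is normalised, so it differs from \<open>G\<close> by a constant
  factor; this factor cancels in the quotient of the two polynomials.\<close>

lemma relaxed_newton_eq:
  fixes P Q G :: "complex poly"
  assumes num: "[:0, 1:] * pderiv p - smult h p = G * P" and den: "pderiv p = G * Q"
    and G: "G \<noteq> 0" and PQ: "coprime P Q"
  shows "relaxed_newton h p = rat_sphere P Q"
proof -
  define g where "g = gcd (G * P) (G * Q)"
  have g: "g = normalize G" unfolding g_def gcd_mult_left using PQ by simp
  have "is_unit (unit_factor G)" using G by simp
  then obtain c where c: "unit_factor G = [:c:]" "c \<noteq> 0"
    by (metis is_unit_poly_iff dvd_0_left not_is_unit_0 is_unit_pCons_iff pCons_0_0 pCons_eq_iff)
  have Gg: "G = g * [:c:]" using normalize_mult_unit_factor[of G] g c by simp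
  have g0: "g \<noteq> 0" using G g by simp
  have "G * P div g = smult c P" "G * Q div g = smult c Q"
    unfolding Gg mult.assoc using g0 by (simp_all only: nonzero_mult_div_cancel_left not_False_eq_True) simp_all
  then show ?thesis
    unfolding relaxed_newton_def Let_def num unfolding den g_def[symmetric] using rat_sphere_smult[OF c(2)] by simp
qed

text \<open>The directions of the small elements \<open>u k\<close> accumulate at some
  \<open>v\<close>. Suitable integer multiples of the \<open>u k\<close> then tend to
  \<open>t * v\<close>, and \<open>T\<close> is closed.\<close>

lemma closed_subgroup_line:
  fixes T :: "complex set"
  assumes T: "closed T" "0 \<in> T" "\<And>a b. a \<in> T \<Longrightarrow> b \<in> T \<Longrightarrow> a + b \<in> T" "\<And>a. a \<in> T \<Longrightarrow> - a \<in> T"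
    and u: "\<And>k. u k \<in> T" "\<And>k. u k \<noteq> 0" "u \<longlonglongrightarrow> 0"
  obtains v where "cmod v = 1" "\<And>t::real. t * v \<in> T"
proof -
  have nat: "of_nat j * a \<in> T" if "a \<in> T" for a and j :: nat
    using that T by (induction j) (auto simp: algebra_simps)
  have int: "of_int j * a \<in> T" if "a \<in> T" for a and j :: int
  proof (cases "j \<ge> 0")
    case True
    define k where "k = nat j"
    have j: "j = int k" using True by (simp add: k_def)
    show ?thesis using nat[OF that, of k] unfolding j by simp
  next
    case False
    define k where "k = nat (- j)"
    have j: "j = - int k" using False by (simp add: k_def)
    show ?thesis using T(4)[OF nat[OF that, of k]] unfolding j by simp
  qed
  have sph: "\<forall>k. u k / cmod (u k) \<in> sphere 0 1" using u(2) by (simp add: norm_divide)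
  have "seq_compact (sphere (0::complex) 1)" by (simp add: compact_imp_seq_compact)
  from seq_compactE[OF this sph] obtain v s where v: "v \<in> sphere 0 1" "strict_mono (s::nat \<Rightarrow> nat)" "((\<lambda>k. u k / cmod (u k)) \<circ> s) \<longlonglongrightarrow> v"
    by metis
  have "of_real t * v \<in> T" for t :: real
  proof -
    define r where "r = (\<lambda>k. cmod (u (s k)))"
    define x where "x = (\<lambda>k. of_int \<lfloor>t / r k\<rfloor> * u (s k))"
    have rpos: "r k > 0" for k using u(2) by (simp add: r_def)
    have r0: "r \<longlonglongrightarrow> 0" unfolding r_def
      using tendsto_norm[OF LIMSEQ_subseq_LIMSEQ[OF u(3) v(2)]] by (simp add: o_def)
    have fl: "(\<lambda>k. \<lfloor>t / r k\<rfloor> * r k) \<longlonglongrightarrow> t"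
    proof (rule tendsto_sandwich[of "\<lambda>k. t - r k" _ _ "\<lambda>k. t"])
      show "\<forall>\<^sub>F k in sequentially. t - r k \<le> \<lfloor>t / r k\<rfloor> * r k"
      proof (intro always_eventually allI)
        fix k
        have "t / r k - 1 \<le> \<lfloor>t / r k\<rfloor>" by linarith
        then have "(t / r k - 1) * r k \<le> \<lfloor>t / r k\<rfloor> * r k" using rpos[of k] by (intro mult_right_mono) auto
        then show "t - r k \<le> \<lfloor>t / r k\<rfloor> * r k" using rpos[of k] by (simp add: left_diff_distrib)
      qed
      show "\<forall>\<^sub>F k in sequentially. \<lfloor>t / r k\<rfloor> * r k \<le> t"
      proof (intro always_eventually allI)
        fix k
        have "\<lfloor>t / r k\<rfloor> * r k \<le> t / r k * r k" using rpos[of k] by (intro mult_right_mono) auto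
        then show "\<lfloor>t / r k\<rfloor> * r k \<le> t" using rpos[of k] by simp
      qed
    qed (use tendsto_diff[OF tendsto_const r0, of t] in auto)
    have "(\<lambda>k. of_real (\<lfloor>t / r k\<rfloor> * r k) * (u (s k) / r k)) \<longlonglongrightarrow> of_real t * v"
      using v(3) by (intro tendsto_mult tendsto_of_real fl) (simp add: o_def r_def)
    moreover have "of_real (\<lfloor>t / r k\<rfloor> * r k) * (u (s k) / r k) = x k" for k
      using rpos[of k] by (simp add: x_def)
    ultimately have "x \<longlonglongrightarrow> of_real t * v" by simp
    moreover have "x k \<in> T" for k unfolding x_def by (intro int u)
    ultimately show ?thesis using T(1) closed_sequentially by blast
  qed
  then show ?thesis using v(1) by (intro that[of v]) auto
qed

text \<open>A connected set transversal to \<open>v\<close> would sweep out an open set under the translations.\<close>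

lemma connected_subset_parallel:
  fixes J :: "complex set"
  assumes B: "open B" and v: "v \<noteq> 0"
    and inv: "\<And>z t. z \<in> J \<Longrightarrow> z \<in> B \<Longrightarrow> z + of_real t * v \<in> B \<Longrightarrow> z + of_real t * v \<in> J"
    and J: "interior J = {}"
    and S: "connected S" "S \<subseteq> J" "S \<subseteq> B" and zw: "z \<in> S" "w \<in> S"
  shows "Im (z / v) = Im (w / v)"
proof (rule ccontr)
  assume ne: "Im (z / v) \<noteq> Im (w / v)"
  define I where "I = (\<lambda>x. Im (x / v)) ` S"
  have cont: "continuous_on A (\<lambda>x. Im (x / v))" for A using v by (intro continuous_intros) auto
  have conn: "connected I" unfolding I_def by (rule connected_continuous_image[OF cont S(1)])
  define a b where "a = min (Im (z / v)) (Im (w / v))" and "b = max (Im (z / v)) (Im (w / v))"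
  have ab: "a < b" "a \<in> I" "b \<in> I" using ne zw by (auto simp: a_def b_def I_def min_def max_def)
  have sub: "{a..b} \<subseteq> I" using connected_contains_Icc[OF conn ab(2,3)] .
  \<comment> \<open>By connectedness the heights of \<open>S\<close> over the direction
    \<open>v\<close> fill the interval between those of \<open>z\<close> and \<open>w\<close>, so
    each point of the strip \<open>V\<close> is a translate of a point of \<open>S\<close>.
    Invariance is used only with both end points in \<open>B\<close>, so a merely local flow is
    enough.\<close>
  define V where "V = B \<inter> {x. a < Im (x / v) \<and> Im (x / v) < b}"
  have "open V" unfolding V_def
    by (intro open_Int B open_Collect_conj open_Collect_less cont continuous_on_const)
  moreover have "V \<subseteq> J"
  proof
    fix x assume x: "x \<in> V"
    then have "Im (x / v) \<in> I" using sub by (auto simp: V_def)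
    then obtain y where y: "y \<in> S" "Im (y / v) = Im (x / v)" by (auto simp: I_def)
    define t where "t = Re (x / v) - Re (y / v)"
    have "x / v = y / v + of_real t" using y(2) by (intro complex_eqI) (auto simp: t_def)
    then have "x / v * v = (y / v + of_real t) * v" by simp
    then have "x = y + of_real t * v" using v by (simp add: distrib_right)
    then show "x \<in> J" using inv[of y t] y S x by (auto simp: V_def)
  qed
  ultimately have "V \<subseteq> interior J" by (rule interior_maximal[rotated])
  moreover have "V \<noteq> {}"
  proof -
    have "(a + b) / 2 \<in> I" using sub ab(1) by auto
    then obtain y where "y \<in> S" "Im (y / v) = (a + b) / 2" by (auto simp: I_def)
    then have "y \<in> V" using S ab(1) by (auto simp: V_def)
    then show ?thesis by auto
  qed
  ultimately show False using J by auto
qed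

section \<open>Closed form of the Newton map, its reduction to lowest terms, and its poles\<close>

locale newton_pmn =
  fixes m n :: nat and h :: complex
  assumes n: "n \<ge> 2" and h: "cmod (h - 1) < 1"
begin

definition "d = complex_of_nat (m + n)"
definition "lam = 1 - h / d"
definition "kap = h * of_nat n / d"
text \<open>\<open>z - h p / p'\<close> in partial fractions with respect to \<open>z^n\<close>. At
  a pole the formula takes the value \<open>z * lam\<close>, since division by zero gives 0;
  identifying it with the Newton map therefore always excludes \<open>d * z^n = m\<close>.\<close>

definition "N z = z * (lam + kap / (d * z ^ n - of_nat m))"
definition "F = relaxed_newton h (pmn m n)"
abbreviation "J \<equiv> finite_julia F"

text \<open>For \<open>m > 0\<close> the common factor \<open>z^(m-1)\<close> of numerator and
  denominator has been divided out. For \<open>m = 0\<close> nothing cancels, and 0 is a pole of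
  order \<open>n - 1\<close>.\<close>

definition "PN = (if m = 0 then [:h:] + monom (d - h) n else monom 1 1 * (monom (d - h) n - [:of_nat m - h:]))"
definition "QN = (if m = 0 then monom d (n - 1) else monom d n - [:of_nat m:])"

lemma PN_QN_zero:
  assumes "m = 0"
  shows "PN = [:h:] + monom (d - h) n" "QN = monom d (n - 1)"
  unfolding PN_def QN_def using assms by (simp_all only: if_True simp_thms)

lemma PN_QN_pos:
  assumes "m \<noteq> 0"
  shows "PN = monom 1 1 * (monom (d - h) n - [:of_nat m - h:])" "QN = monom d n - [:of_nat m:]"
  unfolding PN_def QN_def using assms by (simp_all only: if_False simp_thms)

lemma d_nonzero: "d \<noteq> 0" using n by (simp add: d_def del: of_nat_add)

lemma cmod_d: "cmod d = m + n" by (simp add: d_def del: of_nat_add)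

text \<open>The assumption on \<open>h\<close> enters here: \<open>d - 1\<close> has modulus
  \<open>m + n - 1 >= 1\<close>, and \<open>h\<close> is closer than 1 to the point 1. Since
  \<open>lam = (d - h) / d\<close>, infinity becomes a repelling fixed point with
  \<open>0 < cmod lam < 1\<close>.\<close>

lemma cmod_diff_pos: "cmod (d - h) > 0" and cmod_diff_less: "cmod (d - h) < m + n"
proof -
  have d1: "cmod (d - 1) = real (m + n) - 1"
  proof -
    have "d - 1 = of_real (real (m + n) - 1)" by (simp add: d_def)
    then show ?thesis using n by (simp only: norm_of_real)
  qed
  have "cmod (d - 1) \<le> cmod (d - h) + cmod (h - 1)"
    using norm_triangle_ineq[of "d - h" "h - 1"] by simp
  moreover have "real n \<ge> 2" using n by simp
  ultimately show "cmod (d - h) > 0" using d1 h by linarith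
  have "cmod (d - h) \<le> cmod (d - 1) + cmod (1 - h)"
    using norm_triangle_ineq[of "d - 1" "1 - h"] by simp
  then show "cmod (d - h) < m + n" using d1 h n by (simp add: norm_minus_commute)
qed

lemma lam_eq: "lam = (d - h) / d" using d_nonzero by (simp add: lam_def diff_divide_distrib)

lemma lam_nonzero: "lam \<noteq> 0" using cmod_diff_pos d_nonzero by (auto simp: lam_eq)

lemma lam_less: "cmod lam < 1"
  using cmod_diff_less n by (simp add: lam_eq norm_divide cmod_d divide_less_eq)

lemma h_nonzero: "h \<noteq> 0" using h by auto

lemma kap_nonzero: "kap \<noteq> 0" using h_nonzero d_nonzero n by (simp add: kap_def)

lemma N_numerator: "lam * (d * x - of_nat m) + kap = (d - h) * x - (of_nat m - h)"
  using d_nonzero by (simp add: lam_def kap_def field_simps) (simp add: d_def algebra_simps)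

lemma poly_QN_0_iff: "poly QN z = 0 \<longleftrightarrow> d * z ^ n = of_nat m"
proof (cases "m = 0")
  case True
  then have "poly QN z = 0 \<longleftrightarrow> z = 0" unfolding PN_QN_zero[OF True]
    using d_nonzero n by (simp add: poly_monom)
  then show ?thesis using True d_nonzero n by auto
next
  case False
  then show ?thesis unfolding PN_QN_pos[OF False] by (simp add: poly_monom)
qed

lemma poly_PN_QN: "d * z ^ n \<noteq> of_nat m \<Longrightarrow> poly PN z / poly QN z = N z"
proof -
  assume ne: "d * z ^ n \<noteq> of_nat m"
  define D where "D = d * z ^ n - of_nat m"
  have D: "D \<noteq> 0" using ne by (simp add: D_def)
  have "lam + kap / D = (lam * D + kap) / D" using D by (simp add: add_divide_distrib)
  then have N: "N z = z * (lam * D + kap) / D" by (simp add: N_def D_def[symmetric])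
  have num: "lam * D + kap = (d - h) * z ^ n - (of_nat m - h)" unfolding D_def by (rule N_numerator)
  show ?thesis
  proof (cases "m = 0")
    case True
    then have z: "z \<noteq> 0" using ne n by (auto simp: power_0_left)
    have zn: "z ^ n = z * z ^ (n - 1)" using n by (simp flip: power_Suc)
    have "N z = z * (h + (d - h) * z ^ n) / (d * (z * z ^ (n - 1)))"
      unfolding N num using True by (simp add: D_def zn)
    also have "\<dots> = (h + (d - h) * z ^ n) / (d * z ^ (n - 1))" using z by simp
    finally show ?thesis unfolding PN_QN_zero[OF True] by (simp add: poly_monom)
  next
    case False
    show ?thesis unfolding N num PN_QN_pos[OF False] by (simp add: poly_monom D_def)
  qed
qed

lemma no_common_zero_PN_QN: "poly PN z \<noteq> 0 \<or> poly QN z \<noteq> 0"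
proof (rule ccontr)
  assume "\<not> ?thesis"
  then have P: "poly PN z = 0" and Q: "d * z ^ n = of_nat m" using poly_QN_0_iff by auto
  show False
  proof (cases "m = 0")
    case True
    then have "z = 0" using Q d_nonzero by simp
    then show False using P h_nonzero n unfolding PN_QN_zero[OF True] by (simp add: poly_monom power_0_left)
  next
    case False
    have "z * ((d - h) * z ^ n - (of_nat m - h)) = 0" using P unfolding PN_QN_pos[OF False] by (simp add: poly_monom)
    then have "z * kap = 0" using N_numerator[of "z ^ n"] Q by simp
    then have "z = 0" using kap_nonzero by simp
    then show False using Q n False by (simp add: power_0_left)
  qed
qed

lemma QN_nonzero: "QN \<noteq> 0"
proof
  assume "QN = 0"
  then have "poly QN 1 = 0" by simp
  then have "d = of_nat m" by (simp add: poly_QN_0_iff)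
  then show False using n by (simp add: d_def)
qed

lemma coprime_PN_QN: "coprime PN QN"
  using coprime_poly_complexI[OF QN_nonzero] no_common_zero_PN_QN by blast

lemma pderiv_pmn:
  "pderiv (pmn m n) = monom d (m + n - 1) - monom (of_nat m) (m - 1)"
  by (simp add: pmn_def right_diff_distrib mult_monom pderiv_diff pderiv_monom d_def del: of_nat_add)

lemma F_eq: "F = rat_sphere PN QN"
  unfolding F_def
proof (rule relaxed_newton_eq[OF _ _ _ coprime_PN_QN])
  define G where "G = (if m = 0 then 1 else monom 1 (m - 1) :: complex poly)"
  show "G \<noteq> 0" by (simp add: G_def)
  have x: "[:0, 1:] = monom (1::complex) 1" by (simp add: monom_Suc monom_0)
  show "pderiv (pmn m n) = G * QN"
  proof (cases "m = 0")
    case True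
    have "monom (of_nat m :: complex) (m - 1) = 0" using True by simp
    moreover have "m + n - 1 = n - 1" "G = 1" using True by (simp_all add: G_def)
    ultimately show ?thesis unfolding pderiv_pmn PN_QN_zero[OF True] by (simp only:) simp
  next
    case False
    have "[:of_nat m:] = monom (of_nat m :: complex) 0" by (simp add: monom_0)
    moreover have "m + n - 1 = m - 1 + n" using False by simp
    ultimately show ?thesis using False unfolding pderiv_pmn PN_QN_pos[OF False]
      by (simp add: G_def right_diff_distrib mult_monom)
  qed
  have p: "pmn m n = monom 1 (m + n) - monom 1 m" by (simp add: pmn_def right_diff_distrib mult_monom)
  have L: "[:0, 1:] * pderiv (pmn m n) - smult h (pmn m n) = monom (d - h) (m + n) - monom (of_nat m - h) m"
  proof -
    have "[:0, 1:] * pderiv (pmn m n) = monom d (m + n) - monom (of_nat m) m"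
    proof (cases "m = 0")
      case True
      have "Suc (n - 1) = n" using n by simp
      then show ?thesis using True unfolding pderiv_pmn x right_diff_distrib mult_monom by simp
    next
      case False
      then have "Suc (m + n - 1) = m + n" "Suc (m - 1) = m" using n by auto
      then show ?thesis unfolding pderiv_pmn x right_diff_distrib mult_monom by simp
    qed
    then show ?thesis unfolding p by (simp add: smult_diff_right smult_monom diff_monom[symmetric] algebra_simps)
  qed
  show "[:0, 1:] * pderiv (pmn m n) - smult h (pmn m n) = G * PN"
  proof (cases "m = 0")
    case True
    have "monom (of_nat m - h) m = monom (- h) 0" "monom (d - h) (m + n) = monom (d - h) n" "G = 1"
      using True by (simp_all add: G_def)
    then show ?thesis unfolding L PN_QN_zero[OF True] by (simp only:) (simp add: monom_0)
  next
    case False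
    have "[:of_nat m - h:] = monom (of_nat m - h) 0" by (simp add: monom_0)
    moreover have "m - 1 + (1 + n) = m + n" "m - 1 + 1 = m" using False by auto
    ultimately show ?thesis using False unfolding L PN_QN_pos[OF False]
      by (simp add: G_def right_diff_distrib mult_monom)
  qed
qed

lemma pole_exists: "\<exists>z. d * z ^ n = of_nat m"
proof -
  have "n \<noteq> 0" using n by simp
  then obtain z where "of_nat m / d = z ^ n" using exists_complex_root by metis
  then have "d * z ^ n = d * (of_nat m / d)" by simp
  then show ?thesis using d_nonzero by auto
qed

sublocale rat: rational_map PN QN
proof
  show "QN \<noteq> 0" by (rule QN_nonzero)
  show "poly PN z \<noteq> 0 \<or> poly QN z \<noteq> 0" for z by (rule no_common_zero_PN_QN)
  fix c show "PN \<noteq> smult c QN"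
  proof
    assume *: "PN = smult c QN"
    obtain z where "d * z ^ n = of_nat m"
      using pole_exists by blast
    then have "poly QN z = 0" by (simp add: poly_QN_0_iff)
    then have "poly PN z = 0" using * by simp
    then show False using no_common_zero_PN_QN[of z] \<open>poly QN z = 0\<close> by simp
  qed
qed

lemma continuous_iterates_F: "iterates_continuous F"
  using rat.iterates_continuous by (simp add: F_eq)

lemma closed_julia: "closed J" using rat.closed_J by (simp add: F_eq)

lemma F_Some: "d * z ^ n \<noteq> of_nat m \<Longrightarrow> F (Some z) = Some (N z)"
  using rat.Some_nonpole[of z] poly_PN_QN[of z] by (simp add: F_eq poly_QN_0_iff)

lemma F_pole: "d * z ^ n = of_nat m \<Longrightarrow> F (Some z) = None"
  using rat.Some_pole[of z] by (simp add: F_eq poly_QN_0_iff)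

lemma degree_QN_less: "degree QN < degree PN"
proof (cases "m = 0")
  case True
  have "coeff PN n = d - h" unfolding PN_QN_zero[OF True] using n by (simp add: coeff_pCons split: nat.split)
  then have "degree PN \<ge> n" using cmod_diff_pos by (intro le_degree) auto
  moreover have "degree QN \<le> n - 1" unfolding PN_QN_zero[OF True] by (rule degree_monom_le)
  ultimately show ?thesis using n by simp
next
  case False
  have "PN = monom (d - h) (1 + n) - monom (of_nat m - h) 1"
    unfolding PN_QN_pos[OF False] by (simp add: right_diff_distrib mult_monom flip: monom_0)
  then have "coeff PN (1 + n) = d - h" using n by simp
  then have "degree PN \<ge> 1 + n" using cmod_diff_pos by (intro le_degree) auto
  moreover have "degree QN \<le> n" unfolding PN_QN_pos[OF False] by (intro degree_diff_le degree_monom_le) simp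
  ultimately show ?thesis by simp
qed

lemma F_None: "F None = None"
  using degree_QN_less by (simp add: F_eq rat_sphere_def)

lemma julia_N: "d * z ^ n \<noteq> of_nat m \<Longrightarrow> z \<in> J \<longleftrightarrow> N z \<in> J"
  using rat.julia_invariant[of z] poly_PN_QN[of z] by (simp add: F_eq poly_QN_0_iff)

section \<open>Estimates near infinity, Julia points and Fatou points of the Newton map\<close>

lemma denominator_ge:
  assumes "cmod z \<ge> 1"
  shows "cmod (d * z ^ n - of_nat m) \<ge> n * cmod z ^ n"
proof -
  have "1 \<le> cmod z ^ n" using assms by simp
  then have "real m * 1 \<le> real m * cmod z ^ n" by (intro mult_left_mono) auto
  moreover have "cmod (d * z ^ n) - cmod (of_nat m :: complex) \<le> cmod (d * z ^ n - of_nat m)"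
    by (rule norm_triangle_ineq2)
  ultimately show ?thesis by (simp add: norm_mult norm_power cmod_d algebra_simps)
qed

lemma nonpole_large:
  assumes "cmod z \<ge> 1"
  shows "d * z ^ n \<noteq> of_nat m"
proof
  assume "d * z ^ n = of_nat m"
  then have "real n * cmod z ^ n \<le> 0" using denominator_ge[OF assms] by simp
  moreover have "real n * cmod z ^ n > 0" using assms n by (intro mult_pos_pos zero_less_power) auto
  ultimately show False by simp
qed

lemma N_large:
  assumes "cmod z \<ge> 1"
  shows "cmod (N z - lam * z) \<le> cmod kap / cmod z"
proof -
  have z0: "cmod z > 0" using assms by linarith
  have "cmod z * cmod z \<le> n * cmod z ^ n"
  proof -
    have "cmod z * cmod z = cmod z ^ 2" by (simp add: power2_eq_square)
    also have "\<dots> \<le> 1 * cmod z ^ n" using assms n by (simp add: power_increasing)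
    also have "\<dots> \<le> n * cmod z ^ n" using n by (intro mult_right_mono) auto
    finally show ?thesis .
  qed
  then have D: "cmod z * cmod z \<le> cmod (d * z ^ n - of_nat m)" using denominator_ge[OF assms] by linarith
  have "N z - lam * z = z * kap / (d * z ^ n - of_nat m)" by (simp add: N_def algebra_simps)
  then have "cmod (N z - lam * z) = cmod z * cmod kap / cmod (d * z ^ n - of_nat m)"
    by (simp add: norm_mult norm_divide)
  also have "\<dots> \<le> cmod z * cmod kap / (cmod z * cmod z)"
  proof (rule divide_left_mono[OF D])
    have zz: "cmod z * cmod z > 0" using z0 by simp
    show "0 < cmod (d * z ^ n - of_nat m) * (cmod z * cmod z)"
      by (rule mult_pos_pos[OF less_le_trans[OF zz D] zz])
  qed simp
  also have "\<dots> = cmod kap / cmod z" using z0 by simp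
  finally show ?thesis .
qed

text \<open>An inverse branch of \<open>N\<close> near infinity by Brouwer's theorem:
  \<open>N w = y\<close> is the fixed point equation \<open>w = (y - (N w - lam * w)) / lam\<close>,
  whose right side maps the unit disc about \<open>y / lam\<close> into itself.\<close>

lemma solve_N:
  assumes "cmod (y / lam) \<ge> 2 + cmod kap / cmod lam"
  obtains w where "cmod (w - y / lam) \<le> 1" "cmod w \<ge> 1" "N w = y"
proof -
  define S where "S = cball (y / lam) 1"
  have large: "cmod w \<ge> 1 + cmod kap / cmod lam" "cmod w \<ge> 1" if "w \<in> S" for w
  proof -
    have "cmod (y / lam) \<le> cmod w + 1"
      using that norm_triangle_ineq[of w "y / lam - w"] by (simp add: S_def dist_norm)
    then show "cmod w \<ge> 1 + cmod kap / cmod lam" using assms by linarith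
    moreover have "cmod kap / cmod lam \<ge> 0" by simp
    ultimately show "cmod w \<ge> 1" by linarith
  qed
  define g where "g = (\<lambda>w. (y - (N w - lam * w)) / lam)"
  have "continuous_on S g"
    unfolding g_def N_def using nonpole_large large lam_nonzero
    by (intro continuous_intros) auto
  moreover have "g w \<in> S" if "w \<in> S" for w
  proof -
    have w1: "cmod w \<ge> 1" using large that by blast
    have "cmod kap / cmod lam \<le> cmod w" using large(1)[OF that] by linarith
    then have k: "cmod kap \<le> cmod lam * cmod w" using lam_nonzero by (simp add: divide_le_eq mult.commute)
    have "y / lam - g w = (N w - lam * w) / lam" by (simp add: g_def diff_divide_distrib)
    then have "cmod (y / lam - g w) = cmod (N w - lam * w) / cmod lam" by (simp add: norm_divide)
    also have "\<dots> \<le> (cmod kap / cmod w) / cmod lam" by (intro divide_right_mono N_large w1) auto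
    also have "\<dots> \<le> 1"
    proof -
      have w0: "cmod w > 0" using w1 by linarith
      then have "cmod kap / cmod w \<le> cmod lam" using k by (simp add: divide_le_eq)
      then have "(cmod kap / cmod w) / cmod lam \<le> cmod lam / cmod lam" by (rule divide_right_mono) simp
      then show ?thesis using lam_nonzero by simp
    qed
    finally show ?thesis by (simp add: S_def dist_norm)
  qed
  ultimately obtain w where w: "w \<in> S" "g w = w"
    using brouwer[of S g] unfolding S_def by auto
  have "lam * g w = y - (N w - lam * w)" using lam_nonzero by (simp add: g_def)
  then have "N w = y" using w(2) by simp
  then show ?thesis using w(1) large(2)[OF w(1)] by (intro that) (auto simp: S_def dist_norm norm_minus_commute)
qed

text \<open>Inverse branches near infinity are chained to a backward orbit of the point
  \<open>R\<close> that tends to infinity, as \<open>rat.pole_in_julia\<close> requires.\<close>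

lemma pole_in_J:
  assumes "d * z ^ n = of_nat m"
  shows "z \<in> J"
proof -
  define \<mu> where "\<mu> = (1 + 1 / cmod lam) / 2"
  have lam0: "cmod lam > 0" using lam_nonzero by simp
  have l1: "1 / cmod lam > 1" using lam_less lam0 by (simp add: field_simps)
  then have mu1: "\<mu> > 1" by (simp add: \<mu>_def)
  \<comment> \<open>The first entry makes \<open>solve_N\<close> applicable. The second gives
    \<open>cmod y / cmod lam - 1 >= \<mu> * cmod y\<close>, where \<open>\<mu>\<close> is the
    midpoint of 1 and \<open>1 / cmod lam\<close>.\<close>
  define R where "R = max (2 + cmod kap / cmod lam) (2 / (1 / cmod lam - 1))"
  have step: "\<exists>w. cmod w \<ge> \<mu> * cmod y \<and> cmod w \<ge> 1 \<and> N w = y" if y: "cmod y \<ge> R" for y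
  proof -
    have 1: "cmod (y / lam) = cmod y * (1 / cmod lam)" by (simp add: norm_divide)
    have "cmod y * 1 \<le> cmod y * (1 / cmod lam)" using l1 by (intro mult_left_mono) auto
    then have "cmod (y / lam) \<ge> 2 + cmod kap / cmod lam" using y 1 by (simp add: R_def)
    then obtain w where w: "cmod (w - y / lam) \<le> 1" "cmod w \<ge> 1" "N w = y" using solve_N by blast
    have "cmod (y / lam) \<le> cmod w + 1"
      using w(1) norm_triangle_ineq[of w "y / lam - w"] by (simp add: norm_minus_commute)
    moreover have "2 \<le> cmod y * (1 / cmod lam - 1)"
      using y l1 by (auto simp: R_def divide_le_eq)
    ultimately have "cmod w \<ge> \<mu> * cmod y" using 1 by (simp add: \<mu>_def algebra_simps add_divide_distrib)
    then show ?thesis using w by blast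
  qed
  define nxt where "nxt = (\<lambda>y. SOME w. cmod w \<ge> \<mu> * cmod y \<and> cmod w \<ge> 1 \<and> N w = y)"
  have nxt: "cmod (nxt y) \<ge> \<mu> * cmod y \<and> cmod (nxt y) \<ge> 1 \<and> N (nxt y) = y" if "cmod y \<ge> R" for y
    unfolding nxt_def by (rule someI_ex[OF step[OF that]])
  define y where "y = (\<lambda>k. (nxt ^^ k) (of_real R))"
  have "cmod kap / cmod lam \<ge> 0" by simp
  then have R2: "R \<ge> 2" unfolding R_def by linarith
  have grow: "cmod (y k) \<ge> \<mu> ^ k * R" for k
  proof (induction k)
    case 0 then show ?case using R2 by (simp add: y_def)
  next
    case (Suc k)
    have "1 * R \<le> \<mu> ^ k * R" using mu1 R2 by (intro mult_right_mono) auto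
    then have "cmod (y k) \<ge> R" using Suc by simp
    then have "cmod (y (Suc k)) \<ge> \<mu> * cmod (y k)" using nxt by (simp add: y_def)
    moreover have "\<mu> * cmod (y k) \<ge> \<mu> * (\<mu> ^ k * R)" using Suc mu1 by (intro mult_left_mono) auto
    ultimately show ?case by (simp add: mult.assoc)
  qed
  have yR: "cmod (y k) \<ge> R" for k
  proof -
    have "1 * R \<le> \<mu> ^ k * R" using mu1 R2 by (intro mult_right_mono) auto
    then show ?thesis using grow[of k] by simp
  qed
  have Fy: "F (Some (y (Suc k))) = Some (y k)" for k
  proof -
    have "N (y (Suc k)) = y k" "cmod (y (Suc k)) \<ge> 1" using nxt[OF yR[of k]] by (auto simp: y_def)
    then show ?thesis using F_Some[OF nonpole_large] by simp
  qed
  have orb: "(F ^^ k) (Some (y k)) = Some (of_real R)" for k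
    by (induction k) (simp_all add: funpow_Suc_right Fy del: funpow.simps(2), simp add: y_def)
  have "filterlim (\<lambda>k. norm (y k)) at_top sequentially"
    unfolding filterlim_at_top
  proof
    fix Z :: real
    obtain k0 where k0: "Z < \<mu> ^ k0" using real_arch_pow[OF mu1] by blast
    have "Z \<le> norm (y k)" if "k \<ge> k0" for k
    proof -
      have "\<mu> ^ k0 \<le> \<mu> ^ k" using that mu1 by (intro power_increasing) auto
      also have "\<dots> \<le> \<mu> ^ k * R" using R2 mu1 by (simp add: mult_le_cancel_left1)
      finally show ?thesis using k0 grow[of k] by linarith
    qed
    then show "\<forall>\<^sub>F k in sequentially. Z \<le> norm (y k)" unfolding eventually_sequentially by blast
  qed
  then have lim: "filterlim y at_infinity sequentially" by (simp add: filterlim_at_infinity_conv_norm_at_top)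
  show ?thesis using rat.pole_in_julia[of z y, OF _ _ _ lim] F_None orb assms poly_QN_0_iff
    unfolding F_eq[symmetric] by blast
qed

lemma julia_nonempty: "J \<noteq> {}"
proof -
  obtain z where "d * z ^ n = of_nat m"
    using pole_exists by blast
  then show ?thesis using pole_in_J by auto
qed

text \<open>1 is a simple zero of the polynomial, hence an attracting fixed point of
  \<open>N\<close>, with multiplier \<open>1 - h\<close>. It is the Fatou point from which
  \<open>interior_J\<close> follows.\<close>

lemma one_not_in_J: "1 \<notin> J"
proof -
  have d1: "d * 1 ^ n \<noteq> of_nat m" by (rule nonpole_large) simp
  have dm: "d - of_nat m = of_nat n" by (simp add: d_def)
  have n0: "(of_nat n :: complex) \<noteq> 0" using n by simp
  have lk: "lam + kap / of_nat n = 1" using n0 by (simp add: lam_def kap_def)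
  have N1: "N 1 = 1" using lk dm by (simp add: N_def)
  have kd: "kap * d = h * of_nat n" using d_nonzero by (simp add: kap_def)
  have "(N has_field_derivative (1 - h)) (at 1)"
  proof -
    have "((\<lambda>z. z * (lam + kap / (d * z ^ n - of_nat m))) has_field_derivative
        (lam + kap / of_nat n) - kap * (d * of_nat n) / (of_nat n)^2) (at 1)"
      using d1 dm n0 n
      by (auto intro!: derivative_eq_intros simp: power2_eq_square)
    moreover have "(lam + kap / of_nat n) - kap * (d * of_nat n) / (of_nat n)^2 = 1 - h"
      unfolding lk mult.assoc[symmetric] kd using n0 by (simp add: power2_eq_square)
    ultimately show ?thesis by (simp add: N_def[abs_def])
  qed
  define q where "q = (cmod (1 - h) + 1) / 2"
  have q: "cmod (1 - h) < q" "q < 1" using h by (auto simp: q_def norm_minus_commute)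
  have "((\<lambda>z. (N z - N 1) / (z - 1)) \<longlongrightarrow> 1 - h) (at 1)"
    using \<open>(N has_field_derivative (1 - h)) (at 1)\<close> by (simp add: has_field_derivative_iff)
  then have "((\<lambda>z. cmod ((N z - N 1) / (z - 1))) \<longlongrightarrow> cmod (1 - h)) (at 1)" by (rule tendsto_norm)
  then have "\<forall>\<^sub>F z in at 1. cmod ((N z - N 1) / (z - 1)) < q" using q(1) by (rule order_tendstoD)
  moreover have "\<forall>\<^sub>F z in at 1. d * z ^ n \<noteq> of_nat m"
  proof -
    have "((\<lambda>z. d * z ^ n) \<longlongrightarrow> d * 1 ^ n) (at 1)" by (intro tendsto_intros)
    then show ?thesis using d1 by (rule tendsto_imp_eventually_ne)
  qed
  ultimately have "\<forall>\<^sub>F z in at 1. cmod ((N z - N 1) / (z - 1)) < q \<and> d * z ^ n \<noteq> of_nat m"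
    by (rule eventually_conj)
  then obtain r where r: "r > 0" "\<And>z. z \<noteq> 1 \<Longrightarrow> dist z 1 < r \<Longrightarrow> cmod ((N z - N 1) / (z - 1)) < q \<and> d * z ^ n \<noteq> of_nat m"
    unfolding eventually_at by auto
  have contr: "cmod (N z - 1) \<le> q * cmod (z - 1)" "d * z ^ n \<noteq> of_nat m" if "dist z 1 < r" for z
  proof -
    have "cmod (N z - 1) \<le> q * cmod (z - 1) \<and> d * z ^ n \<noteq> of_nat m"
    proof (cases "z = 1")
      case True
      then show ?thesis using N1 d1 by simp
    next
      case False
      then have "cmod (N z - N 1) / cmod (z - 1) < q" using r(2)[OF False that] by (simp add: norm_divide)
      then show ?thesis using r(2)[OF False that] False N1 by (simp add: divide_less_eq)
    qed
    then show "cmod (N z - 1) \<le> q * cmod (z - 1)" "d * z ^ n \<noteq> of_nat m" by auto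
  qed
  have q0: "q \<ge> 0" using q(1) norm_ge_zero[of "1 - h"] by linarith
  have iter: "\<exists>x. (F ^^ k) (Some z) = Some x \<and> cmod (x - 1) \<le> q ^ k * r" if z: "dist z 1 < r" for z k
  proof (induction k)
    case 0
    then show ?case using z by (simp add: dist_norm)
  next
    case (Suc k)
    then obtain x where x: "(F ^^ k) (Some z) = Some x" "cmod (x - 1) \<le> q ^ k * r" by blast
    show ?case
    \<comment> \<open>For \<open>k = 0\<close> the bound \<open>q^k * r\<close> is just
      \<open>r\<close> and does not place the point in the open disc; the strict inequality for
      \<open>z\<close> is used instead.\<close>
    proof (cases "k = 0")
      case True
      then have xz: "x = z" using x(1) by simp
      have "q * cmod (z - 1) \<le> q * r" using z q0 by (intro mult_left_mono) (auto simp: dist_norm)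
      then show ?thesis using contr[OF z] F_Some True xz x(1) by (auto intro: order_trans)
    next
      case False
      have "q ^ k < 1" using q(2) q0 False by (simp add: power_less_one_iff)
      then have "q ^ k * r < r" using r(1) by simp
      then have xr: "dist x 1 < r" using x(2) by (simp add: dist_norm)
      have "q * cmod (x - 1) \<le> q * (q ^ k * r)" using x(2) q0 by (intro mult_left_mono) auto
      then show ?thesis using contr[OF xr] F_Some x(1) by (auto simp: mult.assoc intro: order_trans)
    qed
  qed
  have "equicont_at F z" if z: "dist z 1 < r/2" for z
  proof (rule uniform_limit_imp_equicont_at[OF continuous_iterates_F, of "r/2" z "Some 1"])
    show "r/2 > 0" using r by simp
    fix \<epsilon> :: real assume \<epsilon>: "\<epsilon> > 0"
    have "(\<lambda>k. 2 * (q ^ k * r)) \<longlonglongrightarrow> 2 * (0 * r)"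
      using q0 q(2) by (intro tendsto_intros LIMSEQ_realpow_zero)
    then have "(\<lambda>k. 2 * (q ^ k * r)) \<longlonglongrightarrow> 0" by simp
    then have "\<forall>\<^sub>F k in sequentially. 2 * (q ^ k * r) < \<epsilon>" using \<epsilon> by (rule order_tendstoD)
    then obtain k0 where k0: "\<And>k. k \<ge> k0 \<Longrightarrow> 2 * (q ^ k * r) < \<epsilon>" unfolding eventually_sequentially by blast
    have "chordal ((F ^^ k) (Some w)) (Some 1) < \<epsilon>" if k: "k \<ge> k0" and w: "dist w z < r/2" for k w
    proof -
      have "dist w 1 < r" using w z dist_triangle[of w 1 z] by simp
      then obtain x where x: "(F ^^ k) (Some w) = Some x" "cmod (x - 1) \<le> q ^ k * r" using iter by blast
      then show ?thesis using chordal_Some_le[of x 1] k0[OF k] by simp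
    qed
    then show "\<exists>k0. \<forall>k\<ge>k0. \<forall>w. dist w z < r/2 \<longrightarrow> chordal ((F ^^ k) (Some w)) (Some 1) < \<epsilon>" by blast
  qed
  then show ?thesis using not_finite_julia_iff[OF continuous_iterates_F] r(1) half_gt_zero by blast
qed

lemma interior_J: "interior J = {}"
  using rat.julia_empty_interior[of 1] F_None one_not_in_J by (simp add: F_eq)

lemma julia_rotate:
  assumes a: "a ^ n = 1"
  shows "z \<in> J \<longleftrightarrow> a * z \<in> J"
proof -
  have rot: "z \<in> J" if z: "a * z \<in> J" and a: "a ^ n = 1" for a z
  proof (rule finite_julia_rotate[OF continuous_iterates_F _ _ z])
    have "cmod a ^ n = 1" using a by (metis norm_one norm_power)
    then show a1: "cmod a = 1" using n power_eq_imp_eq_base[of "cmod a" n 1] by simp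
    have comm: "F (ext_aff (\<lambda>z. a * z) x) = ext_aff (\<lambda>z. a * z) (F x)" for x
    proof (cases x)
      case None
      then show ?thesis by (simp add: F_None ext_aff_def)
    next
      case (Some w)
      have aw: "(a * w) ^ n = w ^ n" using a by (simp add: power_mult_distrib)
      show ?thesis
      proof (cases "d * w ^ n = of_nat m")
        case True
        then show ?thesis using F_pole[of w] F_pole[of "a * w"] aw Some by (simp add: ext_aff_def)
      next
        case False
        then show ?thesis using F_Some[of w] F_Some[of "a * w"] aw Some by (simp add: ext_aff_def N_def)
      qed
    qed
    have "(F ^^ k) (ext_aff (\<lambda>z. a * z) x) = ext_aff (\<lambda>z. a * z) ((F ^^ k) x)" for k x
      by (induction k) (simp_all add: comm)
    from this[of _ "Some _"] show "\<exists>b. cmod b = 1 \<and> (\<forall>z. (F ^^ k) (Some (a * z)) =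
        ext_aff (\<lambda>z. b * z) ((F ^^ k) (Some z)))" for k
      using a1 by (intro exI[of _ a]) (simp add: ext_aff_def)
  qed
  have a0: "a \<noteq> 0" using a n by (auto simp: power_0_left)
  have "inverse a * (a * z) = z" using a0 by simp
  moreover have "inverse a ^ n = 1" using a by (simp add: power_inverse)
  ultimately show ?thesis using rot[of a z] rot[of "inverse a" "a * z"] a by metis
qed

subsection \<open>Translations\<close>

definition trans_group :: "complex set" where
  "trans_group = {c. \<forall>z. z \<in> J \<longleftrightarrow> z + c \<in> J}"

lemma trans_group_0: "0 \<in> trans_group" by (simp add: trans_group_def)

lemma trans_group_add: "a \<in> trans_group \<Longrightarrow> b \<in> trans_group \<Longrightarrow> a + b \<in> trans_group"
  by (auto simp: trans_group_def simp flip: add.assoc)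

lemma trans_group_minus:
  assumes "a \<in> trans_group"
  shows "- a \<in> trans_group"
  unfolding trans_group_def
proof (intro CollectI allI)
  fix z
  have "z + - a \<in> J \<longleftrightarrow> (z + - a) + a \<in> J" using assms unfolding trans_group_def by blast
  then show "z \<in> J \<longleftrightarrow> z + - a \<in> J" by simp
qed

lemma trans_group_of_nat: "c \<in> trans_group \<Longrightarrow> of_nat j * c \<in> trans_group"
  by (induction j) (auto simp: trans_group_0 trans_group_add distrib_right)

lemma closed_trans_group: "closed trans_group"
  unfolding closed_sequential_limits
proof (intro allI impI)
  fix x l assume x: "(\<forall>k. x k \<in> trans_group) \<and> x \<longlonglongrightarrow> l"
  have closed: "y \<in> J" if "\<And>k. s k \<in> J" "s \<longlonglongrightarrow> y" for s :: "nat \<Rightarrow> complex" and y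
    using that closed_julia closed_sequential_limits by blast
  show "l \<in> trans_group" unfolding trans_group_def
  proof (intro CollectI allI iffI)
    fix z assume "z \<in> J"
    then have "z + x k \<in> J" for k using x by (auto simp: trans_group_def)
    moreover have "(\<lambda>k. z + x k) \<longlonglongrightarrow> z + l" using x by (intro tendsto_intros) auto
    ultimately show "z + l \<in> J" by (rule closed)
  next
    fix z assume zl: "z + l \<in> J"
    have "z + l - x k \<in> J" for k
      using zl x trans_group_minus[of "x k"] by (auto simp: trans_group_def)
    moreover have "(\<lambda>k. z + l - x k) \<longlonglongrightarrow> z + l - l" using x by (intro tendsto_intros) auto
    ultimately show "z \<in> J" using closed[of "\<lambda>k. z + l - x k" "z + l - l"] by simp
  qed
qed

text \<open>Far out \<open>N\<close> is almost \<open>z \<mapsto> lam * z\<close>, so it conjugates the translation by \<open>c\<close> to one by about \<open>lam * c\<close>;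
  translating back by a multiple of \<open>c\<close> makes the error arbitrarily small near any given point.\<close>

lemma trans_group_lam:
  assumes c: "c \<in> trans_group"
  shows "lam * c \<in> trans_group"
proof -
  have *: "z + lam * c \<in> J" if c: "c \<in> trans_group" and z: "z \<in> J" for c z
  proof (cases "c = 0")
    case True
    then show ?thesis using z by simp
  next
    case False
    have "\<exists>y\<in>J. dist y (z + lam * c) < e" if e: "e > 0" for e
    proof -
      define K where "K = cmod kap"
      have K0: "K \<ge> 0" by (simp add: K_def)
      have l0: "cmod lam > 0" using lam_nonzero by simp
      define R where "R = 1 + 2 * K / e"
      have R1: "R \<ge> 1" using K0 e by (simp add: R_def)
      \<comment> \<open>\<open>j\<close> is chosen so that \<open>z + j c\<close> is far out and its
        preimage \<open>w\<close>, as well as \<open>w + c\<close>, lies beyond \<open>R\<close>,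
        where \<open>N\<close> differs from multiplication by \<open>lam\<close> by less than
        \<open>e / 2\<close>.\<close>
      define B where "B = cmod lam * (2 + K / cmod lam + R + cmod c) + cmod z"
      obtain j :: nat where j: "B / cmod c < real j" using reals_Archimedean2 by blast
      define y where "y = z + of_nat j * c"
      have jc: "B < real j * cmod c" using j False by (simp add: divide_less_eq)
      have "cmod (of_nat j * c) \<le> cmod y + cmod z"
        using norm_triangle_ineq4[of y z] by (simp add: y_def)
      then have "cmod y \<ge> cmod lam * (2 + K / cmod lam + R + cmod c)" using jc by (simp add: B_def norm_mult)
      then have yl: "cmod (y / lam) \<ge> 2 + K / cmod lam + R + cmod c"
        using l0 by (simp add: norm_divide le_divide_eq mult.commute)
      then have "cmod (y / lam) \<ge> 2 + cmod kap / cmod lam"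
        using R1 norm_ge_zero[of c] unfolding K_def by linarith
      then obtain w where w: "cmod (w - y / lam) \<le> 1" "cmod w \<ge> 1" "N w = y" using solve_N by blast
      have "cmod (y / lam) \<le> cmod w + 1"
        using w(1) norm_triangle_ineq[of w "y / lam - w"] by (simp add: norm_minus_commute)
      moreover have "K / cmod lam \<ge> 0" using K0 by simp
      ultimately have wl: "cmod w \<ge> 1 + R + cmod c" using yl by linarith
      have "cmod w \<le> cmod (w + c) + cmod c" using norm_triangle_ineq4[of "w + c" c] by simp
      then have wc: "cmod (w + c) \<ge> 1 + R" using wl by linarith
      have wR: "cmod w \<ge> 1 + R" using wl norm_ge_zero[of c] by linarith
      have yJ: "y \<in> J" using z trans_group_of_nat[OF c] by (auto simp: y_def trans_group_def)
      then have "w \<in> J" using julia_N[OF nonpole_large[OF w(2)]] w(3) by simp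
      then have "w + c \<in> J" using c by (simp add: trans_group_def)
      then have NJ: "N (w + c) \<in> J" using julia_N[OF nonpole_large, of "w + c"] wc R1 by simp
      have "- (of_nat j * c) \<in> trans_group" using trans_group_minus[OF trans_group_of_nat[OF c]] .
      then have J: "N (w + c) - of_nat j * c \<in> J" using NJ by (auto simp: trans_group_def)
      \<comment> \<open>Shifting by \<open>j c\<close>, going back through \<open>N\<close>,
        shifting by \<open>c\<close>, applying \<open>N\<close> and shifting by \<open>- j c\<close>
        moves \<open>z\<close> by \<open>lam * c\<close>, up to two small remainders.\<close>
      have eq: "N (w + c) - of_nat j * c - (z + lam * c) = (N (w + c) - lam * (w + c)) - (N w - lam * w)"
        using w(3) by (simp add: y_def algebra_simps)
      have small: "cmod (N x - lam * x) < e / 2" if x: "cmod x \<ge> 1 + R" for x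
      proof -
        have "cmod (N x - lam * x) \<le> K / cmod x" unfolding K_def using x R1 by (intro N_large) linarith
        also have "\<dots> \<le> K / (1 + R)" using x R1 K0 by (intro divide_left_mono) (auto intro!: mult_pos_pos)
        also have "\<dots> < e / 2"
        proof -
          have "2 * K / e < 1 + R" by (simp add: R_def)
          then have "2 * K < (1 + R) * e" using e by (simp add: divide_less_eq)
          then show ?thesis using R1 by (simp add: divide_less_eq mult.commute)
        qed
        finally show ?thesis .
      qed
      have "cmod (N (w + c) - of_nat j * c - (z + lam * c)) < e"
        unfolding eq using norm_triangle_ineq4[of "N (w + c) - lam * (w + c)" "N w - lam * w"]
          small[OF wc] small[OF wR] by linarith
      then show ?thesis using J by (auto simp: dist_norm)
    qed
    then have "z + lam * c \<in> closure J" unfolding closure_approachable by blast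
    then show ?thesis using closed_julia by simp
  qed
  show ?thesis unfolding trans_group_def
  proof (intro CollectI allI iffI)
    fix z show "z \<in> J \<Longrightarrow> z + lam * c \<in> J" by (rule *[OF c])
    assume "z + lam * c \<in> J"
    then have "z + lam * c + lam * - c \<in> J" by (rule *[OF trans_group_minus[OF c]])
    then show "z \<in> J" by simp
  qed
qed

lemma trans_group_line:
  assumes "c \<in> trans_group" "c \<noteq> 0"
  obtains v where "cmod v = 1" "\<And>t::real. t * v \<in> trans_group"
proof (rule closed_subgroup_line[OF closed_trans_group trans_group_0 trans_group_add trans_group_minus])
  fix k
  show "lam ^ k * c \<in> trans_group"
    by (induction k) (auto simp: assms mult.assoc intro: trans_group_lam)
  show "lam ^ k * c \<noteq> 0" using assms lam_nonzero by simp
next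
  have "(\<lambda>k. lam ^ k * c) \<longlonglongrightarrow> 0 * c" using lam_less by (intro tendsto_intros LIMSEQ_power_zero)
  then show "(\<lambda>k. lam ^ k * c) \<longlonglongrightarrow> 0" by simp
qed (use that in auto)

text \<open>The expression is the reciprocal of \<open>(N z - lam * z) / v\<close> along a line at
  height \<open>e\<close>. With \<open>s = 1 / t\<close> and after multiplication by
  \<open>s^(n-1)\<close> it becomes \<open>\<phi> s\<close>, which is analytic at 0. As it is real
  for small \<open>s > 0\<close>, both \<open>\<phi> 0 = A\<close> and the derivative
  \<open>A * (n - 1) * i * e\<close> are real, whence \<open>e = 0\<close>.\<close>

lemma horizontal_real_imp_zero:
  fixes A B :: complex and e t0 :: real
  assumes A: "A \<noteq> 0" and t0: "t0 \<ge> 1"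
    and re: "\<And>t. t \<ge> t0 \<Longrightarrow> Im (A * Complex t e ^ (n - 1) - B / Complex t e) = 0"
  shows "e = 0"
proof -
  define \<phi> where "\<phi> = (\<lambda>s. A * (1 + \<i> * e * s) ^ (n - 1) - B * s ^ n / (1 + \<i> * e * s))"
  have zero: "Im (\<phi> (of_real s)) = 0" if s: "0 < s" "s \<le> 1 / t0" for s
  proof -
    define t where "t = 1 / s"
    have t: "t \<ge> t0" "t > 0" using s t0 by (auto simp: t_def field_simps)
    define \<zeta> where "\<zeta> = Complex t e"
    have \<zeta>0: "\<zeta> \<noteq> 0" using t by (auto simp: \<zeta>_def complex_eq_iff)
    have s\<zeta>: "1 + \<i> * e * s = s * \<zeta>" using s by (simp add: \<zeta>_def t_def complex_eq_iff)
    have n1: "s ^ n = s * s ^ (n - 1)" using n by (simp flip: power_Suc)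
    have "\<phi> (of_real s) = A * (s * \<zeta>) ^ (n - 1) - B * of_real s ^ n / (s * \<zeta>)"
      unfolding \<phi>_def s\<zeta> ..
    also have "\<dots> = of_real (s ^ (n - 1)) * (A * \<zeta> ^ (n - 1) - B / \<zeta>)"
    proof -
      have "B * of_real s ^ n / (of_real s * \<zeta>) = B * of_real (s ^ (n - 1)) / \<zeta>"
        using s(1) n1 by (simp flip: of_real_power)
      then show ?thesis by (simp add: power_mult_distrib right_diff_distrib mult_ac)
    qed
    finally show ?thesis using re[OF t(1)] by (simp add: \<zeta>_def flip: of_real_power)
  qed
  have der: "(\<phi> has_field_derivative (A * (of_nat (n - 1) * (\<i> * e)))) (at 0)"
    unfolding \<phi>_def using n by (auto intro!: derivative_eq_intros simp: power_0_left)
  define x where "x = (\<lambda>k::nat. 1 / (t0 + real k))"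
  have x: "0 < x k" "x k \<le> 1 / t0" for k using t0 by (auto simp: x_def intro!: divide_left_mono)
  have xlim: "x \<longlonglongrightarrow> 0"
  proof -
    have "filterlim (\<lambda>k. t0 + real k) at_top sequentially"
      by (intro filterlim_tendsto_add_at_top[OF tendsto_const] filterlim_real_sequentially)
    then show ?thesis unfolding x_def by (intro tendsto_divide_0[OF tendsto_const] filterlim_at_top_imp_at_infinity)
  qed
  then have xl: "(\<lambda>k. complex_of_real (x k)) \<longlonglongrightarrow> 0" using tendsto_of_real[OF xlim] by simp
  then have xat: "filterlim (\<lambda>k. complex_of_real (x k)) (at 0) sequentially"
    unfolding filterlim_at using x(1) by (auto intro!: always_eventually) (metis less_irrefl)
  have "isCont \<phi> 0" using der by (rule DERIV_isCont)
  then have "(\<lambda>k. \<phi> (of_real (x k))) \<longlonglongrightarrow> \<phi> 0" using xl isCont_tendsto_compose by blast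
  then have "(\<lambda>k. Im (\<phi> (of_real (x k)))) \<longlonglongrightarrow> Im (\<phi> 0)" by (rule tendsto_Im)
  then have phi0: "Im (\<phi> 0) = 0" using zero x by (simp add: LIMSEQ_const_iff)
  have "((\<lambda>y. (\<phi> y - \<phi> 0) / (y - 0)) \<longlongrightarrow> A * (of_nat (n - 1) * (\<i> * e))) (at 0)"
    using der by (simp add: has_field_derivative_iff)
  then have "(\<lambda>k. (\<phi> (of_real (x k)) - \<phi> 0) / (of_real (x k) - 0)) \<longlonglongrightarrow> A * (of_nat (n - 1) * (\<i> * e))"
    using xat by (rule filterlim_compose)
  then have "(\<lambda>k. Im ((\<phi> (of_real (x k)) - \<phi> 0) / of_real (x k))) \<longlonglongrightarrow> Im (A * (of_nat (n - 1) * (\<i> * e)))"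
    using tendsto_Im by fastforce
  moreover have "(\<lambda>k. Im ((\<phi> (of_real (x k)) - \<phi> 0) / of_real (x k))) = (\<lambda>k. 0)"
    using zero x phi0 by (intro ext) (simp add: Im_divide_of_real)
  ultimately have "(\<lambda>k::nat. 0) \<longlonglongrightarrow> Im (A * (of_nat (n - 1) * (\<i> * e)))" by (simp only:)
  then have 1: "Im (A * (of_nat (n - 1) * (\<i> * e))) = 0" by (simp only: LIMSEQ_const_iff)
  have "\<phi> 0 = A" using n by (simp add: \<phi>_def power_0_left)
  then have "Im A = 0" using phi0 by simp
  then have "Re A \<noteq> 0" using A by (auto simp: complex_eq_iff)
  then show ?thesis using 1 n by simp
qed

text \<open>A line parallel to \<open>v\<close> in the Julia set is mapped by \<open>N\<close>, far
  out, into a parallel line. Letting \<open>t\<close> grow in the equation for the heights gives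
  first \<open>Im lam = 0\<close> and then that \<open>N z - lam * z\<close> is a real multiple of
  \<open>v\<close>. By \<open>horizontal_real_imp_zero\<close> this leaves only the line through
  0.\<close>

lemma trans_group_trivial:
  assumes not_line: "\<not> is_line (julia F)" and c: "c \<in> trans_group"
  shows "c = 0"
proof (rule ccontr)
  assume "c \<noteq> 0"
  with c obtain v where v: "cmod v = 1" "\<And>t::real. t * v \<in> trans_group" using trans_group_line by blast
  have v0: "v \<noteq> 0" using v(1) by auto
  have inv: "z \<in> J \<Longrightarrow> z + of_real t * v \<in> J" for z t using v(2)[of t] by (simp add: trans_group_def)
  have e0: "e = 0" if e: "\<i> * of_real e * v \<in> J" for e :: real
  proof -
    define z where "z = (\<lambda>t. v * Complex t e)"
    have zJ: "z t \<in> J" for t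
    proof -
      have "z t = \<i> * of_real e * v + of_real t * v" by (simp add: z_def Complex_eq algebra_simps)
      then show ?thesis using inv[OF e, of t] by simp
    qed
    have zt: "cmod (z t) \<ge> t" "cmod (z t) \<ge> 1" if "t \<ge> 1" for t
    proof -
      show "cmod (z t) \<ge> t" using v(1) abs_Re_le_cmod[of "Complex t e"] by (simp add: z_def norm_mult)
      then show "cmod (z t) \<ge> 1" using that by linarith
    qed
    define S where "S = (\<lambda>t. N (z t)) ` {1..}"
    have contz: "continuous_on {1..} z" unfolding z_def Complex_eq by (intro continuous_intros)
    have "continuous_on {1..} (\<lambda>t. N (z t))" unfolding N_def
      using nonpole_large[OF zt(2)] by (intro continuous_intros contz) auto
    then have "connected S" unfolding S_def by (intro connected_continuous_image) auto
    moreover have "S \<subseteq> J" using zJ julia_N[OF nonpole_large[OF zt(2)]] by (auto simp: S_def)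
    ultimately have const: "Im (x / v) = Im (y / v)" if "x \<in> S" "y \<in> S" for x y
      using connected_subset_parallel[of UNIV v J S x y] v0 inv interior_J that by auto
    define G where "G = (\<lambda>t. (N (z t) - lam * z t) / v)"
    have Gle: "cmod (G t) \<le> cmod kap / t" if "t \<ge> 1" for t
    proof -
      have "cmod (G t) \<le> cmod kap / cmod (z t)" using N_large[OF zt(2)[OF that]] v(1) by (simp add: G_def norm_divide)
      also have "\<dots> \<le> cmod kap / t" using zt[OF that] that by (intro divide_left_mono mult_pos_pos) auto
      finally show ?thesis .
    qed
    have Nv: "N (z t) / v = lam * Complex t e + G t" for t
      using v0 by (simp add: G_def z_def diff_divide_distrib)
    define K where "K = Im (N (z 1) / v)"
    have ImK: "Im lam * t + Re lam * e + Im (G t) = K" if "t \<ge> 1" for t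
    proof -
      have "Im (N (z t) / v) = K" unfolding K_def using that by (intro const) (auto simp: S_def)
      then show ?thesis unfolding Nv by (simp add: algebra_simps)
    qed
    have Im_lam: "Im lam = 0"
    proof (rule ccontr)
      assume ne: "Im lam \<noteq> 0"
      define t where "t = 1 + (\<bar>K\<bar> + \<bar>Re lam * e\<bar> + cmod kap + 1) / \<bar>Im lam\<bar>"
      have t1: "t \<ge> 1" by (simp add: t_def)
      have "\<bar>Im lam * t\<bar> = \<bar>Im lam\<bar> * t" using t1 by (simp add: abs_mult)
      also have "\<dots> = \<bar>Im lam\<bar> + (\<bar>K\<bar> + \<bar>Re lam * e\<bar> + cmod kap + 1)" using ne by (simp add: t_def distrib_left)
      finally have 1: "\<bar>Im lam * t\<bar> > \<bar>K\<bar> + \<bar>Re lam * e\<bar> + cmod kap" by simp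
      have "cmod kap / t \<le> cmod kap / 1" using t1 by (intro divide_left_mono) auto
      then have "\<bar>Im (G t)\<bar> \<le> cmod kap" using Gle[OF t1] abs_Im_le_cmod[of "G t"] by simp
      then show False using 1 ImK[OF t1] by linarith
    qed
    have "(\<lambda>k. Im (G (1 + real k))) \<longlonglongrightarrow> 0"
    proof (rule Lim_null_comparison)
      show "\<forall>\<^sub>F k in sequentially. norm (Im (G (1 + real k))) \<le> cmod kap / (1 + real k)"
      proof (intro always_eventually allI)
        fix k show "norm (Im (G (1 + real k))) \<le> cmod kap / (1 + real k)"
          using Gle[of "1 + real k"] abs_Im_le_cmod[of "G (1 + real k)"] by simp
      qed
      have "filterlim (\<lambda>k. 1 + real k) at_top sequentially"
        by (intro filterlim_tendsto_add_at_top[OF tendsto_const] filterlim_real_sequentially)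
      then show "(\<lambda>k. cmod kap / (1 + real k)) \<longlonglongrightarrow> 0"
        by (intro tendsto_divide_0[OF tendsto_const] filterlim_at_top_imp_at_infinity)
    qed
    moreover have "Im (G (1 + real k)) = K - Re lam * e" for k using ImK[of "1 + real k"] Im_lam by simp
    ultimately have "K - Re lam * e = 0" by (simp add: LIMSEQ_const_iff)
    then have ImG: "Im (G t) = 0" if "t \<ge> 1" for t using ImK[OF that] Im_lam by simp
    show "e = 0"
    proof (rule horizontal_real_imp_zero[of "d * v ^ n / kap" 1 e "of_nat m / kap"])
      show "d * v ^ n / kap \<noteq> 0" using d_nonzero v0 kap_nonzero by simp
      fix t :: real assume t: "t \<ge> 1"
      define \<zeta> where "\<zeta> = Complex t e"
      have \<zeta>0: "\<zeta> \<noteq> 0" using t by (auto simp: \<zeta>_def complex_eq_iff)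
      define D where "D = d * z t ^ n - of_nat m"
      have D0: "D \<noteq> 0" using nonpole_large[OF zt(2)[OF t]] by (simp add: D_def)
      have "N (z t) - lam * z t = z t * kap / D" by (simp add: N_def D_def algebra_simps)
      then have "G t = \<zeta> * kap / D" using v0 by (simp add: G_def z_def \<zeta>_def)
      then have "inverse (G t) = D / (\<zeta> * kap)" by simp
      moreover have "Im (inverse (G t)) = 0" using ImG[OF t] by simp
      moreover have "D / (\<zeta> * kap) = d * v ^ n / kap * \<zeta> ^ (n - 1) - of_nat m / kap / \<zeta>"
      proof -
        have "\<zeta> ^ n = \<zeta> ^ (n - 1) * \<zeta>" using n by (simp flip: power_Suc2)
        then have "D = d * v ^ n * \<zeta> ^ (n - 1) * \<zeta> - of_nat m"
          by (simp add: D_def z_def \<zeta>_def[symmetric] power_mult_distrib)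
        then show ?thesis using \<zeta>0 by (simp add: diff_divide_distrib mult.commute[of \<zeta> kap])
      qed
      ultimately show "Im (d * v ^ n / kap * Complex t e ^ (n - 1) - of_nat m / kap / Complex t e) = 0"
        by (simp add: \<zeta>_def)
    qed simp
  qed
  have coord: "\<exists>t. x = of_real t * v" if x: "x \<in> J" for x
  proof -
    define t e where "t = Re (x / v)" and "e = Im (x / v)"
    have "x / v = Complex t e" by (simp add: t_def e_def)
    then have xe: "x / v = of_real t + \<i> * of_real e" by (simp add: Complex_eq)
    have "x = x / v * v" using v0 by simp
    then have xv: "x = of_real t * v + \<i> * of_real e * v" unfolding xe by (simp add: distrib_right)
    then have "\<i> * of_real e * v \<in> J" using inv[OF x, of "- t"] by simp
    then have "e = 0" by (rule e0)
    then show ?thesis using xv by auto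
  qed
  obtain x where x: "x \<in> J" using julia_nonempty by auto
  obtain t where t: "x = of_real t * v" using coord[OF x] by blast
  have "of_real s * v \<in> J" for s
  proof -
    have "x + of_real (s - t) * v = of_real s * v" by (simp add: t algebra_simps)
    then show ?thesis using inv[OF x, of "s - t"] by simp
  qed
  then have "J = {0 + of_real s * v | s. True}" using coord by auto
  moreover have "Some -` julia F = J" by (auto simp: finite_julia_def)
  ultimately have "is_line (julia F)" unfolding is_line_def using v0 by metis
  then show False using not_line by simp
qed

text \<open>The commutator of the symmetry with the rotation by \<open>\<omega>\<close> is the
  translation by \<open>(1 - \<omega>) * b\<close>, which must be trivial.\<close>

lemma symmetry_fixes_zero:
  assumes not_line: "\<not> is_line (julia F)" and a: "cmod a = 1"
    and sym: "\<And>z. z \<in> J \<longleftrightarrow> a * z + b \<in> J"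
  shows "b = 0"
proof -
  obtain \<omega> where \<omega>: "\<omega> ^ n = 1" "\<omega> \<noteq> 1" "cmod \<omega> = 1" using root_of_unity_exists[OF n] .
  have a0: "a \<noteq> 0" "\<omega> \<noteq> 0" using a \<omega> by auto
  have "(1 - \<omega>) * b \<in> trans_group"
    unfolding trans_group_def
  proof (intro CollectI allI)
    fix z
    define y where "y = (z / \<omega> - b) / a"
    have y: "\<omega> * (a * y + b) = z" using a0 by (simp add: y_def)
    have "a * (\<omega> * y) + b = \<omega> * (a * y + b) + (1 - \<omega>) * b" by (simp add: algebra_simps)
    then have "z + (1 - \<omega>) * b = a * (\<omega> * y) + b" using y by simp
    then show "z \<in> J \<longleftrightarrow> z + (1 - \<omega>) * b \<in> J"
      using sym[of y] sym[of "\<omega> * y"] julia_rotate[OF \<omega>(1), of y] julia_rotate[OF \<omega>(1), of "a * y + b"] y by simp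
  qed
  then have "(1 - \<omega>) * b = 0" by (rule trans_group_trivial[OF not_line])
  then show ?thesis using \<omega>(2) by simp
qed

end

section \<open>Linearisation at a repelling fixed point at infinity\<close>

text \<open>\<open>P\<close> is the inverse of the Koenigs coordinate, obtained as the limit of
  \<open>M^k (y / \<Lambda>^k + x0)\<close>: far out the affine part is almost exact, and each
  return step by \<open>M\<close> contracts by a factor \<open>q < 1\<close>. A parametrisation is
  preferred to the coordinate itself because it pulls the Julia set back and can be continued
  inwards by \<open>P (\<Lambda> y) = M (P y)\<close>.\<close>

lemma koenigs_at_infinity:
  fixes M G :: "complex \<Rightarrow> complex" and \<Lambda> x0 :: complex and R0 R1 C :: real
  assumes \<Lambda>: "\<Lambda> \<noteq> 0" "cmod \<Lambda> < 1"
    and hol: "M holomorphic_on {x. cmod x > R1}" and R1: "R1 \<ge> 1" and C: "C \<ge> 0"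
    and M: "\<And>x. cmod x > R1 \<Longrightarrow> M x = \<Lambda> * (x - x0) + x0 + G x"
    and G: "\<And>x. cmod x > R1 \<Longrightarrow> cmod (G x) \<le> C / cmod x"
    and Glip: "\<And>x y. cmod x > R1 \<Longrightarrow> cmod y > R1 \<Longrightarrow> cmod (G x - G y) \<le> C * cmod (x - y) / (cmod x * cmod y)"
  obtains P R K where "R \<ge> R0" "R \<ge> 1" "K \<ge> 0" "R \<ge> K" "P holomorphic_on {y. cmod y > R}"
    "\<And>y. cmod y > R \<Longrightarrow> cmod (P y - (y + x0)) \<le> K / cmod y"
    "\<And>y. cmod y > R \<Longrightarrow> cmod (P y) > R1"
    "\<And>y. cmod (\<Lambda> * y) > R \<Longrightarrow> M (P y) = P (\<Lambda> * y)"
proof -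
  define q where "q = (1 + cmod \<Lambda>) / 2"
  have q: "0 < q" "q < 1" "cmod \<Lambda> < q" using \<Lambda> by (auto simp: q_def add_pos_nonneg)
  have l0: "cmod \<Lambda> > 0" using \<Lambda> by simp
  \<comment> \<open>Beyond \<open>R2\<close> the remainder \<open>G\<close> adds at most
    \<open>(1 - cmod \<Lambda>) / 2\<close> to the Lipschitz constant \<open>cmod \<Lambda>\<close>,
    so that the midpoint \<open>q\<close> is not exceeded.\<close>
  define R2 where "R2 = max R1 (2 * C / (1 - cmod \<Lambda>))"
  have R2: "R2 \<ge> R1" "R2 \<ge> 1" using R1 by (auto simp: R2_def)
  have CR2: "cmod \<Lambda> + C / (R2 * R2) \<le> q"
  proof -
    have "2 * C / (1 - cmod \<Lambda>) \<le> R2" by (simp add: R2_def)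
    then have "2 * C \<le> R2 * (1 - cmod \<Lambda>)" using \<Lambda> by (simp add: divide_le_eq)
    also have "\<dots> \<le> R2 * R2 * (1 - cmod \<Lambda>)" using R2 \<Lambda> by (intro mult_right_mono) auto
    finally have "C / (R2 * R2) \<le> (1 - cmod \<Lambda>) / 2" using R2 by (simp add: divide_le_eq mult.commute)
    then show ?thesis unfolding q_def add_divide_distrib diff_divide_distrib by linarith
  qed
  define K where "K = 2 * C / (1 - q)"
  have K: "K \<ge> 0" using C q by (simp add: K_def)
  define R where "R = Max {R0, 1, K, 2 * cmod x0, 2 * R1, R2 + cmod x0 + 1}"
  have R: "R \<ge> R0" "R \<ge> 1" "R \<ge> K" "R \<ge> 2 * cmod x0" "R \<ge> 2 * R1" "R \<ge> R2 + cmod x0 + 1"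
    by (simp_all add: R_def)
  define A where "A = {y. cmod y > R}"
  have openA: "open A" unfolding A_def by (intro open_Collect_less continuous_intros)
  have Adiv: "y / \<Lambda> \<in> A" if "y \<in> A" for y
  proof -
    have "cmod y * cmod \<Lambda> \<le> cmod y * 1" using \<Lambda> by (intro mult_left_mono) auto
    then have "cmod y \<le> cmod (y / \<Lambda>)" using l0 by (simp add: norm_divide le_divide_eq)
    then show ?thesis using that by (simp add: A_def)
  qed
  have Mlip: "cmod (M a - M b) \<le> q * cmod (a - b)" if ab: "cmod a > R2" "cmod b > R2" for a b
  proof -
    have ab1: "cmod a > R1" "cmod b > R1" using ab R2 by auto
    have "M a - M b = \<Lambda> * (a - b) + (G a - G b)"
      unfolding M[OF ab1(1)] M[OF ab1(2)] by (simp add: algebra_simps)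
    then have "cmod (M a - M b) \<le> cmod \<Lambda> * cmod (a - b) + C * cmod (a - b) / (cmod a * cmod b)"
      using norm_triangle_ineq[of "\<Lambda> * (a - b)" "G a - G b"] Glip[OF ab1] by (simp add: norm_mult)
    also have "C * cmod (a - b) / (cmod a * cmod b) \<le> C * cmod (a - b) / (R2 * R2)"
      using ab R2 C by (intro divide_left_mono mult_mono mult_pos_pos) auto
    also have "cmod \<Lambda> * cmod (a - b) + C * cmod (a - b) / (R2 * R2) = (cmod \<Lambda> + C / (R2 * R2)) * cmod (a - b)"
      by (simp add: distrib_right)
    also have "\<dots> \<le> q * cmod (a - b)" using CR2 by (intro mult_right_mono) auto
    finally show ?thesis by simp
  qed
  define p where "p = rec_nat (\<lambda>y. y + x0) (\<lambda>_ f y. M (f (y / \<Lambda>)))"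
  have p0: "p 0 = (\<lambda>y. y + x0)" and pS: "p (Suc k) = (\<lambda>y. M (p k (y / \<Lambda>)))" for k
    by (simp_all add: p_def)
  define S where "S = (\<lambda>k. \<Sum>i<k. q ^ i)"
  have SK: "2 * C * S k \<le> K" for k
  proof -
    have "S k = (1 - q ^ k) / (1 - q)" using q by (simp add: S_def sum_gp_strict)
    also have "\<dots> \<le> 1 / (1 - q)" using q by (intro divide_right_mono) auto
    finally have "2 * C * S k \<le> 2 * C * (1 / (1 - q))" using C by (intro mult_left_mono) auto
    then show ?thesis by (simp add: K_def)
  qed
  have big: "cmod x > R2" if y: "y \<in> A" and x: "cmod (x - (y + x0)) \<le> 2 * C * S k / cmod y" for x y k
  proof -
    have yR: "cmod y > R" using y by (simp add: A_def)
    have "2 * C * S k / cmod y \<le> K / cmod y" using SK by (intro divide_right_mono) auto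
    also have "\<dots> \<le> 1"
    proof -
      have "K \<le> cmod y" "cmod y > 0" using yR R by linarith+
      then show ?thesis by simp
    qed
    finally have "cmod (x - (y + x0)) \<le> 1" using x by linarith
    moreover have "cmod y \<le> cmod x + cmod (x - (y + x0)) + cmod x0"
      using norm_triangle_ineq4[of x "x - (y + x0)"] norm_triangle_ineq4[of "y + x0" x0] by simp
    ultimately show ?thesis using yR R by linarith
  qed
  \<comment> \<open>Both bounds are carried together: contraction holds only while the points stay
    beyond \<open>R2\<close>, which follows from the accumulated bound. The factor 2 comes from
    \<open>cmod (y / \<Lambda> + x0) >= cmod y / 2\<close>.\<close>
  have main: "(\<forall>y\<in>A. cmod (p k y - (y + x0)) \<le> 2 * C * S k / cmod y) \<and>
      (\<forall>y\<in>A. cmod (p (Suc k) y - p k y) \<le> 2 * C * q ^ k / cmod y)" for k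
  proof (induction k)
    case 0
    have "cmod (p (Suc 0) y - p 0 y) \<le> 2 * C / cmod y" if y: "y \<in> A" for y
    proof -
      have yR: "cmod y > R" using y by (simp add: A_def)
      define x where "x = y / \<Lambda> + x0"
      have "cmod (y / \<Lambda>) \<ge> cmod y"
      proof -
        have "cmod y * cmod \<Lambda> \<le> cmod y * 1" using \<Lambda> by (intro mult_left_mono) auto
        then show ?thesis using l0 by (simp add: norm_divide le_divide_eq)
      qed
      then have x: "cmod x \<ge> cmod y / 2"
        using norm_triangle_ineq4[of x x0] yR R by (simp add: x_def)
      then have x1: "cmod x > R1" using yR R by linarith
      have "p (Suc 0) y - p 0 y = G x" using M[OF x1] \<Lambda> by (simp add: pS p0 x_def)
      then have "cmod (p (Suc 0) y - p 0 y) \<le> C / cmod x" using G[OF x1] by simp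
      also have "\<dots> \<le> C / (cmod y / 2)" using x x1 R1 yR R C by (intro divide_left_mono mult_pos_pos) auto
      finally show ?thesis by (simp add: mult.commute)
    qed
    then show ?case by (simp add: p0 S_def)
  next
    case (Suc k)
    have B: "cmod (p (Suc k) y - (y + x0)) \<le> 2 * C * S (Suc k) / cmod y" if y: "y \<in> A" for y
    proof -
      have "cmod (p (Suc k) y - (y + x0)) \<le> 2 * C * q ^ k / cmod y + 2 * C * S k / cmod y"
      proof -
        have "cmod (p (Suc k) y - (y + x0)) \<le> cmod (p (Suc k) y - p k y) + cmod (p k y - (y + x0))"
          using dist_triangle[of "p (Suc k) y" "y + x0" "p k y"] by (simp only: dist_norm)
        moreover have "cmod (p (Suc k) y - p k y) \<le> 2 * C * q ^ k / cmod y"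
          "cmod (p k y - (y + x0)) \<le> 2 * C * S k / cmod y" using Suc y by blast+
        ultimately show ?thesis by linarith
      qed
      also have "\<dots> = 2 * C * S (Suc k) / cmod y" by (simp add: S_def add_divide_distrib[symmetric] distrib_left)
      finally show ?thesis .
    qed
    have "cmod (p (Suc (Suc k)) y - p (Suc k) y) \<le> 2 * C * q ^ Suc k / cmod y" if y: "y \<in> A" for y
    proof -
      define u where "u = y / \<Lambda>"
      have u: "u \<in> A" unfolding u_def by (rule Adiv[OF y])
      have y0: "cmod y > 0" using y R by (auto simp: A_def)
      have a: "cmod (p (Suc k) u) > R2" using big[OF u] B[OF u] by blast
      have b: "cmod (p k u) > R2" using big[OF u] Suc u by blast
      have "p (Suc (Suc k)) y - p (Suc k) y = M (p (Suc k) u) - M (p k u)" by (simp only: pS u_def)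
      then have "cmod (p (Suc (Suc k)) y - p (Suc k) y) \<le> q * cmod (p (Suc k) u - p k u)"
        using Mlip[OF a b] by simp
      also have "\<dots> \<le> q * (2 * C * q ^ k / cmod u)" using Suc u q by (intro mult_left_mono) auto
      also have "\<dots> \<le> q * (2 * C * q ^ k / cmod y)"
      proof -
        have "cmod y * cmod \<Lambda> \<le> cmod y * 1" using \<Lambda> by (intro mult_left_mono) auto
        then have "cmod u \<ge> cmod y" unfolding u_def using l0 by (simp add: norm_divide le_divide_eq)
        then show ?thesis using y0 q C by (intro mult_left_mono divide_left_mono mult_pos_pos) auto
      qed
      finally show ?thesis by (simp add: mult_ac)
    qed
    with B show ?case by blast
  qed
  have pbig: "cmod (p k y) > R2" if "y \<in> A" for k y using big[OF that] main that by blast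
  have phol: "p k holomorphic_on A" for k
  proof (induction k)
    case 0
    show ?case unfolding p0 by (intro holomorphic_intros)
  next
    case (Suc k)
    have 1: "(\<lambda>y. p k (y / \<Lambda>)) holomorphic_on A"
    proof (rule holomorphic_on_compose_gen[of "\<lambda>y. y / \<Lambda>" A "p k" A, unfolded o_def])
      show "(\<lambda>y. y / \<Lambda>) holomorphic_on A" using \<Lambda> by (intro holomorphic_intros) auto
    qed (use Suc Adiv in auto)
    have 2: "(\<lambda>y. p k (y / \<Lambda>)) ` A \<subseteq> {x. cmod x > R1}"
    proof safe
      fix y assume "y \<in> A"
      from pbig[OF Adiv[OF this], of k] show "R1 < cmod (p k (y / \<Lambda>))" using R2(1) by linarith
    qed
    show ?case unfolding pS
      using holomorphic_on_compose_gen[OF 1 hol 2] by (simp add: o_def)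
  qed
  define P where "P = (\<lambda>y. (y + x0) + (\<Sum>i. p (Suc i) y - p i y))"
  have unif: "uniform_limit A p P sequentially"
  proof -
    have "uniform_limit A (\<lambda>k y. \<Sum>i<k. p (Suc i) y - p i y) (\<lambda>y. \<Sum>i. p (Suc i) y - p i y) sequentially"
    proof (rule Weierstrass_m_test[where M = "\<lambda>i. 2 * C * q ^ i"])
      fix i y assume y: "y \<in> A"
      have "cmod (p (Suc i) y - p i y) \<le> 2 * C * q ^ i / cmod y" using main y by blast
      also have "\<dots> \<le> 2 * C * q ^ i / 1" using y R C q by (intro divide_left_mono) (auto simp: A_def)
      finally show "cmod (p (Suc i) y - p i y) \<le> 2 * C * q ^ i" by simp
    qed (use q in \<open>auto intro!: summable_mult summable_geometric\<close>)
    then have "uniform_limit A (\<lambda>k y. (y + x0) + (\<Sum>i<k. p (Suc i) y - p i y)) P sequentially"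
      unfolding P_def by (intro uniform_limit_add uniform_limit_const)
    moreover have "(y + x0) + (\<Sum>i<k. p (Suc i) y - p i y) = p k y" for k y
      using sum_lessThan_telescope[of "\<lambda>i. p i y" k] by (simp add: p0)
    then have "(\<lambda>k y. (y + x0) + (\<Sum>i<k. p (Suc i) y - p i y)) = p" by (intro ext)
    ultimately show ?thesis by simp
  qed
  have Phol: "P holomorphic_on A"
  proof (rule holomorphic_uniform_sequence[OF openA])
    show "p k holomorphic_on A" for k by (rule phol)
    fix y assume "y \<in> A"
    then obtain e where e: "e > 0" "cball y e \<subseteq> A" using openA open_contains_cball by blast
    then show "\<exists>d>0. cball y d \<subseteq> A \<and> uniform_limit (cball y d) p P sequentially"
      using uniform_limit_on_subset[OF unif] by blast
  qed
  have lim: "(\<lambda>k. p k y) \<longlonglongrightarrow> P y" if "y \<in> A" for y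
    using tendsto_uniform_limitI[OF unif that] .
  have Pbd: "cmod (P y - (y + x0)) \<le> K / cmod y" if y: "y \<in> A" for y
  proof (rule LIMSEQ_le_const2)
    show "(\<lambda>k. cmod (p k y - (y + x0))) \<longlonglongrightarrow> cmod (P y - (y + x0))"
      by (intro tendsto_intros lim y)
    have "cmod (p k y - (y + x0)) \<le> K / cmod y" for k
    proof -
      have "cmod (p k y - (y + x0)) \<le> 2 * C * S k / cmod y" using main y by blast
      also have "\<dots> \<le> K / cmod y" using SK by (intro divide_right_mono) auto
      finally show ?thesis .
    qed
    then show "\<exists>N. \<forall>k\<ge>N. cmod (p k y - (y + x0)) \<le> K / cmod y" by blast
  qed
  have Pbig: "cmod (P y) > R1" if y: "y \<in> A" for y
  proof -
    have yR: "cmod y > R" using y by (simp add: A_def)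
    have "K \<le> cmod y" "cmod y > 0" using yR R by linarith+
    then have "K / cmod y \<le> 1" by simp
    then have "cmod (P y - (y + x0)) \<le> 1" using Pbd[OF y] by linarith
    moreover have "cmod y \<le> cmod (P y) + cmod (P y - (y + x0)) + cmod x0"
      using norm_triangle_ineq4[of "P y" "P y - (y + x0)"] norm_triangle_ineq4[of "y + x0" x0] by simp
    ultimately show ?thesis using yR R R2 by linarith
  qed
  have func: "M (P y) = P (\<Lambda> * y)" if y: "cmod (\<Lambda> * y) > R" for y
  proof -
    have yA: "\<Lambda> * y \<in> A" using y by (simp add: A_def)
    have "\<Lambda> * y / \<Lambda> = y" using \<Lambda> by simp
    then have yA': "y \<in> A" using Adiv[OF yA] by simp
    have op: "open {x. cmod x > R1}" by (intro open_Collect_less continuous_intros)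
    have "continuous_on {x. cmod x > R1} M" by (rule holomorphic_on_imp_continuous_on[OF hol])
    then have "isCont M (P y)"
      using Pbig[OF yA'] unfolding continuous_on_eq_continuous_at[OF op] by blast
    then have "(\<lambda>k. M (p k y)) \<longlonglongrightarrow> M (P y)" using lim[OF yA'] isCont_tendsto_compose by blast
    moreover have "(\<lambda>k. p (Suc k) (\<Lambda> * y)) \<longlonglongrightarrow> P (\<Lambda> * y)" using lim[OF yA] by (rule LIMSEQ_Suc)
    moreover have "p (Suc k) (\<Lambda> * y) = M (p k y)" for k using \<Lambda> by (simp add: pS)
    ultimately show ?thesis using LIMSEQ_unique by simp
  qed
  show ?thesis
    by (rule that[of R K P]) (use R K Phol Pbd Pbig func in \<open>auto simp: A_def\<close>)
qed

lemma holomorphic_lipschitz: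
  assumes hol: "f holomorphic_on ball 0 1"
  obtains C where "C \<ge> 0" "\<And>s t. cmod s \<le> 1/2 \<Longrightarrow> cmod t \<le> 1/2 \<Longrightarrow> cmod (f s - f t) \<le> C * cmod (s - t)"
proof -
  have sub: "cball 0 (1/2) \<subseteq> ball (0::complex) 1" by auto
  have "continuous_on (cball 0 (1/2)) (deriv f)"
    using holomorphic_deriv[OF hol] sub by (meson holomorphic_on_imp_continuous_on holomorphic_on_subset open_ball)
  then have "bounded (deriv f ` cball 0 (1/2))" by (intro compact_imp_bounded compact_continuous_image) auto
  then obtain C where C: "C > 0" "\<And>x. x \<in> cball 0 (1/2) \<Longrightarrow> cmod (deriv f x) \<le> C"
    unfolding bounded_pos by auto
  have "cmod (f s - f t) \<le> C * cmod (s - t)" if "cmod s \<le> 1/2" "cmod t \<le> 1/2" for s t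
  proof (rule field_differentiable_bound[of "cball 0 (1/2)" f "deriv f"])
    show "(f has_field_derivative deriv f x) (at x within cball 0 (1/2))" if "x \<in> cball 0 (1/2)" for x
      using hol that sub by (meson has_field_derivative_at_within holomorphic_derivI open_ball subsetD)
  qed (use that C in auto)
  then show ?thesis using C(1) by (intro that[of C]) auto
qed

context newton_pmn
begin

subsection \<open>The quotient of the Newton map by the rotation symmetry\<close>

definition "M x = x * (lam + kap / (d * x - of_nat m)) ^ n"
definition "X = {z ^ n | z. z \<in> J}"
definition "Lam = lam ^ n"
text \<open>The constant term of \<open>M\<close> at infinity, from the first order expansion of
  \<open>(lam + kap / (d x))^n\<close>. The point \<open>x0\<close> below is the fixed point of the
  affine part \<open>x -> Lam * x + mu\<close>.\<close>

definition "mu = of_nat n * lam ^ (n - 1) * kap / d"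
definition "x0 = mu / (1 - Lam)"

lemma M_power: "M (z ^ n) = N z ^ n"
  by (simp add: M_def N_def power_mult_distrib)

lemma nth_root_exists: "\<exists>z::complex. z ^ n = x"
proof -
  have "n \<noteq> 0" using n by simp
  then show ?thesis using exists_complex_root by metis
qed

lemma power_in_X: "z ^ n \<in> X \<longleftrightarrow> z \<in> J"
proof
  assume "z ^ n \<in> X"
  then obtain w where w: "z ^ n = w ^ n" "w \<in> J" by (auto simp: X_def)
  show "z \<in> J"
  proof (cases "w = 0")
    case True
    then show ?thesis using w n by (auto simp: power_0_left)
  next
    case False
    then have "(z / w) ^ n = 1" using w by (simp add: power_divide)
    then show ?thesis using julia_rotate[of "z / w" w] w False by simp
  qed
qed (auto simp: X_def)

lemma X_M: "d * x \<noteq> of_nat m \<Longrightarrow> x \<in> X \<longleftrightarrow> M x \<in> X"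
proof -
  assume *: "d * x \<noteq> of_nat m"
  obtain z where z: "z ^ n = x" using nth_root_exists by blast
  then show ?thesis using * julia_N[of z] power_in_X[of z] power_in_X[of "N z"] M_power[of z] by simp
qed

lemma X_pole: "d * x = of_nat m \<Longrightarrow> x \<in> X"
proof -
  assume *: "d * x = of_nat m"
  obtain z where "z ^ n = x" using nth_root_exists by blast
  then show ?thesis using * pole_in_J[of z] power_in_X[of z] by simp
qed

lemma interior_X: "interior X = {}"
proof (rule ccontr)
  assume "interior X \<noteq> {}"
  then obtain x where x: "x \<in> interior X" by auto
  define V where "V = (\<lambda>z::complex. z ^ n) -` interior X"
  have "open V" unfolding V_def by (intro open_vimage continuous_intros) auto
  moreover have "V \<subseteq> J" using power_in_X interior_subset by (auto simp: V_def)
  ultimately have "V \<subseteq> interior J" by (rule interior_maximal[rotated])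
  moreover obtain z where "z ^ n = x" using nth_root_exists by blast
  then have "z \<in> V" using x by (simp add: V_def)
  ultimately show False using interior_J by auto
qed

lemma closed_X: "closed X"
proof -
  have "\<not> (\<lambda>z::complex. z ^ n) constant_on UNIV"
  proof
    assume "(\<lambda>z::complex. z ^ n) constant_on UNIV"
    then obtain y where "\<And>x::complex. x ^ n = y" unfolding constant_on_def by auto
    from this[of 0] this[of 1] have "(0::complex) ^ n = 1" by simp
    then show False using n by (simp add: power_0_left)
  qed
  then have "open ((\<lambda>z. z ^ n) ` (- J))"
    using closed_julia by (intro open_mapping_thm[of _ UNIV]) (auto intro!: holomorphic_intros)
  moreover have "(\<lambda>z. z ^ n) ` (- J) = - X"
  proof
    show "(\<lambda>z. z ^ n) ` (- J) \<subseteq> - X" using power_in_X by auto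
    show "- X \<subseteq> (\<lambda>z. z ^ n) ` (- J)"
    proof
      fix x assume x: "x \<in> - X"
      obtain z where "z ^ n = x" using nth_root_exists by blast
      then show "x \<in> (\<lambda>z. z ^ n) ` (- J)" using x power_in_X[of z] by auto
    qed
  qed
  ultimately show ?thesis by (simp add: closed_def)
qed

text \<open>Used to exclude that \<open>P\<close> or a later iterate is constant on a disc. Clearing
  denominators in \<open>M x = c\<close> gives the polynomial \<open>q\<close>. If \<open>q\<close>
  were zero, its value where \<open>lam * (d x - m) + kap\<close> vanishes would force
  \<open>c = 0\<close>, and then \<open>lam * k + kap = 0\<close> would hold for all positive
  integers \<open>k\<close>.\<close>

lemma M_finite_fibre: "finite {x. d * x \<noteq> of_nat m \<and> M x = c}"
proof -
  define q where "q = monom 1 1 * (smult lam [:- of_nat m, d:] + [:kap:]) ^ n - smult c ([:- of_nat m, d:] ^ n)"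
  have pq: "poly q x = x * (lam * (d * x - of_nat m) + kap) ^ n - c * (d * x - of_nat m) ^ n" for x
    by (simp add: q_def poly_monom algebra_simps)
  have "q \<noteq> 0"
  proof
    assume q0: "q = 0"
    define x where "x = (\<lambda>y. (of_nat m + y) / d)"
    have x: "d * x y - of_nat m = y" for y using d_nonzero by (simp add: x_def)
    have "poly q (x (- kap / lam)) = 0" by (simp add: q0)
    then have "c * (- kap / lam) ^ n = 0" unfolding pq x using lam_nonzero n by (simp add: power_0_left)
    then have c: "c = 0" using kap_nonzero lam_nonzero by simp
    have z: "x y * (lam * y + kap) ^ n = 0" for y
    proof -
      have "poly q (x y) = 0" by (simp add: q0)
      then show ?thesis unfolding pq x c by simp
    qed
    have "x (of_nat k) \<noteq> 0" if "k > 0" for k :: nat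
    proof -
      have "complex_of_nat (m + k) \<noteq> 0" using that by (simp del: of_nat_add)
      then show ?thesis using d_nonzero by (simp add: x_def)
    qed
    then have "lam * of_nat k + kap = 0" if "k > 0" for k :: nat using z[of "of_nat k"] that by simp
    from this[of 1] this[of 2] have "lam + kap = 0" "lam * 2 + kap = 0" by simp_all
    then have "lam * 2 + kap - (lam + kap) = 0" by simp
    then have "lam = 0" by simp
    then show False using lam_nonzero by simp
  qed
  then have "finite {x. poly q x = 0}" by (rule poly_roots_finite)
  moreover have "{x. d * x \<noteq> of_nat m \<and> M x = c} \<subseteq> {x. poly q x = 0}"
  proof
    fix x assume "x \<in> {x. d * x \<noteq> of_nat m \<and> M x = c}"
    then have D: "d * x - of_nat m \<noteq> 0" and c: "M x = c" by auto
    define D where "D = d * x - of_nat m"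
    have "lam + kap / D = (lam * D + kap) / D" using D by (simp add: D_def add_divide_distrib)
    then have "c = x * (lam * D + kap) ^ n / D ^ n" using c by (simp add: M_def D_def[symmetric] power_divide)
    then show "x \<in> {x. poly q x = 0}" using D by (simp add: pq D_def[symmetric])
  qed
  ultimately show ?thesis by (rule finite_subset[rotated])
qed

lemma Lam_nonzero: "Lam \<noteq> 0" using lam_nonzero by (simp add: Lam_def)

lemma Lam_less: "cmod Lam < 1"
  using lam_less n by (simp add: Lam_def norm_power power_less_one_iff)

lemma x0_nonzero: "x0 \<noteq> 0"
proof -
  have "mu \<noteq> 0" using n lam_nonzero kap_nonzero d_nonzero by (simp add: mu_def)
  moreover have "1 - Lam \<noteq> 0" using Lam_less by auto
  ultimately show ?thesis by (simp add: x0_def)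
qed

lemma pole_bound: "d * x = of_nat m \<Longrightarrow> cmod x \<le> 1"
proof -
  assume "d * x = of_nat m"
  then have "cmod d * cmod x = m" by (metis norm_mult norm_of_nat)
  then have "(m + n) * cmod x = real m" by (simp add: cmod_d)
  moreover have "real m \<le> (m + n) * 1" by simp
  ultimately have "(m + n) * cmod x \<le> (m + n) * 1" by simp
  then show ?thesis using n by (simp add: mult_le_cancel_left)
qed

lemma M_holomorphic: "M holomorphic_on {x. d * x \<noteq> of_nat m}"
  unfolding M_def by (intro holomorphic_intros) auto

text \<open>With \<open>s = 1 / x\<close> the quotient \<open>M x / x\<close> is a function
  \<open>q\<close> analytic near \<open>s = 0\<close>. Its difference quotient \<open>q1\<close> at
  0 gives \<open>G x = q1 (1 / x) - mu\<close>, and one Lipschitz bound for \<open>q1\<close> yields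
  both estimates.\<close>

lemma M_expansion:
  obtains C G where "C \<ge> 0" "\<And>x. cmod x > 2 \<Longrightarrow> M x = Lam * (x - x0) + x0 + G x"
    "\<And>x. cmod x > 2 \<Longrightarrow> cmod (G x) \<le> C / cmod x"
    "\<And>x y. cmod x > 2 \<Longrightarrow> cmod y > 2 \<Longrightarrow> cmod (G x - G y) \<le> C * cmod (x - y) / (cmod x * cmod y)"
proof -
  define q where "q = (\<lambda>s. (lam + kap * s / (d - of_nat m * s)) ^ n)"
  have ds: "d - of_nat m * s \<noteq> 0" if "s \<in> ball 0 1" for s
  proof
    assume "d - of_nat m * s = 0"
    then have "cmod d = cmod (of_nat m * s)" by simp
    also have "\<dots> = m * cmod s" by (simp add: norm_mult)
    also have "\<dots> \<le> real m * 1" using that by (intro mult_left_mono) auto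
    finally show False using n by (simp add: cmod_d)
  qed
  have hol: "q holomorphic_on ball 0 1" unfolding q_def using ds by (intro holomorphic_intros) auto
  have q0: "q 0 = Lam" by (simp add: q_def Lam_def)
  have der: "(q has_field_derivative mu) (at 0)"
    unfolding q_def mu_def using d_nonzero
    by (auto intro!: derivative_eq_intros simp: power2_eq_square)
  then have dq: "deriv q 0 = mu" by (rule DERIV_imp_deriv)
  define q1 where "q1 = (\<lambda>s. if s = 0 then deriv q 0 else (q s - q 0) / (s - 0))"
  have "q1 holomorphic_on ball 0 1" unfolding q1_def by (rule pole_lemma[OF hol]) simp
  then obtain C where C: "C \<ge> 0" "\<And>s t. cmod s \<le> 1/2 \<Longrightarrow> cmod t \<le> 1/2 \<Longrightarrow> cmod (q1 s - q1 t) \<le> C * cmod (s - t)"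
    using holomorphic_lipschitz by blast
  define G where "G = (\<lambda>x. q1 (1 / x) - mu)"
  have half: "cmod (1 / x) \<le> 1/2" if "cmod x > 2" for x
  proof -
    have "1 / cmod x \<le> 1 / 2" using that by (intro divide_left_mono) auto
    then show ?thesis by (simp add: norm_divide)
  qed
  show ?thesis
  proof (rule that[OF C(1)])
    fix x assume x: "cmod x > 2"
    then have x0: "x \<noteq> 0" by auto
    have "kap / (d * x - of_nat m) = kap * (1 / x) / (d - of_nat m * (1 / x))"
    proof -
      have "d - of_nat m * (1 / x) = (d * x - of_nat m) / x" using x0 by (simp add: diff_divide_distrib)
      then show ?thesis using x0 by simp
    qed
    then have "M x = x * q (1 / x)" unfolding M_def q_def by (simp only:)
    moreover have "q1 (1 / x) = x * (q (1 / x) - Lam)" using x0 by (simp add: q1_def q0)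
    ultimately have "M x = Lam * x + mu + G x" by (simp add: G_def algebra_simps)
    moreover have "(1 - Lam) * local.x0 = mu" using Lam_less by (auto simp: x0_def)
    ultimately show "M x = Lam * (x - local.x0) + local.x0 + G x" by (simp add: algebra_simps)
    have "G x = q1 (1 / x) - q1 0" by (simp add: G_def q1_def dq)
    then show "cmod (G x) \<le> C / cmod x" using C(2)[OF half[OF x], of 0] by (simp add: norm_divide)
    fix y assume y: "cmod y > 2"
    then have y0: "y \<noteq> 0" by auto
    have "1 / x - 1 / y = (y - x) / (x * y)" using x0 y0 by (simp add: divide_simps)
    then have "cmod (1 / x - 1 / y) = cmod (x - y) / (cmod x * cmod y)"
      by (simp add: norm_divide norm_mult norm_minus_commute)
    then show "cmod (G x - G y) \<le> C * cmod (x - y) / (cmod x * cmod y)"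
      using C(2)[OF half[OF x] half[OF y]] by (simp add: G_def)
  qed
qed

lemma koenigs:
  obtains P R K where "R \<ge> 1" "K \<ge> 0" "R \<ge> K" "P holomorphic_on {y. cmod y > R}"
    "\<And>y. cmod y > R \<Longrightarrow> cmod (P y - (y + x0)) \<le> K / cmod y"
    "\<And>y. cmod y > R \<Longrightarrow> cmod (P y) > 2"
    "\<And>y. cmod (Lam * y) > R \<Longrightarrow> M (P y) = P (Lam * y)"
    "\<And>x. cmod x \<ge> R \<Longrightarrow> cmod (M x) < cmod x"
proof (rule M_expansion)
  fix C G assume G: "C \<ge> 0" "\<And>x. cmod x > 2 \<Longrightarrow> M x = Lam * (x - x0) + x0 + G x"
    "\<And>x. cmod x > 2 \<Longrightarrow> cmod (G x) \<le> C / cmod x"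
    "\<And>x y. cmod x > 2 \<Longrightarrow> cmod y > 2 \<Longrightarrow> cmod (G x - G y) \<le> C * cmod (x - y) / (cmod x * cmod y)"
  \<comment> \<open>Large enough for \<open>cmod Lam * cmod x + 2 * cmod x0 + C < cmod x\<close>,
    which gives the strict decrease of the modulus under \<open>M\<close>.\<close>
  define R0 where "R0 = Max {3, (2 * cmod x0 + C + 1) / (1 - cmod Lam)}"
  have hol: "M holomorphic_on {x. cmod x > 2}"
    by (rule holomorphic_on_subset[OF M_holomorphic]) (use pole_bound in fastforce)
  have R2: "(2::real) \<ge> 1" by simp
  show thesis
  proof (rule koenigs_at_infinity[OF Lam_nonzero Lam_less hol R2 G(1), of x0 G R0])
    fix P R K assume *: "R \<ge> R0" "R \<ge> 1" "K \<ge> 0" "R \<ge> K" "P holomorphic_on {y. cmod y > R}"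
      "\<And>y. cmod y > R \<Longrightarrow> cmod (P y - (y + x0)) \<le> K / cmod y"
      "\<And>y. cmod y > R \<Longrightarrow> cmod (P y) > 2"
      "\<And>y. cmod (Lam * y) > R \<Longrightarrow> M (P y) = P (Lam * y)"
    have "cmod (M x) < cmod x" if x: "cmod x \<ge> R" for x
    proof -
      have xR: "cmod x \<ge> 3" "cmod x \<ge> (2 * cmod x0 + C + 1) / (1 - cmod Lam)"
        using x *(1) by (simp_all add: R0_def)
      then have x2: "cmod x > 2" by simp
      have "M x = Lam * x + (x0 - Lam * x0) + G x" using G(2)[OF x2] by (simp add: algebra_simps)
      then have "cmod (M x) \<le> cmod (Lam * x) + cmod (x0 - Lam * x0) + cmod (G x)"
        using norm_triangle_ineq[of "Lam * x + (x0 - Lam * x0)" "G x"] norm_triangle_ineq[of "Lam * x" "x0 - Lam * x0"] by simp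
      also have "cmod (x0 - Lam * x0) \<le> cmod x0 + cmod Lam * cmod x0"
        using norm_triangle_ineq4[of x0 "Lam * x0"] by (simp add: norm_mult)
      also have "cmod Lam * cmod x0 \<le> 1 * cmod x0" using Lam_less by (intro mult_right_mono) auto
      also have "cmod (G x) \<le> C / 1"
      proof -
        have "C / cmod x \<le> C / 1" using xR(1) G(1) by (intro divide_left_mono) auto
        then show ?thesis using G(3)[OF x2] by linarith
      qed
      finally have "cmod (M x) \<le> cmod Lam * cmod x + (2 * cmod x0 + C)" by (simp add: norm_mult)
      moreover have "2 * cmod x0 + C + 1 \<le> cmod x * (1 - cmod Lam)"
        using xR(2) Lam_less by (simp add: divide_le_eq)
      ultimately show ?thesis by (simp add: algebra_simps)
    qed
    then show thesis by (intro that[of R K P] *(2-8))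
  qed (use G in auto)
qed

end

subsection \<open>The Julia set in the linearising coordinate\<close>

locale newton_koenigs = newton_pmn +
  fixes P :: "complex \<Rightarrow> complex" and R K :: real
  assumes R: "R \<ge> 1" and K: "K \<ge> 0" "R \<ge> K"
    and P_hol: "P holomorphic_on {y. cmod y > R}"
    and P_near: "\<And>y. cmod y > R \<Longrightarrow> cmod (P y - (y + x0)) \<le> K / cmod y"
    and P_large: "\<And>y. cmod y > R \<Longrightarrow> cmod (P y) > 2"
    and P_func: "\<And>y. cmod (Lam * y) > R \<Longrightarrow> M (P y) = P (Lam * y)"
    and M_decreasing: "\<And>x. cmod x \<ge> R \<Longrightarrow> cmod (M x) < cmod x"
begin

text \<open>The preimage of \<open>X\<close> under \<open>P\<close>, continued from
  \<open>cmod y > R\<close> to the punctured plane by invariance under \<open>Lam\<close>. By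
  \<open>Jh_iff\<close> any admissible \<open>k\<close> gives the same answer.\<close>

definition "Jh = {y. y \<noteq> 0 \<and> (\<exists>k. cmod (y / Lam ^ k) > R \<and> P (y / Lam ^ k) \<in> X)}"

lemma Lam_pos: "cmod Lam > 0" using Lam_nonzero by simp

lemma cmod_div_Lam: "cmod (y / Lam ^ k) = cmod y / cmod Lam ^ k"
  by (simp add: norm_divide norm_power)

lemma cmod_div_Lam_ge: "cmod (y / Lam ^ k) \<ge> cmod y"
proof -
  have "cmod y * cmod Lam ^ k \<le> cmod y * 1" using Lam_less by (intro mult_left_mono power_le_one) auto
  then show ?thesis unfolding cmod_div_Lam using Lam_pos by (simp add: le_divide_eq)
qed

lemma Lam_power_small:
  assumes "\<epsilon> > 0"
  shows "\<forall>\<^sub>F k in sequentially. B * cmod Lam ^ k < \<epsilon>"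
proof -
  have "(\<lambda>k. B * cmod Lam ^ k) \<longlonglongrightarrow> B * 0" using Lam_less by (intro tendsto_intros LIMSEQ_realpow_zero) auto
  then have "(\<lambda>k. B * cmod Lam ^ k) \<longlonglongrightarrow> 0" by simp
  then show ?thesis using assms by (rule order_tendstoD)
qed

lemma exists_large:
  assumes "y \<noteq> 0"
  shows "\<exists>k. cmod (y / Lam ^ k) > B"
proof -
  have "\<forall>\<^sub>F k in sequentially. B * cmod Lam ^ k < cmod y" using assms by (intro Lam_power_small) simp
  then obtain k where "B * cmod Lam ^ k < cmod y" unfolding eventually_sequentially by blast
  then have "B < cmod y / cmod Lam ^ k" using Lam_pos by (simp add: less_divide_eq)
  then show ?thesis unfolding cmod_div_Lam by blast
qed

lemma P_near_1: "cmod y > R \<Longrightarrow> cmod (P y - (y + x0)) \<le> 1"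
proof -
  assume y: "cmod y > R"
  have "K \<le> cmod y" "cmod y > 0" using y K R by linarith+
  then have "K / cmod y \<le> 1" by simp
  then show ?thesis using P_near[OF y] by linarith
qed

lemma P_nonpole: "cmod y > R \<Longrightarrow> d * P y \<noteq> of_nat m"
  using P_large[of y] pole_bound[of "P y"] by fastforce

lemma open_A: "open {y. cmod y > r}" for r :: real
  by (intro open_Collect_less continuous_intros)

lemma isCont_P: "cmod y > R \<Longrightarrow> isCont P y"
  using holomorphic_on_imp_continuous_on[OF P_hol] unfolding continuous_on_eq_continuous_at[OF open_A] by blast

lemma P_X_Lam: "cmod y > R \<Longrightarrow> P (y / Lam ^ k) \<in> X \<longleftrightarrow> P y \<in> X"
proof (induction k)
  case (Suc k)
  define u where "u = y / Lam ^ Suc k"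
  have u: "Lam * u = y / Lam ^ k" using Lam_nonzero by (simp add: u_def)
  have l: "cmod (Lam * u) > R" unfolding u using cmod_div_Lam_ge[of y k] Suc.prems by linarith
  have l': "cmod u > R" unfolding u_def using cmod_div_Lam_ge[of y "Suc k"] Suc.prems by linarith
  have "P u \<in> X \<longleftrightarrow> M (P u) \<in> X" by (rule X_M[OF P_nonpole[OF l']])
  also have "M (P u) = P (Lam * u)" by (rule P_func[OF l])
  finally show ?case using Suc unfolding u by (simp add: u_def)
qed simp

lemma Jh_iff:
  assumes "cmod (y / Lam ^ k) > R"
  shows "y \<in> Jh \<longleftrightarrow> P (y / Lam ^ k) \<in> X"
proof
  assume "y \<in> Jh"
  then obtain l where l: "cmod (y / Lam ^ l) > R" "P (y / Lam ^ l) \<in> X" by (auto simp: Jh_def)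
  have kl: "y / Lam ^ k / Lam ^ l = y / Lam ^ l / Lam ^ k" by simp
  show "P (y / Lam ^ k) \<in> X" using P_X_Lam[OF assms, of l] P_X_Lam[OF l(1), of k] l(2) unfolding kl by blast
next
  assume "P (y / Lam ^ k) \<in> X"
  moreover have "y \<noteq> 0" using assms R by auto
  ultimately show "y \<in> Jh" using assms by (auto simp: Jh_def)
qed

lemma Jh_iff_P: "cmod y > R \<Longrightarrow> y \<in> Jh \<longleftrightarrow> P y \<in> X"
  using Jh_iff[of y 0] by simp

lemma Jh_nonzero: "y \<in> Jh \<Longrightarrow> y \<noteq> 0" by (simp add: Jh_def)

lemma Jh_scale: "Lam ^ k * y \<in> Jh \<longleftrightarrow> y \<in> Jh"
proof (cases "y = 0")
  case False
  then obtain l where l: "cmod (y / Lam ^ l) > R" using exists_large by blast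
  have *: "Lam ^ k * y / Lam ^ (k + l) = y / Lam ^ l" using Lam_nonzero by (simp add: power_add)
  then show ?thesis using Jh_iff[of "Lam ^ k * y" "k + l"] Jh_iff[OF l] l by simp
qed (use Jh_nonzero in auto)

lemma Jh_closed:
  assumes y: "y \<noteq> 0" and approx: "\<And>\<epsilon>. \<epsilon> > 0 \<Longrightarrow> \<exists>w\<in>Jh. cmod (w - y) < \<epsilon>"
  shows "y \<in> Jh"
proof -
  have "\<exists>w\<in>Jh. cmod (w - y) < 1 / real (Suc j)" for j by (intro approx) simp
  then obtain s where s: "\<And>j. s j \<in> Jh" "\<And>j. cmod (s j - y) < 1 / real (Suc j)" by metis
  have lim: "s \<longlonglongrightarrow> y"
  proof (rule Lim_null_comparison[THEN LIM_zero_cancel])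
    show "\<forall>\<^sub>F j in sequentially. norm (s j - y) \<le> 1 / real (Suc j)" using s(2) by (simp add: less_imp_le)
    show "(\<lambda>j. 1 / real (Suc j)) \<longlonglongrightarrow> 0" by (rule LIMSEQ_Suc[OF lim_1_over_n])
  qed
  obtain k where k: "cmod (y / Lam ^ k) > R" using exists_large[OF y] by blast
  have lim': "(\<lambda>j. s j / Lam ^ k) \<longlonglongrightarrow> y / Lam ^ k" using Lam_nonzero by (intro tendsto_intros lim) auto
  then have "(\<lambda>j. cmod (s j / Lam ^ k)) \<longlonglongrightarrow> cmod (y / Lam ^ k)" by (rule tendsto_norm)
  then have "\<forall>\<^sub>F j in sequentially. R < cmod (s j / Lam ^ k)" using k by (rule order_tendstoD)
  then have ev: "\<forall>\<^sub>F j in sequentially. P (s j / Lam ^ k) \<in> X"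
    by (rule eventually_mono) (use Jh_iff s(1) in blast)
  have "(\<lambda>j. P (s j / Lam ^ k)) \<longlonglongrightarrow> P (y / Lam ^ k)" using isCont_tendsto_compose[OF isCont_P[OF k] lim'] .
  then have "P (y / Lam ^ k) \<in> X" using ev closed_X by (metis Lim_in_closed_set sequentially_bot)
  then show ?thesis using Jh_iff[OF k] by simp
qed

text \<open>\<open>P\<close> differs from \<open>y -> y + x0\<close> by at most 1, so Brouwer's
  theorem on the unit disc about \<open>x - x0\<close> solves \<open>P y = x\<close>.\<close>

lemma P_surj:
  assumes x: "cmod x \<ge> R + cmod x0 + 2"
  shows "\<exists>y. cmod y > R \<and> P y = x \<and> cmod (y - (x - x0)) \<le> K / cmod y"
proof -
  define S where "S = cball (x - x0) 1"
  have large: "cmod y > R" if "y \<in> S" for y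
  proof -
    have "cmod (x - x0) \<le> cmod y + 1"
      using that norm_triangle_ineq[of y "x - x0 - y"] by (simp add: S_def dist_norm)
    moreover have "cmod x \<le> cmod (x - x0) + cmod x0" using norm_triangle_ineq[of "x - x0" x0] by simp
    ultimately show ?thesis using x by linarith
  qed
  define g where "g = (\<lambda>y. (x - x0) - (P y - (y + x0)))"
  have "continuous_on S P" using large isCont_P by (intro continuous_at_imp_continuous_on) auto
  then have "continuous_on S g" unfolding g_def by (intro continuous_intros)
  moreover have "g y \<in> S" if "y \<in> S" for y
    using P_near_1[OF large[OF that]] by (simp add: g_def S_def dist_norm diff_diff_eq)
  ultimately obtain y where y: "y \<in> S" "g y = y"
    using brouwer[of S g] unfolding S_def by auto
  have yR: "cmod y > R" by (rule large[OF y(1)])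
  have "P y = x" using y(2) by (simp add: g_def algebra_simps)
  moreover have "y - (x - x0) = - (P y - (y + x0))" using \<open>P y = x\<close> by (simp add: algebra_simps)
  then have "cmod (y - (x - x0)) \<le> K / cmod y" using P_near[OF yR] by (metis norm_minus_cancel)
  ultimately show ?thesis using yR by blast
qed

text \<open>For \<open>cmod y >= R'\<close> the point \<open>P y\<close> and its rotated image have
  modulus at least \<open>R + cmod x0 + 2\<close>, as \<open>P_surj\<close> requires, and the new
  point \<open>y'\<close> has modulus at least \<open>cmod y / 2\<close>.\<close>

definition "R' = R + 4 * cmod x0 + 4"

text \<open>The rotation about 0 sends \<open>y + x0\<close> to \<open>\<beta> (y + x0)\<close>,
  which in the centred coordinate reads \<open>y -> \<beta> y + (\<beta> - 1) x0\<close>. The error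
  is that of \<open>P\<close>, made once on the way in and once on the way back.\<close>

lemma near_rotation:
  assumes \<beta>: "cmod \<beta> = 1" "\<And>x. x \<in> X \<Longrightarrow> \<beta> * x \<in> X" and y: "y \<in> Jh" "cmod y \<ge> R'"
  shows "\<exists>y'\<in>Jh. cmod (y' - (\<beta> * y + (\<beta> - 1) * x0)) \<le> 3 * K / cmod y"
proof -
  have x0p: "cmod x0 \<ge> 0" by simp
  have yR: "cmod y > R" "cmod y \<ge> 4 * cmod x0 + 4" using y(2) x0p R unfolding R'_def by linarith+
  have PyX: "P y \<in> X" using Jh_iff_P[OF yR(1)] y(1) by simp
  define x where "x = \<beta> * P y"
  have xX: "x \<in> X" unfolding x_def by (rule \<beta>(2)[OF PyX])
  have cx: "cmod x = cmod (P y)" using \<beta>(1) by (simp add: x_def norm_mult)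
  have "cmod y \<le> cmod (P y) + cmod (P y - (y + x0)) + cmod x0"
    using norm_triangle_ineq4[of "P y" "P y - (y + x0)"] norm_triangle_ineq4[of "y + x0" x0] by simp
  then have Py: "cmod (P y) \<ge> cmod y - cmod x0 - 1" using P_near_1[OF yR(1)] by linarith
  then have "cmod x \<ge> R + cmod x0 + 2" using cx y(2) x0p unfolding R'_def by linarith
  then obtain y' where y': "cmod y' > R" "P y' = x" "cmod (y' - (x - x0)) \<le> K / cmod y'" using P_surj by blast
  have y'J: "y' \<in> Jh" using Jh_iff_P[OF y'(1)] y'(2) xX by simp
  have "cmod x \<le> cmod y' + cmod (P y' - (y' + x0)) + cmod x0"
    using norm_triangle_ineq[of "y' + x0" "P y' - (y' + x0)"] norm_triangle_ineq[of y' x0] y'(2) by simp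
  then have "cmod y' \<ge> cmod y - 2 * cmod x0 - 2" using P_near_1[OF y'(1)] Py cx by linarith
  then have half: "cmod y' \<ge> cmod y / 2" using yR(2) by linarith
  have y0: "cmod y > 0" using yR(1) R by linarith
  have "K / cmod y' \<le> K / (cmod y / 2)" using half y0 K by (intro divide_left_mono mult_pos_pos) auto
  then have 1: "cmod (y' - (x - x0)) \<le> 2 * K / cmod y" using y'(3) by (simp add: mult.commute)
  have eq: "y' - (\<beta> * y + (\<beta> - 1) * x0) = (y' - (x - x0)) + \<beta> * (P y - (y + x0))"
    by (simp add: x_def algebra_simps)
  have "cmod (y' - (\<beta> * y + (\<beta> - 1) * x0)) \<le> cmod (y' - (x - x0)) + cmod (\<beta> * (P y - (y + x0)))"
    unfolding eq by (rule norm_triangle_ineq)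
  also have "\<dots> \<le> 2 * K / cmod y + K / cmod y"
    using 1 P_near[OF yR(1)] \<beta>(1) by (intro add_mono) (simp_all add: norm_mult)
  also have "\<dots> = 3 * K / cmod y" by (simp add: add_divide_distrib[symmetric])
  finally show ?thesis using y'J by blast
qed

text \<open>The translation part and the error of \<open>near_rotation\<close> are bounded.
  Conjugation with \<open>Lam^k\<close> multiplies them by \<open>Lam^k\<close>, so in the limit
  only the linear part remains.\<close>

lemma exact_rotation:
  assumes \<beta>: "cmod \<beta> = 1" "\<And>x. x \<in> X \<Longrightarrow> \<beta> * x \<in> X" and y: "y \<in> Jh"
  shows "\<beta> * y \<in> Jh"
proof (rule Jh_closed)
  show "\<beta> * y \<noteq> 0" using Jh_nonzero[OF y] \<beta>(1) by auto
  fix \<epsilon> :: real assume \<epsilon>: "\<epsilon> > 0"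
  define B where "B = 3 * K + 2 * cmod x0 + 1"
  have B: "B > 0" using K(1) unfolding B_def by (simp add: add_nonneg_pos)
  have "\<forall>\<^sub>F k in sequentially. R' * cmod Lam ^ k < cmod y" using Jh_nonzero[OF y] by (intro Lam_power_small) simp
  moreover have "\<forall>\<^sub>F k in sequentially. B * cmod Lam ^ k < \<epsilon>" using \<epsilon> by (rule Lam_power_small)
  ultimately have "\<forall>\<^sub>F k in sequentially. R' * cmod Lam ^ k < cmod y \<and> B * cmod Lam ^ k < \<epsilon>"
    by (rule eventually_conj)
  then obtain k where k: "R' * cmod Lam ^ k < cmod y" "B * cmod Lam ^ k < \<epsilon>"
    unfolding eventually_sequentially by blast
  define u where "u = y / Lam ^ k"
  have yu: "y = Lam ^ k * u" using Lam_nonzero by (simp add: u_def)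
  have uJ: "u \<in> Jh" using y Jh_scale[of k u] yu by simp
  have uR: "cmod u \<ge> R'" unfolding u_def cmod_div_Lam using k(1) Lam_pos by (simp add: le_divide_eq)
  obtain y' where y': "y' \<in> Jh" "cmod (y' - (\<beta> * u + (\<beta> - 1) * x0)) \<le> 3 * K / cmod u"
    using near_rotation[OF \<beta> uJ uR] by blast
  have "cmod u \<ge> 1" using uR R norm_ge_zero[of x0] unfolding R'_def by linarith
  then have "3 * K / cmod u \<le> 3 * K / 1" using K(1) by (intro divide_left_mono) auto
  moreover have "cmod ((\<beta> - 1) * x0) \<le> 2 * cmod x0"
  proof -
    have "cmod (\<beta> - 1) \<le> 2" using norm_triangle_ineq4[of \<beta> 1] \<beta>(1) by simp
    then show ?thesis by (simp add: norm_mult mult_right_mono)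
  qed
  moreover have "cmod (y' - \<beta> * u) \<le> cmod (y' - (\<beta> * u + (\<beta> - 1) * x0)) + cmod ((\<beta> - 1) * x0)"
    using norm_triangle_ineq[of "y' - (\<beta> * u + (\<beta> - 1) * x0)" "(\<beta> - 1) * x0"] by (simp add: algebra_simps)
  ultimately have "cmod (y' - \<beta> * u) \<le> B" using y'(2) unfolding B_def by linarith
  moreover have "Lam ^ k * y' - \<beta> * y = Lam ^ k * (y' - \<beta> * u)" by (simp add: yu algebra_simps)
  then have "cmod (Lam ^ k * y' - \<beta> * y) = cmod Lam ^ k * cmod (y' - \<beta> * u)" by (simp add: norm_mult norm_power)
  ultimately have "cmod (Lam ^ k * y' - \<beta> * y) \<le> cmod Lam ^ k * B" using Lam_pos by (simp add: mult_left_mono)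
  then have "cmod (Lam ^ k * y' - \<beta> * y) < \<epsilon>" using k(2) by (simp add: mult.commute)
  then show "\<exists>w\<in>Jh. cmod (w - \<beta> * y) < \<epsilon>" using Jh_scale[of k y'] y'(1) by blast
qed

lemma P_not_constant_large:
  assumes "r \<ge> 4" "ball y r \<subseteq> {y. cmod y > R}"
  shows "\<not> P constant_on ball y r"
proof
  assume "P constant_on ball y r"
  moreover have "y \<in> ball y r" "y + 3 \<in> ball y r" using assms(1) by (auto simp: dist_norm)
  ultimately have "P y = P (y + 3)" unfolding constant_on_def by metis
  moreover have "cmod (P y - (y + x0)) \<le> 1" "cmod (P (y + 3) - (y + 3 + x0)) \<le> 1"
    using P_near_1[of y] P_near_1[of "y + 3"] subsetD[OF assms(2) \<open>y \<in> ball y r\<close>] subsetD[OF assms(2) \<open>y + 3 \<in> ball y r\<close>] by simp_all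
  moreover have "(P y - (y + x0)) - (P (y + 3) - (y + 3 + x0)) = 3 + (P y - P (y + 3))" by simp
  ultimately have "cmod 3 \<le> 1 + (1 :: real)"
    using norm_triangle_ineq4[of "P y - (y + x0)" "P (y + 3) - (y + 3 + x0)"] by simp
  then show False by simp
qed

text \<open>A disc in \<open>Jh\<close> is blown up by a power of \<open>1 / Lam\<close> until its
  radius is at least 4, where \<open>P\<close> cannot be constant since it moves points by
  \<open>x0\<close> up to an error 1. Its open image would lie in \<open>X\<close>.\<close>

lemma interior_Jh: "interior Jh = {}"
proof (rule ccontr)
  assume "interior Jh \<noteq> {}"
  then obtain y r where yr: "r > 0" "ball y r \<subseteq> Jh" by (metis ex_in_conv mem_interior)
  have y0: "y \<noteq> 0" using yr Jh_nonzero by (metis centre_in_ball subsetD)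
  define s where "s = min r (cmod y / 2)"
  have s: "s > 0" "s \<le> r" "s \<le> cmod y / 2" using yr y0 by (auto simp: s_def)
  have "\<forall>\<^sub>F k in sequentially. R * cmod Lam ^ k < cmod y / 2" using y0 by (intro Lam_power_small) simp
  moreover have "\<forall>\<^sub>F k in sequentially. 4 * cmod Lam ^ k < s" using s(1) by (rule Lam_power_small)
  ultimately have "\<forall>\<^sub>F k in sequentially. R * cmod Lam ^ k < cmod y / 2 \<and> 4 * cmod Lam ^ k < s"
    by (rule eventually_conj)
  then obtain k where k: "R * cmod Lam ^ k < cmod y / 2" "4 * cmod Lam ^ k < s"
    unfolding eventually_sequentially by blast
  define u where "u = y / Lam ^ k"
  define t where "t = s / cmod Lam ^ k"
  have Lk: "cmod Lam ^ k > 0" using Lam_pos by simp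
  have t4: "t \<ge> 4" using k(2) Lk by (simp add: t_def le_divide_eq)
  have scaled: "Lam ^ k * w \<in> ball y s" if w: "w \<in> ball u t" for w
  proof -
    have "y - Lam ^ k * w = Lam ^ k * (u - w)" using Lam_nonzero by (simp add: u_def right_diff_distrib)
    then have "cmod (y - Lam ^ k * w) = cmod Lam ^ k * cmod (u - w)" by (simp add: norm_mult norm_power)
    also have "\<dots> < cmod Lam ^ k * t" using w Lk by (simp add: dist_norm)
    also have "\<dots> = s" unfolding t_def using Lk by (metis less_irrefl nonzero_mult_div_cancel_left times_divide_eq_right)
    finally show ?thesis by (simp add: dist_norm)
  qed
  have large: "cmod w > R" if w: "w \<in> ball u t" for w
  proof -
    have "cmod y \<le> cmod (Lam ^ k * w) + cmod (y - Lam ^ k * w)"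
      using norm_triangle_ineq[of "Lam ^ k * w" "y - Lam ^ k * w"] by simp
    then have "cmod (Lam ^ k * w) > cmod y / 2" using scaled[OF w] s(3) by (simp add: dist_norm)
    then have "cmod Lam ^ k * R < cmod Lam ^ k * cmod w" using k(1) by (simp add: norm_mult norm_power mult.commute)
    then show ?thesis using Lk by simp
  qed
  have wX: "P w \<in> X" if w: "w \<in> ball u t" for w
  proof -
    have "Lam ^ k * w \<in> Jh" using scaled[OF w] s(2) yr(2) by auto
    then show ?thesis using Jh_scale Jh_iff_P[OF large[OF w]] by simp
  qed
  have sub: "ball u t \<subseteq> {y. cmod y > R}" using large by auto
  have hol: "P holomorphic_on ball u t" by (rule holomorphic_on_subset[OF P_hol sub])
  have "open (P ` ball u t)"
    by (rule open_mapping_thm[OF hol _ _ _ _ P_not_constant_large[OF t4 sub]]) auto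
  moreover have "P ` ball u t \<subseteq> X" using wX by auto
  ultimately have "P ` ball u t \<subseteq> interior X" by (rule interior_maximal[rotated])
  moreover have "u \<in> ball u t" using t4 by simp
  ultimately show False using interior_X by auto
qed

end

subsection \<open>The flow generated by an extra rotation\<close>

locale newton_extra_rotation = newton_koenigs +
  fixes \<alpha> :: complex
  assumes \<alpha>: "cmod \<alpha> = 1" "\<alpha> \<noteq> 1" and X_rotate: "\<And>x. x \<in> X \<longleftrightarrow> \<alpha> * x \<in> X"
begin

definition "c = (\<alpha> - 1) * x0"

lemma c_nonzero: "c \<noteq> 0" using \<alpha> x0_nonzero by (simp add: c_def)

lemma \<alpha>_nonzero: "\<alpha> \<noteq> 0" using \<alpha> by auto

lemma X_rotate': "x \<in> X \<Longrightarrow> \<alpha> * x \<in> X" using X_rotate by blast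

lemma X_rotate_inverse: "x \<in> X \<Longrightarrow> inverse \<alpha> * x \<in> X"
  using X_rotate[of "inverse \<alpha> * x"] \<alpha>_nonzero by (simp add: mult.assoc[symmetric])

lemma cmod_inverse_\<alpha>: "cmod (inverse \<alpha>) = 1" using \<alpha> by (simp add: norm_inverse)

text \<open>Composing the approximate rotation by \<open>\<alpha>\<close> with the exact inverse
  rotation leaves the translation by \<open>c\<close>. For \<open>\<sigma> = -1\<close> the roles of
  \<open>\<alpha>\<close> and its inverse are exchanged, and the exact rotation comes last.\<close>

lemma near_translation:
  assumes y: "y \<in> Jh" "cmod y \<ge> R'" and \<sigma>: "\<sigma> = 1 \<or> \<sigma> = - 1"
  shows "\<exists>y'\<in>Jh. cmod (y' - (y + \<sigma> * c)) \<le> 3 * K / cmod y"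
proof (cases "\<sigma> = 1")
  case True
  have 1: "inverse \<alpha> * y \<in> Jh" by (rule exact_rotation[OF cmod_inverse_\<alpha> X_rotate_inverse y(1)])
  have 2: "cmod (inverse \<alpha> * y) = cmod y" using cmod_inverse_\<alpha> by (simp only: norm_mult mult_1)
  obtain y' where "y' \<in> Jh" "cmod (y' - (\<alpha> * (inverse \<alpha> * y) + (\<alpha> - 1) * x0)) \<le> 3 * K / cmod y"
    using near_rotation[OF \<alpha>(1) X_rotate' 1] y(2) unfolding 2 by blast
  then show ?thesis using True \<alpha>_nonzero by (auto simp: c_def mult.assoc[symmetric])
next
  case False
  then have s: "\<sigma> = - 1" using \<sigma> by simp
  obtain y' where y': "y' \<in> Jh" "cmod (y' - (inverse \<alpha> * y + (inverse \<alpha> - 1) * x0)) \<le> 3 * K / cmod y"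
    using near_rotation[OF cmod_inverse_\<alpha> X_rotate_inverse y] by blast
  have "\<alpha> * y' \<in> Jh" by (rule exact_rotation[OF \<alpha>(1) X_rotate' y'(1)])
  moreover have "\<alpha> * y' - (y + \<sigma> * c) = \<alpha> * (y' - (inverse \<alpha> * y + (inverse \<alpha> - 1) * x0))"
  proof -
    have a1: "\<alpha> * inverse \<alpha> = 1" using \<alpha>_nonzero by simp
    have "\<alpha> * (y' - (inverse \<alpha> * y + (inverse \<alpha> - 1) * x0)) = \<alpha> * y' - ((\<alpha> * inverse \<alpha>) * y + (\<alpha> * inverse \<alpha> - \<alpha>) * x0)"
      by (simp only: right_diff_distrib distrib_left left_diff_distrib mult.assoc mult_1 mult_1_right)
    then show ?thesis unfolding a1 s c_def by (simp add: algebra_simps)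
  qed
  then have "cmod (\<alpha> * y' - (y + \<sigma> * c)) \<le> 3 * K / cmod y" using y'(2) \<alpha>(1) by (simp add: norm_mult)
  ultimately show ?thesis by blast
qed

text \<open>After rescaling, the step has length of order \<open>cmod Lam ^ k\<close>, while the
  error is of the order of the square of this. So the many steps that cover a fixed distance still
  leave a total error tending to 0.\<close>

lemma near_translation_scaled:
  assumes y: "y \<in> Jh" "cmod y \<ge> R' * cmod Lam ^ k" and \<sigma>: "\<sigma> = 1 \<or> \<sigma> = - 1"
  shows "\<exists>y'\<in>Jh. cmod (y' - (y + \<sigma> * (Lam ^ k * c))) \<le> 3 * K * cmod Lam ^ k * cmod Lam ^ k / cmod y"
proof -
  have Lk: "cmod Lam ^ k > 0" using Lam_pos by simp
  define u where "u = y / Lam ^ k"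
  have yu: "y = Lam ^ k * u" using Lam_nonzero by (simp add: u_def)
  have uJ: "u \<in> Jh" using y(1) Jh_scale[of k u] yu by simp
  have uR: "cmod u \<ge> R'" unfolding u_def cmod_div_Lam using y(2) Lk by (simp add: le_divide_eq)
  obtain y' where y': "y' \<in> Jh" "cmod (y' - (u + \<sigma> * c)) \<le> 3 * K / cmod u"
    using near_translation[OF uJ uR \<sigma>] by blast
  have "Lam ^ k * y' - (y + \<sigma> * (Lam ^ k * c)) = Lam ^ k * (y' - (u + \<sigma> * c))"
    by (simp add: yu algebra_simps)
  then have "cmod (Lam ^ k * y' - (y + \<sigma> * (Lam ^ k * c))) = cmod Lam ^ k * cmod (y' - (u + \<sigma> * c))"
    by (simp add: norm_mult norm_power)
  also have "\<dots> \<le> cmod Lam ^ k * (3 * K / cmod u)" using y'(2) Lk by (intro mult_left_mono) auto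
  also have "\<dots> = 3 * K * cmod Lam ^ k * cmod Lam ^ k / cmod y"
    unfolding u_def cmod_div_Lam by (simp add: mult_ac)
  finally show ?thesis using y'(1) Jh_scale[of k y'] by blast
qed

text \<open>An Euler scheme: about \<open>\<tau> / r\<close> steps \<open>\<sigma> * u k\<close> of
  length \<open>r\<close>, with directions tending to \<open>v\<close>, follow the segment. The
  error of a step is inversely proportional to the distance from 0, which is why the segment must
  avoid 0.\<close>

lemma flow_pos:
  assumes v: "cmod v = 1" and s: "(\<lambda>k. Lam ^ s k * c / cmod (Lam ^ s k * c)) \<longlonglongrightarrow> v" "strict_mono (s :: nat \<Rightarrow> nat)"
    and \<sigma>: "\<sigma> = 1 \<or> \<sigma> = - 1" and \<tau>: "\<tau> \<ge> 0"
    and y: "y \<in> Jh" and seg: "\<And>t. 0 \<le> t \<Longrightarrow> t \<le> \<tau> \<Longrightarrow> y + \<sigma> * (of_real t * v) \<noteq> 0"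
  shows "y + \<sigma> * (of_real \<tau> * v) \<in> Jh"
proof (rule Jh_closed)
  show "y + \<sigma> * (of_real \<tau> * v) \<noteq> 0" using seg[OF \<tau>] by simp
  have cs: "cmod \<sigma> = 1" using \<sigma> by auto
  have cont: "continuous_on {0..\<tau>} (\<lambda>t. cmod (y + \<sigma> * (of_real t * v)))" by (intro continuous_intros)
  have "{0..\<tau>} \<noteq> {}" using \<tau> by simp
  then obtain t0 where t0: "t0 \<in> {0..\<tau>}" "\<And>t. t \<in> {0..\<tau>} \<Longrightarrow> cmod (y + \<sigma> * (of_real t0 * v)) \<le> cmod (y + \<sigma> * (of_real t * v))"
    using continuous_attains_inf[OF compact_Icc _ cont] by blast
  define \<delta> where "\<delta> = cmod (y + \<sigma> * (of_real t0 * v))"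
  have \<delta>: "\<delta> > 0" using seg t0(1) by (simp add: \<delta>_def)
  have \<delta>': "\<delta> \<le> cmod (y + \<sigma> * (of_real t * v))" if "0 \<le> t" "t \<le> \<tau>" for t
    using t0(2) that by (simp add: \<delta>_def)
  fix \<epsilon> :: real assume \<epsilon>: "\<epsilon> > 0"
  define L where "L = (\<lambda>k. cmod Lam ^ s k)"
  define u where "u = (\<lambda>k. Lam ^ s k * c)"
  define w where "w = (\<lambda>k. u k / cmod (u k))"
  \<comment> \<open>In this order: deviation of the direction from \<open>v\<close>, accumulated
    errors of the steps, the incomplete last step, and the radius from which a step is possible at
    this scale. With \<open>err\<close> below \<open>\<delta> / 2\<close>, all intermediate points
    keep distance at least \<open>\<delta> / 2\<close> from 0.\<close>
  define err where "err = (\<lambda>k. \<tau> * cmod (w k - v) + 6 * K * \<tau> / (cmod c * \<delta>) * L k + cmod c * L k + R' * L k)"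
  have Llim: "L \<longlonglongrightarrow> 0"
  proof -
    have "(\<lambda>k. cmod Lam ^ k) \<longlonglongrightarrow> 0" using Lam_less by (intro LIMSEQ_realpow_zero) auto
    from LIMSEQ_subseq_LIMSEQ[OF this s(2)] show ?thesis by (simp add: L_def o_def)
  qed
  have wlim: "(\<lambda>k. w k - v) \<longlonglongrightarrow> 0" using s(1) unfolding w_def u_def by (rule LIM_zero)
  have "err \<longlonglongrightarrow> \<tau> * 0 + 6 * K * \<tau> / (cmod c * \<delta>) * 0 + cmod c * 0 + R' * 0"
    unfolding err_def using tendsto_norm[OF wlim] by (intro tendsto_intros Llim) simp
  then have "err \<longlonglongrightarrow> 0" by simp
  moreover have "min (\<delta> / 2) \<epsilon> > 0" using \<delta> \<epsilon> by simp
  ultimately have "\<forall>\<^sub>F k in sequentially. err k < min (\<delta> / 2) \<epsilon>" by (rule order_tendstoD)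
  then obtain k where k: "err k < \<delta> / 2" "err k < \<epsilon>" unfolding eventually_sequentially by auto
  have Lk: "L k > 0" using Lam_pos by (simp add: L_def)
  define r where "r = cmod (u k)"
  have r: "r = L k * cmod c" by (simp add: r_def u_def L_def norm_mult norm_power)
  have r0: "r > 0" using r Lk c_nonzero by simp
  have uw: "u k = of_real r * w k" using r0 by (simp add: w_def r_def)
  \<comment> \<open>The number of steps; it hides the exponent \<open>n\<close> of the
    locale.\<close>
  define n where "n = nat \<lfloor>\<tau> / r\<rfloor>"
  have nr: "real n * r \<le> \<tau>" "\<tau> - r \<le> real n * r"
  proof -
    have q: "\<tau> / r \<ge> 0" using \<tau> r0 by simp
    have "real n \<le> \<tau> / r" "\<tau> / r - 1 \<le> real n" unfolding n_def using q by linarith+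
    then have a: "real n * r \<le> \<tau> / r * r" "(\<tau> / r - 1) * r \<le> real n * r"
      using r0 by (meson less_imp_le mult_right_mono)+
    then show "real n * r \<le> \<tau>" "\<tau> - r \<le> real n * r" using r0 by (simp_all add: left_diff_distrib)
  qed
  define E where "E = 6 * K * L k * L k / \<delta>"
  have E0: "E \<ge> 0" using K Lk \<delta> by (simp add: E_def)
  have nE: "real n * E \<le> 6 * K * \<tau> / (cmod c * \<delta>) * L k"
  proof -
    have "real n \<le> \<tau> / r" using nr(1) r0 by (simp add: le_divide_eq)
    then have "real n * E \<le> \<tau> / r * E" using E0 by (intro mult_right_mono)
    also have "\<dots> = 6 * K * \<tau> / (cmod c * \<delta>) * L k" unfolding r E_def using Lk by (simp add: mult_ac)
    finally show ?thesis .
  qed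
  have parts: "0 \<le> \<tau> * cmod (w k - v)" "0 \<le> 6 * K * \<tau> / (cmod c * \<delta>) * L k" "0 \<le> cmod c * L k" "0 \<le> R' * L k"
    using \<tau> K \<delta> Lk R by (auto simp: R'_def)
  have "\<exists>z\<in>Jh. cmod (z - (y + \<sigma> * (of_nat i * u k))) \<le> real i * E" if "i \<le> n" for i
    using that
  proof (induction i)
    case 0
    then show ?case using y by auto
  next
    case (Suc i)
    then obtain z where z: "z \<in> Jh" "cmod (z - (y + \<sigma> * (of_nat i * u k))) \<le> real i * E" by auto
    have iE: "real i * E \<le> real n * E" using Suc.prems E0 by (intro mult_right_mono) auto
    have ir: "real i * r \<le> \<tau>" "0 \<le> real i * r"
    proof -
      have "real i * r \<le> real n * r" using Suc.prems r0 by (intro mult_right_mono) auto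
      then show "real i * r \<le> \<tau>" using nr(1) by linarith
    qed (use r0 in simp)
    have eq: "y + \<sigma> * (of_nat i * u k) = (y + \<sigma> * (of_real (real i * r) * v)) + \<sigma> * (of_real (real i * r) * (w k - v))"
      unfolding uw by (simp add: algebra_simps)
    have "cmod (\<sigma> * (of_real (real i * r) * (w k - v))) = real i * r * cmod (w k - v)"
      using cs r0 by (simp add: norm_mult)
    also have "\<dots> \<le> \<tau> * cmod (w k - v)" using ir by (intro mult_right_mono) auto
    finally have e1: "cmod (\<sigma> * (of_real (real i * r) * (w k - v))) \<le> \<tau> * cmod (w k - v)" .
    have "\<delta> \<le> cmod (y + \<sigma> * (of_real (real i * r) * v))" using \<delta>' ir by blast
    also have "\<dots> \<le> cmod (y + \<sigma> * (of_nat i * u k)) + \<tau> * cmod (w k - v)"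
    proof -
      have "y + \<sigma> * (of_real (real i * r) * v) = (y + \<sigma> * (of_nat i * u k)) - \<sigma> * (of_real (real i * r) * (w k - v))"
        using eq by (simp only: add_diff_cancel_right')
      then have "cmod (y + \<sigma> * (of_real (real i * r) * v)) = cmod ((y + \<sigma> * (of_nat i * u k)) - \<sigma> * (of_real (real i * r) * (w k - v)))"
        by (rule arg_cong)
      then show ?thesis
        using norm_triangle_ineq4[of "y + \<sigma> * (of_nat i * u k)" "\<sigma> * (of_real (real i * r) * (w k - v))"] e1 by linarith
    qed
    also have "cmod (y + \<sigma> * (of_nat i * u k)) \<le> cmod z + real i * E"
      using norm_triangle_ineq4[of z "z - (y + \<sigma> * (of_nat i * u k))"] z(2) by simp
    finally have zd: "cmod z \<ge> \<delta> / 2" using k(1) iE nE parts unfolding err_def by linarith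
    then have "cmod z \<ge> R' * L k" using k(1) parts unfolding err_def by linarith
    then obtain z' where z': "z' \<in> Jh" "cmod (z' - (z + \<sigma> * u k)) \<le> 3 * K * L k * L k / cmod z"
      using near_translation_scaled[OF z(1) _ \<sigma>, of "s k"] unfolding L_def u_def by blast
    have "3 * K * L k * L k / cmod z \<le> 3 * K * L k * L k / (\<delta> / 2)"
      using zd \<delta> K Lk by (intro divide_left_mono mult_pos_pos mult_nonneg_nonneg) auto
    also have "\<dots> = E" by (simp add: E_def)
    finally have e2: "cmod (z' - (z + \<sigma> * u k)) \<le> E" using z'(2) by linarith
    have "z' - (y + \<sigma> * (of_nat (Suc i) * u k)) = (z' - (z + \<sigma> * u k)) + (z - (y + \<sigma> * (of_nat i * u k)))"
      by (simp add: algebra_simps)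
    then have "cmod (z' - (y + \<sigma> * (of_nat (Suc i) * u k))) = cmod ((z' - (z + \<sigma> * u k)) + (z - (y + \<sigma> * (of_nat i * u k))))"
      by (rule arg_cong)
    then have "cmod (z' - (y + \<sigma> * (of_nat (Suc i) * u k))) \<le> E + real i * E"
      using norm_triangle_ineq[of "z' - (z + \<sigma> * u k)" "z - (y + \<sigma> * (of_nat i * u k))"] e2 z(2) by linarith
    then show ?case using z'(1) by (intro bexI[of _ z']) (auto simp: algebra_simps)
  qed
  from this[OF order_refl] obtain z where z: "z \<in> Jh" "cmod (z - (y + \<sigma> * (of_nat n * u k))) \<le> real n * E" by blast
  have "cmod (\<sigma> * (of_nat n * u k) - \<sigma> * (of_real \<tau> * v)) \<le> r + \<tau> * cmod (w k - v)"
  proof -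
    have "\<sigma> * (of_nat n * u k) - \<sigma> * (of_real \<tau> * v) = \<sigma> * (of_real (real n * r - \<tau>) * w k + of_real \<tau> * (w k - v))"
      unfolding uw by (simp add: algebra_simps)
    then have "cmod (\<sigma> * (of_nat n * u k) - \<sigma> * (of_real \<tau> * v)) = cmod (of_real (real n * r - \<tau>) * w k + of_real \<tau> * (w k - v))"
      using cs by (simp add: norm_mult)
    also have "\<dots> \<le> cmod (of_real (real n * r - \<tau>) * w k) + cmod (of_real \<tau> * (w k - v))"
      by (rule norm_triangle_ineq)
    also have "cmod (of_real \<tau> * (w k - v)) = \<tau> * cmod (w k - v)" using \<tau> by (simp add: norm_mult)
    also have "cmod (of_real (real n * r - \<tau>) * w k) = \<bar>real n * r - \<tau>\<bar>"
    proof -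
      have "cmod (w k) = 1" using r0 unfolding w_def r_def by (simp add: norm_divide)
      then show ?thesis unfolding norm_mult norm_of_real by simp
    qed
    also have "\<bar>real n * r - \<tau>\<bar> \<le> r" using nr by linarith
    finally show ?thesis by simp
  qed
  moreover have "cmod (z - (y + \<sigma> * (of_real \<tau> * v))) \<le> cmod (z - (y + \<sigma> * (of_nat n * u k))) + cmod (\<sigma> * (of_nat n * u k) - \<sigma> * (of_real \<tau> * v))"
    using dist_triangle[of z "y + \<sigma> * (of_real \<tau> * v)" "y + \<sigma> * (of_nat n * u k)"] by (simp add: dist_norm)
  ultimately have "cmod (z - (y + \<sigma> * (of_real \<tau> * v))) \<le> real n * E + (r + \<tau> * cmod (w k - v))"
    using z(2) by linarith
  also have "\<dots> \<le> err k" using nE parts(4) r unfolding err_def by (simp add: mult.commute)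
  finally show "\<exists>z\<in>Jh. cmod (z - (y + \<sigma> * (of_real \<tau> * v))) < \<epsilon>" using z(1) k(2) by (intro bexI[of _ z]) auto
qed

text \<open>Multiplication by \<open>Lam\<close> may turn the steps \<open>Lam^k * c\<close>, so
  \<open>v\<close> is only a limit of their directions along a subsequence. Negative times are
  reached by steps in the opposite direction.\<close>

lemma flow:
  obtains v where "cmod v = 1"
    "\<And>y t. y \<in> Jh \<Longrightarrow> (\<And>s. 0 \<le> s \<Longrightarrow> s \<le> 1 \<Longrightarrow> y + of_real (s * t) * v \<noteq> 0) \<Longrightarrow> y + of_real t * v \<in> Jh"
proof -
  have sph: "\<forall>k. Lam ^ k * c / cmod (Lam ^ k * c) \<in> sphere 0 1"
    using Lam_nonzero c_nonzero by (simp add: norm_divide norm_mult)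
  have "seq_compact (sphere (0::complex) 1)" by (simp add: compact_imp_seq_compact)
  from seq_compactE[OF this sph] obtain v s where v: "v \<in> sphere 0 1" "strict_mono (s::nat \<Rightarrow> nat)"
    "((\<lambda>k. Lam ^ k * c / cmod (Lam ^ k * c)) \<circ> s) \<longlonglongrightarrow> v" .
  have v1: "cmod v = 1" using v(1) by simp
  have lim: "(\<lambda>k. Lam ^ s k * c / cmod (Lam ^ s k * c)) \<longlonglongrightarrow> v" using v(3) by (simp add: o_def)
  have "y + of_real t * v \<in> Jh"
    if y: "y \<in> Jh" and seg: "\<And>s. 0 \<le> s \<Longrightarrow> s \<le> 1 \<Longrightarrow> y + of_real (s * t) * v \<noteq> 0" for y and t :: real
  proof -
    define \<sigma> :: complex where "\<sigma> = (if t \<ge> 0 then 1 else - 1)"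
    have \<sigma>: "\<sigma> = 1 \<or> \<sigma> = - 1" by (simp add: \<sigma>_def)
    have st: "\<sigma> * (of_real \<bar>t\<bar> * v) = of_real t * v" by (simp add: \<sigma>_def)
    have "y + \<sigma> * (of_real \<bar>t\<bar> * v) \<in> Jh"
    proof (rule flow_pos[OF v1 lim v(2) \<sigma> _ y])
      fix r :: real assume r: "0 \<le> r" "r \<le> \<bar>t\<bar>"
      show "y + \<sigma> * (of_real r * v) \<noteq> 0"
      proof (cases "t = 0")
        case True
        then show ?thesis using r seg[of 0] by simp
      next
        case False
        have "of_real (r / \<bar>t\<bar> * t) = \<sigma> * of_real r" using False by (simp add: \<sigma>_def)
        then show ?thesis using seg[of "r / \<bar>t\<bar>"] r False by (simp add: mult.assoc divide_le_eq)
      qed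
    qed simp
    then show ?thesis unfolding st .
  qed
  then show ?thesis using that v1 by blast
qed

end

context newton_koenigs
begin

subsection \<open>The linearising coordinate reaches a multiple preimage of infinity\<close>

text \<open>\<open>xp\<close> is a point near which some iterate of \<open>M\<close> has a pole of order at least two.\<close>

definition "xp = (if m = 0 then - kap / (d * lam) else of_nat m / d)"

lemma xp_zero: "m = 0 \<Longrightarrow> xp = - kap / (d * lam)"
  unfolding xp_def by (simp only: if_True simp_thms)

lemma xp_pos: "m \<noteq> 0 \<Longrightarrow> xp = of_nat m / d"
  unfolding xp_def by (simp only: if_False simp_thms)

text \<open>For \<open>m = 0\<close> the pole of \<open>M\<close> is 0, and
  \<open>M x = x * (lam + kap / (d x))^n\<close> shows that a finite orbit can enter it only through
  \<open>xp\<close>.\<close>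

lemma M_eq_0_imp:
  assumes m0: "m = 0" and x: "d * x \<noteq> of_nat m" and Mx: "M x = 0"
  shows "x = xp"
proof -
  have x0: "x \<noteq> 0" using x m0 by auto
  have "d * x - of_nat m = d * x" using m0 by simp
  then have "x * (lam + kap / (d * x)) ^ n = 0" using Mx unfolding M_def by (simp only:)
  then have "lam + kap / (d * x) = 0" using x0 by simp
  moreover have "(lam + kap / (d * x)) * (d * x) = d * lam * x + kap"
  proof -
    have "(lam + kap / (d * x)) * (d * x) = lam * (d * x) + kap / (d * x) * (d * x)" by (rule distrib_right)
    also have "kap / (d * x) * (d * x) = kap" using x0 d_nonzero by simp
    finally show ?thesis by (simp add: mult_ac)
  qed
  ultimately have "d * lam * x = - kap" by (simp add: eq_neg_iff_add_eq_0)
  moreover have "d * lam \<noteq> 0" using d_nonzero lam_nonzero by simp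
  ultimately have "x = - kap / (d * lam)" by (metis nonzero_mult_div_cancel_left)
  then show ?thesis using xp_zero[OF m0] by simp
qed

text \<open>An orbit that avoids \<open>xp\<close> also avoids the preimages of \<open>xp\<close>;
  this supplies a second omitted value for Picard's theorem. If \<open>q\<close> had no zero it
  would be constant, and comparing its values at \<open>xp\<close> and at the zero of
  \<open>lam + kap / (d x - m)\<close> would give \<open>cmod lam ^ n = 1\<close>.\<close>

lemma second_omitted_value:
  assumes m0: "m \<noteq> 0"
  shows "\<exists>x. d * x \<noteq> of_nat m \<and> M x = xp"
proof -
  define q where "q = monom 1 1 * (smult lam [:- of_nat m, d:] + [:kap:]) ^ n - smult xp ([:- of_nat m, d:] ^ n)"
  have pq: "poly q x = x * (lam * (d * x - of_nat m) + kap) ^ n - xp * (d * x - of_nat m) ^ n" for x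
    by (simp add: q_def poly_monom algebra_simps)
  have xp: "d * xp = of_nat m" "xp \<noteq> 0" using xp_pos[OF m0] d_nonzero m0 by auto
  have q_xp: "poly q xp = xp * kap ^ n" unfolding pq xp using n by (simp add: power_0_left)
  have "\<not> constant (poly q)"
  proof
    assume c: "constant (poly q)"
    define x where "x = (of_nat m - kap / lam) / d"
    have x: "d * x - of_nat m = - kap / lam" using d_nonzero by (simp add: x_def)
    have "poly q x = - xp * (- kap / lam) ^ n" unfolding pq x using lam_nonzero n by (simp add: power_0_left)
    moreover have "poly q x = poly q xp" using c unfolding Fundamental_Theorem_Algebra.constant_def by blast
    ultimately have "cmod (- xp * (- kap / lam) ^ n) = cmod (xp * kap ^ n)" using q_xp by simp
    then have "(cmod kap / cmod lam) ^ n = cmod kap ^ n"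
      using xp(2) by (simp add: norm_mult norm_power norm_divide)
    then have "cmod lam ^ n = 1" using kap_nonzero lam_nonzero by (simp add: power_divide field_simps)
    then show False using lam_less n power_eq_imp_eq_base[of "cmod lam" n 1] by simp
  qed
  then obtain x where x: "poly q x = 0" using fundamental_theorem_of_algebra by blast
  have D: "d * x \<noteq> of_nat m"
  proof
    assume "d * x = of_nat m"
    then have "d * x = d * xp" using xp by simp
    then have "x = xp" using d_nonzero by simp
    then show False using x q_xp xp(2) kap_nonzero by simp
  qed
  define E where "E = d * x - of_nat m"
  have E: "E \<noteq> 0" using D by (simp add: E_def)
  have "lam + kap / E = (lam * E + kap) / E" using E by (simp add: add_divide_distrib)
  then have "M x = x * (lam * E + kap) ^ n / E ^ n" by (simp add: M_def E_def[symmetric] power_divide)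
  also have "x * (lam * E + kap) ^ n = xp * E ^ n" using x unfolding pq E_def by simp
  also have "xp * E ^ n / E ^ n = xp" using E by simp
  finally show ?thesis using D by blast
qed

text \<open>If \<open>xp\<close> were never reached, no orbit from the image of \<open>P\<close>
  would meet a pole, and \<open>P\<close> would extend to the punctured plane. The extension omits
  two values, so its singularity at 0 is removable or a pole. In the first case it is
  \<open>y + x0\<close>, which omits only \<open>x0\<close>; in the second an orbit of
  \<open>M\<close> escapes to infinity, against \<open>M_decreasing\<close>.\<close>

lemma P_orbit_hits:
  "\<exists>y k. cmod y > R \<and> (\<forall>i<k. d * (M ^^ i) (P y) \<noteq> of_nat m) \<and> (M ^^ k) (P y) = xp"
proof (rule ccontr)
  assume none: "\<not> ?thesis"
  have nonpole: "d * (M ^^ k) (P y) \<noteq> of_nat m" if y: "cmod y > R" for y k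
  proof (induction k rule: less_induct)
    case (less k)
    show ?case
    proof
      assume pole: "d * (M ^^ k) (P y) = of_nat m"
      show False
      proof (cases "m = 0")
        case False
        have "(M ^^ k) (P y) = of_nat m / d" using pole d_nonzero by (metis nonzero_mult_div_cancel_left)
        then have "(M ^^ k) (P y) = xp" using xp_pos[OF False] by simp
        then show False using none y less by blast
      next
        case True
        then have z: "(M ^^ k) (P y) = 0" using pole d_nonzero by simp
        show False
        proof (cases k)
          case 0
          then show False using z P_large[OF y] by simp
        next
          case (Suc j)
          have "d * (M ^^ j) (P y) \<noteq> of_nat m" using less[of j] Suc by simp
          moreover have "M ((M ^^ j) (P y)) = 0" using z Suc by simp
          ultimately have "(M ^^ j) (P y) = xp" using M_eq_0_imp[OF True] by blast
          moreover have "\<forall>i<j. d * (M ^^ i) (P y) \<noteq> of_nat m" using less Suc by simp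
          ultimately show False using none y by blast
        qed
      qed
    qed
  qed
  have omit1: "(M ^^ k) (P y) \<noteq> xp" if "cmod y > R" for y k using none nonpole that by blast
  obtain u where u: "u \<noteq> xp" "\<And>y k. cmod y > R \<Longrightarrow> (M ^^ k) (P y) \<noteq> u"
  proof (cases "m = 0")
    case True
    have "xp \<noteq> 0" using xp_zero[OF True] kap_nonzero d_nonzero lam_nonzero by simp
    moreover have "(M ^^ k) (P y) \<noteq> 0" if "cmod y > R" for y k using nonpole[OF that, of k] True by auto
    ultimately show ?thesis using that[of 0] by auto
  next
    case False
    obtain x where x: "d * x \<noteq> of_nat m" "M x = xp" using second_omitted_value[OF False] by blast
    have "d * xp = of_nat m" using xp_pos[OF False] d_nonzero by simp
    then have "x \<noteq> xp" using x(1) by auto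
    moreover have "(M ^^ k) (P y) \<noteq> x" if "cmod y > R" for y k
      using omit1[OF that, of "Suc k"] x(2) by auto
    ultimately show ?thesis using that[of x] by auto
  qed
  have hol: "(\<lambda>y. (M ^^ k) (P y)) holomorphic_on {y. cmod y > R}" for k
  proof (induction k)
    case 0
    show ?case using P_hol by simp
  next
    case (Suc k)
    have "(\<lambda>y. (M ^^ k) (P y)) ` {y. cmod y > R} \<subseteq> {x. d * x \<noteq> of_nat m}" using nonpole by auto
    from holomorphic_on_compose_gen[OF Suc M_holomorphic this] show ?case by (simp add: o_def)
  qed
  \<comment> \<open>The extension forced by \<open>Pe (Lam y) = M (Pe y)\<close>; the choice of
    \<open>k\<close> does not affect the value, by \<open>step\<close>.\<close>
  define Pe where "Pe = (\<lambda>y. let k = (SOME k. cmod (y / Lam ^ k) > R) in (M ^^ k) (P (y / Lam ^ k)))"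
  have step: "(M ^^ (k + l)) (P (y / Lam ^ (k + l))) = (M ^^ k) (P (y / Lam ^ k))" if k: "cmod (y / Lam ^ k) > R" for y k l
  proof (induction l)
    case (Suc l)
    define w where "w = y / Lam ^ (k + Suc l)"
    have w: "Lam * w = y / Lam ^ (k + l)" using Lam_nonzero by (simp add: w_def)
    have kl: "y / Lam ^ (k + l) = y / Lam ^ k / Lam ^ l" by (simp add: power_add)
    have "cmod (Lam * w) > R" unfolding w kl using cmod_div_Lam_ge[of "y / Lam ^ k" l] k by linarith
    then have "M (P w) = P (y / Lam ^ (k + l))" using P_func w by simp
    then have "(M ^^ (k + Suc l)) (P w) = (M ^^ (k + l)) (P (y / Lam ^ (k + l)))"
      by (simp add: funpow_Suc_right del: funpow.simps)
    then show ?case using Suc by (simp add: w_def)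
  qed simp
  have Pe: "Pe y = (M ^^ k) (P (y / Lam ^ k))" if k: "cmod (y / Lam ^ k) > R" for y k
  proof -
    define l where "l = (SOME k. cmod (y / Lam ^ k) > R)"
    have l: "cmod (y / Lam ^ l) > R" unfolding l_def using k by (rule someI)
    have "Pe y = (M ^^ l) (P (y / Lam ^ l))" by (simp add: Pe_def l_def Let_def)
    also have "\<dots> = (M ^^ (l + k)) (P (y / Lam ^ (l + k)))" using step[OF l, of k] by simp
    also have "l + k = k + l" by simp
    also have "(M ^^ (k + l)) (P (y / Lam ^ (k + l))) = (M ^^ k) (P (y / Lam ^ k))" using step[OF k] .
    finally show ?thesis .
  qed
  define U where "U = (\<lambda>k. {y. cmod (y / Lam ^ k) > R})"
  have openU: "open (U k)" for k
    unfolding U_def using Lam_nonzero by (intro open_Collect_less continuous_intros) auto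
  have cover: "UNIV - {0} = (\<Union>k. U k)"
  proof
    show "UNIV - {0} \<subseteq> (\<Union>k. U k)" using exists_large by (auto simp: U_def)
    show "(\<Union>k. U k) \<subseteq> UNIV - {0}" using R by (auto simp: U_def)
  qed
  have "Pe holomorphic_on U k" for k
  proof -
    have sc: "(\<lambda>y. y / Lam ^ k) holomorphic_on U k" using Lam_nonzero by (intro holomorphic_intros) auto
    have "(\<lambda>y. y / Lam ^ k) ` U k \<subseteq> {y. cmod y > R}" by (auto simp: U_def)
    from holomorphic_on_compose_gen[OF sc hol this, of k]
    have "(\<lambda>y. (M ^^ k) (P (y / Lam ^ k))) holomorphic_on U k" by (simp add: o_def)
    then show ?thesis by (rule holomorphic_transform) (auto simp: U_def Pe)
  qed
  then have Pe_hol: "Pe holomorphic_on UNIV - {0}"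
    unfolding cover using openU by (intro holomorphic_on_UN_open) auto
  have Pe_omit: "Pe y \<noteq> xp \<and> Pe y \<noteq> u" if y: "y \<in> UNIV - {0}" for y
  proof -
    obtain k where k: "cmod (y / Lam ^ k) > R" using exists_large y by blast
    then show ?thesis using Pe[OF k] omit1[OF k] u(2)[OF k] by simp
  qed
  define f where "f = (\<lambda>y. Pe y - xp)"
  have "f holomorphic_on UNIV - {0}" unfolding f_def by (intro holomorphic_intros Pe_hol)
  moreover have "f y \<noteq> 0 \<and> f y \<noteq> u - xp" if "y \<in> UNIV - {0}" for y
    using Pe_omit[OF that] by (simp add: f_def)
  ultimately obtain l where l: "(f \<longlongrightarrow> l) (at 0) \<or> ((inverse \<circ> f) \<longlongrightarrow> l) (at 0)"
    using great_Picard[of UNIV 0 0 "u - xp" f] u(1) by auto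
  \<comment> \<open>Removable case: the extension minus \<open>y + x0\<close> is entire and tends to
    0 at infinity.\<close>
  have False if lim: "(Pe \<longlongrightarrow> l) (at 0)" for l
  proof -
    define Q where "Q = (\<lambda>y. if y = 0 then l else Pe y)"
    have "Q holomorphic_on UNIV" unfolding Q_def by (rule removable_singularity[OF Pe_hol _ lim]) simp
    then have hol': "(\<lambda>y. Q y - (y + x0)) holomorphic_on UNIV" by (intro holomorphic_intros)
    have "((\<lambda>y. Q y - (y + x0)) \<longlongrightarrow> 0) at_infinity"
    proof (rule Lim_null_comparison)
      show "\<forall>\<^sub>F y in at_infinity. norm (Q y - (y + x0)) \<le> K / cmod y"
        unfolding eventually_at_infinity
      proof (intro exI allI impI)
        fix y :: complex assume "R + 1 \<le> norm y"
        then have y: "cmod y > R" by simp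
        moreover have "y \<noteq> 0" using y R by auto
        ultimately show "norm (Q y - (y + x0)) \<le> K / cmod y" using P_near[OF y] Pe[of y 0] by (simp add: Q_def)
      qed
      show "((\<lambda>y. K / cmod y) \<longlongrightarrow> 0) at_infinity"
        by (intro tendsto_divide_0[OF tendsto_const] filterlim_at_top_imp_at_infinity filterlim_norm_at_top)
    qed
    from Liouville_weak_0[OF hol' this] have Q: "Q y = y + x0" for y by (metis eq_iff_diff_eq_0)
    have "xp \<noteq> x0 \<or> u \<noteq> x0" using u(1) by auto
    then obtain w where w: "w \<noteq> x0" "w = xp \<or> w = u" by auto
    then have "Pe (w - x0) = w" using Q[of "w - x0"] by (simp add: Q_def)
    then show False using Pe_omit[of "w - x0"] w by auto
  qed
  then have fin: False if "(f \<longlongrightarrow> l) (at 0)" for l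
    using tendsto_add[OF that tendsto_const[of xp]] by (simp add: f_def)
  have fin': False if lim: "((inverse \<circ> f) \<longlongrightarrow> l) (at 0)" and l0: "l \<noteq> 0" for l
  proof -
    have "((\<lambda>y. inverse ((inverse \<circ> f) y)) \<longlongrightarrow> inverse l) (at 0)" using lim l0 by (rule tendsto_inverse)
    then have "(f \<longlongrightarrow> inverse l) (at 0)" by (simp add: o_def)
    then show False by (rule fin)
  qed
  \<comment> \<open>Pole case: the points \<open>Pe (Lam^k * y)\<close> form an orbit of
    \<open>M\<close> that would grow beyond all bounds, although \<open>M\<close> decreases the
    modulus outside radius \<open>R\<close>.\<close>
  have False if lim: "((inverse \<circ> f) \<longlongrightarrow> 0) (at 0)"
  proof -
    define y :: complex where "y = of_real (R + 1)"
    have y: "cmod y > R" using R by (simp add: y_def)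
    define x where "x = (\<lambda>k. (M ^^ k) (P y))"
    have xk: "x k = Pe (Lam ^ k * y)" for k
      using Pe[of "Lam ^ k * y" k] y Lam_nonzero by (simp add: x_def)
    have Ly: "(\<lambda>k. Lam ^ k * y) \<longlonglongrightarrow> 0 * y" using Lam_less by (intro tendsto_intros LIMSEQ_power_zero)
    have "y \<noteq> 0" using y R by auto
    then have "filterlim (\<lambda>k. Lam ^ k * y) (at 0) sequentially"
      unfolding filterlim_at using Ly Lam_nonzero by (auto intro!: always_eventually)
    from filterlim_compose[OF lim this] have "(\<lambda>k. inverse (x k - xp)) \<longlonglongrightarrow> 0" by (simp add: o_def xk f_def)
    then have inv0: "(\<lambda>k. cmod (inverse (x k - xp))) \<longlonglongrightarrow> 0" using tendsto_norm_zero by blast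
    have big: "\<forall>\<^sub>F k in sequentially. cmod (x k) > B" if B: "B > 0" for B
    proof -
      have Bp: "B + cmod xp > 0" using B by (simp add: add_pos_nonneg)
      then have "inverse (B + cmod xp) > 0" by simp
      with inv0 have "\<forall>\<^sub>F k in sequentially. cmod (inverse (x k - xp)) < inverse (B + cmod xp)"
        by (rule order_tendstoD)
      then show ?thesis
      proof (rule eventually_mono)
        fix k assume k: "cmod (inverse (x k - xp)) < inverse (B + cmod xp)"
        have "x k \<noteq> xp" unfolding x_def by (rule omit1[OF y])
        then have "cmod (x k - xp) > 0" by simp
        then have "B + cmod xp < cmod (x k - xp)"
          using k Bp by (simp add: norm_inverse inverse_less_iff_less)
        then show "B < cmod (x k)" using norm_triangle_ineq4[of "x k" xp] by linarith
      qed
    qed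
    obtain k0 where k0: "\<And>k. k \<ge> k0 \<Longrightarrow> cmod (x k) > R"
      using big[of R] R unfolding eventually_sequentially by auto
    have dec: "cmod (x (k0 + i)) \<le> cmod (x k0)" for i
    proof (induction i)
      case (Suc i)
      have "cmod (M (x (k0 + i))) < cmod (x (k0 + i))" using k0[of "k0 + i"] by (intro M_decreasing) simp
      then show ?case using Suc by (simp add: x_def)
    qed simp
    have "cmod (x k0) > 0" using k0[of k0] R by linarith
    then obtain k1 where k1: "\<And>k. k \<ge> k1 \<Longrightarrow> cmod (x k) > cmod (x k0)"
      using big unfolding eventually_sequentially by blast
    show False using k1[of "k0 + k1"] dec[of k1] by simp
  qed
  then show False using l fin fin' by metis
qed

end

section \<open>Local form of the iterated linearising coordinate at a multiple preimage of
  infinity\<close>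

lemma finite_image_imp_constant_on:
  fixes f :: "complex \<Rightarrow> complex"
  assumes hol: "f holomorphic_on ball y r" and r: "r > 0" and fin: "finite (f ` ball y r)"
  shows "f constant_on ball y r"
proof (rule ccontr)
  assume "\<not> f constant_on ball y r"
  then have "open (f ` ball y r)" by (intro open_mapping_thm[OF hol]) auto
  moreover have "f ` ball y r \<noteq> {}" using r by auto
  ultimately obtain z e where "e > 0" "ball z e \<subseteq> f ` ball y r" by (metis ex_in_conv open_contains_ball)
  then have "finite (ball z e)" using fin finite_subset by blast
  then show False using \<open>e > 0\<close> uncountable_ball countable_finite by blast
qed

text \<open>At a zero of order \<open>D\<close> a function is the \<open>D\<close>-th power of a
  local coordinate, and \<open>\<psi>\<close> is the inverse of that coordinate. The vanishing
  derivative gives \<open>D >= 2\<close>.\<close>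

lemma zero_power_coordinate:
  fixes f :: "complex \<Rightarrow> complex"
  assumes hol: "f holomorphic_on ball \<xi> r" and r: "r > 0" and f0: "f \<xi> = 0" and f1: "deriv f \<xi> = 0"
    and nc: "\<not> f constant_on ball \<xi> r"
  obtains D \<psi> \<eta> where "D \<ge> 2" "\<eta> > 0" "\<psi> holomorphic_on ball 0 \<eta>" "\<psi> 0 = \<xi>" "deriv \<psi> 0 \<noteq> 0"
    "\<And>q. q \<in> ball 0 \<eta> \<Longrightarrow> \<psi> q \<in> ball \<xi> r" "\<And>q. q \<in> ball 0 \<eta> \<Longrightarrow> f (\<psi> q) = q ^ D"
proof -
  have "\<exists>n>0. (deriv ^^ n) f \<xi> \<noteq> 0"
  proof (rule ccontr)
    assume "\<not> ?thesis"
    then have z: "(deriv ^^ k) f \<xi> = 0" if "0 < k" for k using that by blast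
    have "f w = f \<xi>" if "w \<in> ball \<xi> r" for w
      by (rule holomorphic_fun_eq_const_on_connected[OF hol open_ball connected_ball z _ that]) (use r in auto)
    then show False using nc unfolding constant_on_def by blast
  qed
  then obtain k where k: "k > 0 \<and> (deriv ^^ k) f \<xi> \<noteq> 0" by blast
  define D where "D = (LEAST k. k > 0 \<and> (deriv ^^ k) f \<xi> \<noteq> 0)"
  have D: "D > 0" "(deriv ^^ D) f \<xi> \<noteq> 0" using LeastI[of "\<lambda>k. k > 0 \<and> (deriv ^^ k) f \<xi> \<noteq> 0", OF k] by (auto simp: D_def)
  have least: "(deriv ^^ i) f \<xi> = 0" if "0 < i" "i < D" for i
    using not_less_Least[of i "\<lambda>k. k > 0 \<and> (deriv ^^ k) f \<xi> \<noteq> 0"] that by (auto simp: D_def)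
  have "D \<noteq> 1" using D(2) f1 by auto
  then have D2: "D \<ge> 2" using D(1) by simp
  have \<xi>: "\<xi> \<in> ball \<xi> r" using r by simp
  show thesis
  proof (rule holomorphic_factor_order_of_zero_strong[OF hol open_ball \<xi> D least])
    fix g s
    assume s: "0 < s" and ghol: "g holomorphic_on ball \<xi> s"
      and fg: "\<And>w. w \<in> ball \<xi> s \<Longrightarrow> f w - f \<xi> = ((w - \<xi>) * g w) ^ D"
      and g0: "\<And>w. w \<in> ball \<xi> s \<Longrightarrow> g w \<noteq> 0"
    define t where "t = min r s"
    have t: "t > 0" "ball \<xi> t \<subseteq> ball \<xi> s" "ball \<xi> t \<subseteq> ball \<xi> r" using r s by (auto simp: t_def)
    define \<phi> where "\<phi> = (\<lambda>w. (w - \<xi>) * g w)"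
    have \<phi>hol: "\<phi> holomorphic_on ball \<xi> t"
      unfolding \<phi>_def by (intro holomorphic_intros holomorphic_on_subset[OF ghol t(2)])
    have \<phi>der: "deriv \<phi> \<xi> \<noteq> 0"
    proof -
      have "(g has_field_derivative deriv g \<xi>) (at \<xi>)" using ghol s by (intro holomorphic_derivI[of _ "ball \<xi> s"]) auto
      then have "(\<phi> has_field_derivative g \<xi>) (at \<xi>)" unfolding \<phi>_def
        by (auto intro!: derivative_eq_intros)
      then have "deriv \<phi> \<xi> = g \<xi>" by (rule DERIV_imp_deriv)
      then show ?thesis using g0 s by simp
    qed
    obtain t' where t': "t' > 0" "ball \<xi> t' \<subseteq> ball \<xi> t" "inj_on \<phi> (ball \<xi> t')"
      using has_complex_derivative_locally_injective[OF \<phi>hol _ open_ball \<phi>der] t(1) by auto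
    have \<phi>hol': "\<phi> holomorphic_on ball \<xi> t'" by (rule holomorphic_on_subset[OF \<phi>hol t'(2)])
    have op: "open (\<phi> ` ball \<xi> t')" by (rule open_mapping_thm3[OF \<phi>hol' open_ball t'(3)])
    show thesis
    proof (rule holomorphic_has_inverse[OF \<phi>hol' open_ball t'(3)])
      fix \<psi> assume \<psi>hol: "\<psi> holomorphic_on \<phi> ` ball \<xi> t'"
        and \<psi>der: "\<And>z. z \<in> ball \<xi> t' \<Longrightarrow> deriv \<phi> z * deriv \<psi> (\<phi> z) = 1"
        and \<psi>: "\<And>z. z \<in> ball \<xi> t' \<Longrightarrow> \<psi> (\<phi> z) = z"
      have \<phi>\<xi>: "\<phi> \<xi> = 0" by (simp add: \<phi>_def)
      have \<xi>': "\<xi> \<in> ball \<xi> t'" using t' by simp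
      have "0 \<in> \<phi> ` ball \<xi> t'" using \<phi>\<xi> \<xi>' by (metis imageI)
      then obtain \<eta> where \<eta>: "\<eta> > 0" "ball 0 \<eta> \<subseteq> \<phi> ` ball \<xi> t'" using op open_contains_ball by blast
      show thesis
      proof (rule that[OF D2 \<eta>(1)])
        show "\<psi> holomorphic_on ball 0 \<eta>" by (rule holomorphic_on_subset[OF \<psi>hol \<eta>(2)])
        show "\<psi> 0 = \<xi>" using \<psi>[OF \<xi>'] \<phi>\<xi> by simp
        show "deriv \<psi> 0 \<noteq> 0" using \<psi>der[OF \<xi>'] \<phi>\<xi> by auto
        fix q :: complex assume "q \<in> ball 0 \<eta>"
        then obtain z where z: "z \<in> ball \<xi> t'" "q = \<phi> z" using \<eta>(2) by blast
        have \<psi>q: "\<psi> q = z" using \<psi>[OF z(1)] z(2) by simp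
        show "\<psi> q \<in> ball \<xi> r" unfolding \<psi>q using z(1) t'(2) t(3) by blast
        have "z \<in> ball \<xi> s" using z(1) t'(2) t(2) by blast
        then show "f (\<psi> q) = q ^ D" unfolding \<psi>q using fg f0 z(2) by (simp add: \<phi>_def)
      qed
    qed
  qed
qed

context newton_koenigs
begin

text \<open>If \<open>P\<close> is constant on a disc, then so is \<open>M (P w)\<close> on the disc
  scaled up by \<open>1 / Lam\<close>, and the finite fibres of \<open>M\<close> make
  \<open>P\<close> itself constant there. Repeating this reaches radius 4, where
  \<open>P_not_constant_large\<close> applies.\<close>

lemma P_not_constant:
  assumes "r > 0" "ball y r \<subseteq> {y. cmod y > R}"
  shows "\<not> P constant_on ball y r"
proof
  assume const: "P constant_on ball y r"
  define B where "B = (\<lambda>k. ball (y / Lam ^ k) (r / cmod Lam ^ k))"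
  have LB: "Lam * w \<in> B k" if "w \<in> B (Suc k)" for w k
  proof -
    have "y / Lam ^ k - Lam * w = Lam * (y / Lam ^ Suc k - w)" using Lam_nonzero by (simp add: right_diff_distrib)
    then have "cmod (y / Lam ^ k - Lam * w) = cmod Lam * cmod (y / Lam ^ Suc k - w)" by (simp only: norm_mult)
    also have "\<dots> < cmod Lam * (r / cmod Lam ^ Suc k)"
      using that Lam_pos by (intro mult_strict_left_mono) (auto simp: B_def dist_norm)
    also have "\<dots> = r / cmod Lam ^ k" using Lam_pos by simp
    finally show ?thesis by (simp add: B_def dist_norm)
  qed
  have BR: "B k \<subseteq> {y. cmod y > R}" for k
  proof (induction k)
    case 0
    then show ?case using assms(2) by (simp add: B_def)
  next
    case (Suc k)
    show ?case
    proof
      fix w assume "w \<in> B (Suc k)"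
      then have "cmod (Lam * w) > R" using LB Suc by blast
      moreover have "cmod (Lam * w) \<le> 1 * cmod w" unfolding norm_mult using Lam_less by (intro mult_right_mono) auto
      ultimately show "w \<in> {y. cmod y > R}" by simp
    qed
  qed
  have "P constant_on B k" for k
  proof (induction k)
    case 0
    then show ?case using const by (simp add: B_def)
  next
    case (Suc k)
    then obtain c where c: "\<And>w. w \<in> B k \<Longrightarrow> P w = c" unfolding constant_on_def by blast
    have "P ` B (Suc k) \<subseteq> {x. d * x \<noteq> of_nat m \<and> M x = c}"
    proof safe
      fix w assume w: "w \<in> B (Suc k)"
      have "cmod (Lam * w) > R" using LB[OF w] BR by blast
      then show "M (P w) = c" using P_func c[OF LB[OF w]] by simp
      assume "d * P w = of_nat m"
      moreover have "cmod w > R" using w BR by blast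
      ultimately show False using P_nonpole by blast
    qed
    then have fin: "finite (P ` B (Suc k))" using M_finite_fibre finite_subset by blast
    have "P holomorphic_on B (Suc k)" by (rule holomorphic_on_subset[OF P_hol BR])
    then show ?case using finite_image_imp_constant_on fin assms(1) Lam_pos unfolding B_def by simp
  qed
  moreover obtain k where "4 * cmod Lam ^ k < r"
    using Lam_power_small[OF assms(1), of 4] unfolding eventually_sequentially by blast
  then have "r / cmod Lam ^ k \<ge> 4" using Lam_pos by (simp add: le_divide_eq)
  ultimately show False using P_not_constant_large[of "r / cmod Lam ^ k" "y / Lam ^ k"] BR[of k] unfolding B_def by blast
qed

text \<open>The domain on which the \<open>k\<close>-th iterate is meaningful: at and after a pole,
  \<open>M\<close> would only return values produced by division by zero.\<close>

definition "U k = {y. cmod y > R \<and> (\<forall>i<k. d * (M ^^ i) (P y) \<noteq> of_nat m)}"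

lemma iterate_on_U: "open (U k) \<and> (\<lambda>y. (M ^^ k) (P y)) holomorphic_on U k"
proof (induction k)
  case 0
  show ?case using open_A P_hol by (simp add: U_def)
next
  case (Suc k)
  have eq: "U (Suc k) = U k \<inter> (\<lambda>y. (M ^^ k) (P y)) -` {x. d * x \<noteq> of_nat m}"
    by (auto simp: U_def less_Suc_eq)
  have opn: "open {x. d * x \<noteq> of_nat m}" by (intro open_Collect_neq continuous_intros)
  have "continuous_on (U k) (\<lambda>y. (M ^^ k) (P y))" using Suc holomorphic_on_imp_continuous_on by blast
  then have op: "open (U (Suc k))" unfolding eq using Suc opn continuous_open_preimage by blast
  have hol: "(\<lambda>y. (M ^^ k) (P y)) holomorphic_on U (Suc k)"
    using Suc by (rule holomorphic_on_subset[OF conjunct2]) (auto simp: eq)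
  have sub: "(\<lambda>y. (M ^^ k) (P y)) ` U (Suc k) \<subseteq> {x. d * x \<noteq> of_nat m}" by (auto simp: U_def)
  from holomorphic_on_compose_gen[OF hol M_holomorphic sub] op show ?case by (simp add: o_def)
qed

lemma Jh_iff_U: "y \<in> U k \<Longrightarrow> y \<in> Jh \<longleftrightarrow> (M ^^ k) (P y) \<in> X"
proof (induction k)
  case 0
  then show ?case using Jh_iff_P[of y] by (simp add: U_def)
next
  case (Suc k)
  then have "y \<in> U k" "d * (M ^^ k) (P y) \<noteq> of_nat m" by (auto simp: U_def)
  then show ?case using Suc X_M[of "(M ^^ k) (P y)"] by simp
qed

lemma iterate_not_constant:
  assumes "r > 0" "ball y r \<subseteq> U k"
  shows "\<not> (\<lambda>y. (M ^^ k) (P y)) constant_on ball y r"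
  using assms
proof (induction k)
  case 0
  then show ?case using P_not_constant[of r y] by (auto simp: U_def)
next
  case (Suc k)
  have sub: "ball y r \<subseteq> U k" using Suc.prems by (auto simp: U_def)
  show ?case
  proof
    assume "(\<lambda>y. (M ^^ Suc k) (P y)) constant_on ball y r"
    then obtain c where c: "\<And>w. w \<in> ball y r \<Longrightarrow> (M ^^ Suc k) (P w) = c" unfolding constant_on_def by blast
    have "(\<lambda>y. (M ^^ k) (P y)) ` ball y r \<subseteq> {x. d * x \<noteq> of_nat m \<and> M x = c}"
      using c Suc.prems(2) by (auto simp: U_def)
    then have fin: "finite ((\<lambda>y. (M ^^ k) (P y)) ` ball y r)" using M_finite_fibre finite_subset by blast
    have "(\<lambda>y. (M ^^ k) (P y)) holomorphic_on ball y r"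
      using iterate_on_U holomorphic_on_subset sub by blast
    then show False using finite_image_imp_constant_on fin Suc.IH[OF Suc.prems(1) sub] Suc.prems(1) by blast
  qed
qed

text \<open>For \<open>m > 0\<close> the pole of \<open>M\<close> has order \<open>n >= 2\<close>,
  and \<open>F\<close> is the reciprocal of \<open>M\<close>. For \<open>m = 0\<close> the pole 0
  has order \<open>n - 1\<close>, which may be 1; so \<open>xp\<close> is taken as the
  \<open>n\<close>-fold zero of \<open>M\<close>, and \<open>F\<close> is the reciprocal of the
  second iterate, with a zero of order \<open>n * (n - 1)\<close>.\<close>

lemma double_pole:
  obtains V F where "open V" "xp \<in> V" "F holomorphic_on V" "F xp = 0" "deriv F xp = 0"
    "\<And>x. x \<in> V \<Longrightarrow> F x = 0 \<Longrightarrow> x = xp" "\<And>x. x \<in> V \<Longrightarrow> F x \<noteq> 0 \<Longrightarrow> x \<in> X \<longleftrightarrow> 1 / F x \<in> X"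
proof (cases "m = 0")
  case False
  have xp: "d * xp = of_nat m" "xp \<noteq> 0" using xp_pos[OF False] d_nonzero False by auto
  define E where "E = (\<lambda>x. d * x - of_nat m)"
  define V where "V = {x. x \<noteq> 0 \<and> lam * E x + kap \<noteq> 0}"
  define F where "F = (\<lambda>x. E x ^ n / (x * (lam * E x + kap) ^ n))"
  have Exp: "E xp = 0" by (simp add: E_def xp)
  show thesis
  proof (rule that[of V F])
    show "open V" unfolding V_def E_def by (intro open_Collect_conj open_Collect_neq continuous_intros)
    show xpV: "xp \<in> V" using xp Exp kap_nonzero by (simp add: V_def)
    show hol: "F holomorphic_on V" unfolding F_def E_def by (intro holomorphic_intros) (auto simp: V_def E_def)
    show "F xp = 0" using n by (simp add: F_def Exp power_0_left)
    show "deriv F xp = 0"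
    proof -
      \<comment> \<open>One factor \<open>E\<close> is split off; the cofactor \<open>H\<close>
        still vanishes at \<open>xp\<close> because \<open>n >= 2\<close>, so the product has
        derivative 0.\<close>
      define H where "H = (\<lambda>x. E x ^ (n - 1) / (x * (lam * E x + kap) ^ n))"
      have "H holomorphic_on V" unfolding H_def E_def by (intro holomorphic_intros) (auto simp: V_def E_def)
      then have "(H has_field_derivative deriv H xp) (at xp)"
        using \<open>open V\<close> xpV by (intro holomorphic_derivI)
      moreover have "(E has_field_derivative d) (at xp)" unfolding E_def by (auto intro!: derivative_eq_intros)
      ultimately have "((\<lambda>x. E x * H x) has_field_derivative (E xp * deriv H xp + d * H xp)) (at xp)"
        by (auto intro!: derivative_eq_intros)
      moreover have "H xp = 0" using n by (simp add: H_def Exp power_0_left)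
      moreover have "(\<lambda>x. E x * H x) = F"
      proof
        fix x have "E x ^ n = E x * E x ^ (n - 1)" using n by (simp flip: power_Suc)
        then show "E x * H x = F x" by (simp add: F_def H_def)
      qed
      ultimately have "(F has_field_derivative 0) (at xp)" using Exp by simp
      then show ?thesis by (rule DERIV_imp_deriv)
    qed
    fix x assume x: "x \<in> V"
    then have x0: "x \<noteq> 0" "lam * E x + kap \<noteq> 0" by (auto simp: V_def)
    show "x = xp" if "F x = 0"
    proof -
      have "E x = 0" using that x0 by (simp add: F_def)
      then have "d * x = d * xp" using xp by (simp add: E_def)
      then show ?thesis using d_nonzero by simp
    qed
    show "x \<in> X \<longleftrightarrow> 1 / F x \<in> X" if "F x \<noteq> 0"
    proof -
      have E0: "E x \<noteq> 0" using that n by (auto simp: F_def power_0_left)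
      have "lam + kap / E x = (lam * E x + kap) / E x" using E0 by (simp add: add_divide_distrib)
      moreover have "M x = x * (lam + kap / E x) ^ n" by (simp add: M_def E_def)
      ultimately have "M x = 1 / F x" by (simp add: F_def power_divide)
      moreover have "d * x \<noteq> of_nat m" using E0 by (simp add: E_def)
      ultimately show ?thesis using X_M[of x] by simp
    qed
  qed
next
  case True
  have xp: "xp = - kap / (d * lam)" by (rule xp_zero[OF True])
  have xp0: "xp \<noteq> 0" using xp kap_nonzero d_nonzero lam_nonzero by simp
  have M0: "M x = x * (lam + kap / (d * x)) ^ n" for x
  proof -
    have "d * x - of_nat m = d * x" using True by simp
    then show ?thesis unfolding M_def by (simp only:)
  qed
  have pole: "d * x = of_nat m \<longleftrightarrow> x = 0" for x
  proof -
    have "of_nat m = (0::complex)" using True by simp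
    then show ?thesis using d_nonzero by (simp only:) simp
  qed
  have Mxp: "M xp = 0"
  proof -
    have "kap / (d * xp) = - lam" using kap_nonzero d_nonzero lam_nonzero by (simp add: xp)
    then show ?thesis using n by (simp add: M0 power_0_left)
  qed
  define W where "W = (\<lambda>v. lam * v + kap / d)"
  define V where "V = {x. x \<noteq> 0} \<inter> M -` {v. W v \<noteq> 0}"
  \<comment> \<open>\<open>1 / M (M x)\<close>, written by means of
    \<open>M v = W v^n / v^(n-1)\<close> so that it is holomorphic also where
    \<open>M x = 0\<close>.\<close>
  define F where "F = (\<lambda>x. M x ^ (n - 1) / W (M x) ^ n)"
  have hM: "M holomorphic_on {x. x \<noteq> 0}" using M_holomorphic by (simp only: pole)
  have op0: "open {x::complex. x \<noteq> 0}" by (intro open_Collect_neq continuous_intros)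
  have W0: "W 0 \<noteq> 0" using kap_nonzero d_nonzero by (simp add: W_def)
  have opV: "open V"
  proof -
    have "open {v. W v \<noteq> 0}" unfolding W_def by (intro open_Collect_neq continuous_intros)
    then show ?thesis unfolding V_def
      using holomorphic_on_imp_continuous_on[OF hM] op0 continuous_open_preimage by blast
  qed
  have hMV: "M holomorphic_on V" using hM by (rule holomorphic_on_subset) (auto simp: V_def)
  have dM: "(M has_field_derivative 0) (at xp)"
  proof -
    define H where "H = (\<lambda>x. x * (lam + kap / (d * x)) ^ (n - 1))"
    define L where "L = (\<lambda>x. lam + kap / (d * x))"
    have hL: "L holomorphic_on {x. x \<noteq> 0}" unfolding L_def using d_nonzero by (intro holomorphic_intros) auto
    have hH: "H holomorphic_on {x. x \<noteq> 0}" unfolding H_def using d_nonzero by (intro holomorphic_intros) auto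
    have "L xp = 0" using kap_nonzero d_nonzero lam_nonzero by (simp add: L_def xp)
    moreover have "H xp = 0" using \<open>L xp = 0\<close> n by (simp add: H_def L_def power_0_left)
    moreover have "(L has_field_derivative deriv L xp) (at xp)" "(H has_field_derivative deriv H xp) (at xp)"
      using hL hH op0 xp0 by (auto intro: holomorphic_derivI)
    ultimately have "((\<lambda>x. L x * H x) has_field_derivative 0) (at xp)"
      by (auto intro!: derivative_eq_intros)
    moreover have "(\<lambda>x. L x * H x) = M"
    proof
      fix x have "L x ^ n = L x * L x ^ (n - 1)" using n by (simp flip: power_Suc)
      then show "L x * H x = M x" unfolding M0 H_def L_def by (simp add: mult_ac)
    qed
    ultimately show ?thesis by simp
  qed
  show thesis
  proof (rule that[of V F])
    show "open V" by (rule opV)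
    show xpV: "xp \<in> V" using xp0 Mxp W0 by (simp add: V_def)
    show hol: "F holomorphic_on V" unfolding F_def W_def using hMV
      by (intro holomorphic_intros) (auto simp: V_def W_def)
    show "F xp = 0" using n by (simp add: F_def Mxp power_0_left)
    show "deriv F xp = 0"
    proof -
      have "((\<lambda>v. v ^ (n - 1) / W v ^ n) has_field_derivative deriv (\<lambda>v. v ^ (n - 1) / W v ^ n) (M xp)) (at (M xp))"
      proof (rule holomorphic_derivI)
        show "(\<lambda>v. v ^ (n - 1) / W v ^ n) holomorphic_on {v. W v \<noteq> 0}"
          unfolding W_def by (intro holomorphic_intros) auto
        show "open {v. W v \<noteq> 0}" unfolding W_def by (intro open_Collect_neq continuous_intros)
        show "M xp \<in> {v. W v \<noteq> 0}" using W0 Mxp by simp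
      qed
      from DERIV_chain2[OF this dM] have "(F has_field_derivative 0) (at xp)" by (simp add: F_def)
      then show ?thesis by (rule DERIV_imp_deriv)
    qed
    fix x assume x: "x \<in> V"
    then have x0: "x \<noteq> 0" "W (M x) \<noteq> 0" by (auto simp: V_def)
    show "x = xp" if "F x = 0"
    proof -
      have "M x = 0" using that x0 n by (simp add: F_def)
      then show ?thesis using M_eq_0_imp[OF True, of x] x0 pole by blast
    qed
    show "x \<in> X \<longleftrightarrow> 1 / F x \<in> X" if "F x \<noteq> 0"
    proof -
      define v where "v = M x"
      have v0: "v \<noteq> 0" using that n by (auto simp: F_def v_def power_0_left)
      have "lam + kap / (d * v) = W v / v" using v0 by (simp add: W_def add_divide_distrib)
      then have "M v = v * W v ^ n / v ^ n" by (simp add: M0 power_divide)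
      moreover have "v ^ n = v * v ^ (n - 1)" using n by (simp flip: power_Suc)
      ultimately have "M v = W v ^ n / v ^ (n - 1)" using v0 by simp
      then have "M v = 1 / F x" by (simp add: F_def v_def)
      moreover have "d * x \<noteq> of_nat m" "d * v \<noteq> of_nat m" using pole x0 v0 by auto
      ultimately show ?thesis using X_M[of x] X_M[of v] by (simp add: v_def)
    qed
  qed
qed

end

section \<open>Arcs of the Julia set against the flow\<close>

context newton_extra_rotation
begin

text \<open>\<open>P\<close> maps the ray to a curve in \<open>X\<close> that runs to infinity in
  direction \<open>\<sigma> v\<close>. Its points are \<open>1 / q^D\<close> for a curve
  \<open>q\<close> that ends at 0 in direction \<open>\<nu>\<close>, and \<open>\<psi>\<close> turns
  \<open>q\<close> into an arc of \<open>Jh\<close> ending at \<open>\<xi>\<close> with tangent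
  \<open>deriv \<psi> 0 * \<nu>\<close>. By \<open>connected_subset_parallel\<close> the arc runs
  parallel to \<open>v\<close>.\<close>

lemma arc_direction:
  assumes v: "cmod v = 1"
    and inv: "\<And>y t. y \<in> Jh \<Longrightarrow> (\<And>s. 0 \<le> s \<Longrightarrow> s \<le> 1 \<Longrightarrow> y + of_real (s * t) * v \<noteq> 0) \<Longrightarrow> y + of_real t * v \<in> Jh"
    and D: "D \<ge> 2" and \<eta>: "\<eta> > 0" and \<psi>: "\<psi> holomorphic_on ball 0 \<eta>" "\<psi> 0 = \<xi>"
    and \<rho>: "0 \<notin> ball \<xi> \<rho>" "\<And>q. q \<in> ball 0 \<eta> \<Longrightarrow> \<psi> q \<in> ball \<xi> \<rho>"
    and \<psi>J: "\<And>q. q \<in> ball 0 \<eta> \<Longrightarrow> q \<noteq> 0 \<Longrightarrow> \<psi> q \<in> Jh \<longleftrightarrow> 1 / q ^ D \<in> X"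
    and \<sigma>: "\<sigma> = 1 \<or> \<sigma> = - 1" and ray: "\<And>t. t \<ge> 0 \<Longrightarrow> y1 + of_real t * (\<sigma> * v) \<in> Jh"
    and \<nu>: "\<nu> ^ D = \<sigma> / v"
  shows "Im (deriv \<psi> 0 * \<nu> / v) = 0"
proof -
  have v0: "v \<noteq> 0" using v by auto
  have s0: "\<sigma> \<noteq> 0" "cmod \<sigma> = 1" "\<sigma> * \<sigma> = 1" using \<sigma> by auto
  have D0: "D > 0" "D \<noteq> 0" using D by auto
  define C where "C = cmod y1 + cmod x0 + 1"
  have C1: "C \<ge> 1" by (simp add: C_def)
  define y where "y = (\<lambda>t. y1 + of_real t * (\<sigma> * v))"
  have yJ: "y t \<in> Jh" if "t \<ge> 0" for t unfolding y_def by (rule ray[OF that])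
  have yR: "cmod (y t) > R" if "t > R + cmod y1" for t
  proof -
    have "cmod (of_real t * (\<sigma> * v)) = \<bar>t\<bar>" using v s0 by (simp add: norm_mult)
    moreover have "cmod (of_real t * (\<sigma> * v)) \<le> cmod (y t) + cmod y1"
      using norm_triangle_ineq4[of "y t" y1] by (simp add: y_def)
    ultimately show ?thesis using that by linarith
  qed
  have conty: "continuous_on A y" for A unfolding y_def by (intro continuous_intros)
  \<comment> \<open>Normalised to tend to 1, so that the principal logarithm provides a continuous
    \<open>D\<close>-th root.\<close>
  define w where "w = (\<lambda>t. P (y t) / (\<sigma> * v) / of_real t)"
  have w_near: "cmod (w t - 1) \<le> C / t" if t: "t > R + cmod y1" for t
  proof -
    have t0: "t > 0" using t R norm_ge_zero[of y1] by linarith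
    have sv: "\<sigma> * v \<noteq> 0" using s0 v0 by simp
    have "w t - 1 = (P (y t) - of_real t * (\<sigma> * v)) / (\<sigma> * v) / of_real t"
      using t0 sv by (simp add: w_def diff_divide_distrib)
    then have "cmod (w t - 1) = cmod (P (y t) - of_real t * (\<sigma> * v)) / t"
      using t0 s0 v by (simp add: norm_divide norm_mult)
    moreover have "P (y t) - of_real t * (\<sigma> * v) = (P (y t) - (y t + x0)) + (y1 + x0)" by (simp add: y_def)
    then have "cmod (P (y t) - of_real t * (\<sigma> * v)) = cmod ((P (y t) - (y t + x0)) + (y1 + x0))" by (rule arg_cong)
    then have "cmod (P (y t) - of_real t * (\<sigma> * v)) \<le> 1 + (cmod y1 + cmod x0)"
      using P_near_1[OF yR[OF t]] norm_triangle_ineq[of "P (y t) - (y t + x0)" "y1 + x0"] norm_triangle_ineq[of y1 x0] by linarith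
    ultimately show ?thesis using t0 by (simp add: C_def divide_right_mono)
  qed
  define T0 where "T0 = R + cmod y1 + 2 * C + 1"
  have T0: "T0 > R + cmod y1" "T0 \<ge> 1" "T0 \<ge> 2 * C" using C1 R by (auto simp: T0_def)
  have w_half: "cmod (w t - 1) \<le> 1/2" if t: "t \<ge> T0" for t
  proof -
    have "C / t \<le> C / (2 * C)" using t T0 C1 by (intro divide_left_mono) auto
    also have "\<dots> = 1/2" using C1 by simp
    finally have "C / t \<le> 1/2" .
    moreover have "t > R + cmod y1" using t T0 by linarith
    ultimately show ?thesis using w_near[of t] by linarith
  qed
  have w_ok: "w t \<notin> \<real>\<^sub>\<le>\<^sub>0" "w t \<noteq> 0" if t: "t \<ge> T0" for t
  proof -
    have "\<bar>Re (w t - 1)\<bar> \<le> 1/2" using w_half[OF t] abs_Re_le_cmod[of "w t - 1"] by linarith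
    then have "Re (w t) > 0" unfolding minus_complex.simps(1) one_complex.simps(1) by linarith
    then show "w t \<notin> \<real>\<^sub>\<le>\<^sub>0" "w t \<noteq> 0" by (auto simp: complex_nonpos_Reals_iff)
  qed
  have contw: "continuous_on {T0..} w"
  proof -
    have "continuous_on {T0..} (\<lambda>t. P (y t))"
    proof (rule continuous_on_compose2[of "{y. cmod y > R}" P])
      show "continuous_on {y. cmod y > R} P" by (rule holomorphic_on_imp_continuous_on[OF P_hol])
      show "y ` {T0..} \<subseteq> {y. cmod y > R}" using yR T0 by auto
    qed (rule conty)
    then show ?thesis unfolding w_def using T0 s0 v0 by (intro continuous_intros) auto
  qed
  \<comment> \<open>\<open>q = r e\<close> is a \<open>D\<close>-th root of
    \<open>1 / P (y t)\<close>: the real factor \<open>r\<close> carries the size, and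
    \<open>e\<close> tends to the direction \<open>\<nu>\<close>. The condition on
    \<open>\<nu>\<close> fits because \<open>1 / (\<sigma> v) = \<sigma> / v\<close>.\<close>
  define r where "r = (\<lambda>t. t powr (- 1 / D))"
  define e where "e = (\<lambda>t. \<nu> * exp (- Ln (w t) / of_nat D))"
  define q where "q = (\<lambda>t. of_real (r t) * e t)"
  have rpos: "r t > 0" if "t \<ge> T0" for t using that T0 by (simp add: r_def)
  have rD: "r t ^ D = 1 / t" if "t \<ge> T0" for t
  proof -
    have t0: "t > 0" using that T0 by linarith
    have "r t ^ D = r t powr real D" using rpos[OF that] by (simp add: powr_realpow)
    also have "\<dots> = t powr (- 1 / D * D)" by (simp add: r_def powr_powr)
    also have "- 1 / real D * real D = -1" using D0 by simp
    also have "t powr -1 = 1 / t" using t0 by (simp add: powr_minus_divide)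
    finally show ?thesis .
  qed
  have eD: "e t ^ D = \<sigma> / v / w t" if "t \<ge> T0" for t
  proof -
    have "exp (- Ln (w t) / of_nat D) ^ D = exp (of_nat D * (- Ln (w t) / of_nat D))" by (rule exp_of_nat_mult[symmetric])
    also have "of_nat D * (- Ln (w t) / of_nat D) = - Ln (w t)" using D0 by simp
    also have "exp (- Ln (w t)) = 1 / w t" using w_ok[OF that] by (simp add: exp_minus inverse_eq_divide)
    finally show ?thesis by (simp add: e_def power_mult_distrib \<nu>)
  qed
  have qD: "1 / q t ^ D = P (y t)" and q0: "q t \<noteq> 0" if t: "t \<ge> T0" for t
  proof -
    have t0: "t > 0" using t T0 by linarith
    have "q t ^ D = of_real (r t ^ D) * e t ^ D" by (simp add: q_def power_mult_distrib)
    also have "\<dots> = of_real (1 / t) * (\<sigma> / v / w t)" unfolding rD[OF t] eD[OF t] ..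
    finally have "1 / q t ^ D = of_real t * (v / \<sigma>) * w t" by simp
    also have "\<dots> = P (y t) * (v / \<sigma>) / (\<sigma> * v)" using t0 by (simp add: w_def)
    also have "\<dots> = P (y t) / (\<sigma> * \<sigma>)" using v0 by simp
    finally show "1 / q t ^ D = P (y t)" using s0 by simp
    have "t > R + cmod y1" using t T0 by linarith
    then have "cmod (P (y t)) > 2" by (rule P_large[OF yR])
    then have "P (y t) \<noteq> 0" by auto
    moreover have "1 / (0::complex) ^ D = 0" using D0 by (simp add: power_0_left)
    ultimately show "q t \<noteq> 0" using \<open>1 / q t ^ D = P (y t)\<close> by metis
  qed
  have conte: "continuous_on {T0..} e"
    unfolding e_def using w_ok by (intro continuous_intros continuous_on_Ln contw) (auto simp: D0)
  have contr: "continuous_on {T0..} r"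
    unfolding r_def using T0 by (intro continuous_intros) auto
  have contq: "continuous_on {T0..} q" unfolding q_def by (intro continuous_intros conte contr)
  have wlim: "(w \<longlongrightarrow> 1) at_top"
  proof (rule LIM_zero_cancel, rule Lim_null_comparison)
    show "\<forall>\<^sub>F t in at_top. norm (w t - 1) \<le> C / t"
      using eventually_gt_at_top[of "R + cmod y1"] by (rule eventually_mono) (rule w_near)
    show "((\<lambda>t. C / t) \<longlongrightarrow> 0) at_top"
      by (intro tendsto_divide_0[OF tendsto_const] filterlim_at_top_imp_at_infinity filterlim_ident)
  qed
  have elim: "(e \<longlongrightarrow> \<nu>) at_top"
  proof -
    have "(1::complex) \<notin> \<real>\<^sub>\<le>\<^sub>0" by simp
    then have L: "((\<lambda>t. Ln (w t)) \<longlongrightarrow> Ln 1) at_top" using wlim by (intro tendsto_Ln)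
    have "(e \<longlongrightarrow> \<nu> * exp (- Ln 1 / of_nat D)) at_top"
      unfolding e_def using D0
      by (intro tendsto_mult tendsto_const tendsto_exp tendsto_divide tendsto_minus L) auto
    then show ?thesis by simp
  qed
  have rlim: "(r \<longlongrightarrow> 0) at_top"
    unfolding r_def using D0 by (intro tendsto_neg_powr filterlim_ident) auto
  have qlim: "(q \<longlongrightarrow> 0) at_top"
  proof -
    have "(q \<longlongrightarrow> of_real 0 * \<nu>) at_top" unfolding q_def by (intro tendsto_intros rlim elim)
    then show ?thesis by simp
  qed
  then have "\<forall>\<^sub>F t in at_top. q t \<in> ball 0 \<eta>" using \<eta> by (intro topological_tendstoD[OF qlim]) auto
  then obtain T1 where T1: "\<And>t. t \<ge> T1 \<Longrightarrow> q t \<in> ball 0 \<eta>" unfolding eventually_at_top_linorder by blast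
  define T where "T = max T0 T1"
  have T: "t \<ge> T0" "q t \<in> ball 0 \<eta>" if "t \<ge> T" for t using that T1 by (auto simp: T_def)
  define a where "a = (\<lambda>t. \<psi> (q t))"
  have aJ: "a t \<in> Jh" "a t \<in> ball \<xi> \<rho>" if t: "t \<ge> T" for t
  proof -
    have "P (y t) \<in> X"
    proof -
      have "t > R + cmod y1" "t \<ge> 0" using T(1)[OF t] T0 by linarith+
      then show ?thesis using Jh_iff_P[OF yR] yJ by blast
    qed
    then show "a t \<in> Jh" using \<psi>J[OF T(2)[OF t] q0[OF T(1)[OF t]]] qD[OF T(1)[OF t]] by (simp add: a_def)
    show "a t \<in> ball \<xi> \<rho>" unfolding a_def by (rule \<rho>(2)[OF T(2)[OF t]])
  qed
  define S where "S = a ` {T..}"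
  have "continuous_on {T..} a" unfolding a_def
  proof (rule continuous_on_compose2[of "ball 0 \<eta>" \<psi>])
    show "continuous_on (ball 0 \<eta>) \<psi>" by (rule holomorphic_on_imp_continuous_on[OF \<psi>(1)])
    show "continuous_on {T..} q" using contq by (rule continuous_on_subset) (auto simp: T_def)
    show "q ` {T..} \<subseteq> ball 0 \<eta>" using T by auto
  qed
  then have conn: "connected S" unfolding S_def by (intro connected_continuous_image) auto
  have SJ: "S \<subseteq> Jh" "S \<subseteq> ball \<xi> \<rho>" using aJ by (auto simp: S_def)
  \<comment> \<open>The segment stays in the convex ball, which misses 0, so the flow is available
    along it.\<close>
  have binv: "z + of_real t * v \<in> Jh" if z: "z \<in> Jh" "z \<in> ball \<xi> \<rho>" "z + of_real t * v \<in> ball \<xi> \<rho>" for z t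
  proof (rule inv[OF z(1)])
    fix s :: real assume s: "0 \<le> s" "s \<le> 1"
    have "(1 - s) *\<^sub>R z + s *\<^sub>R (z + of_real t * v) \<in> ball \<xi> \<rho>"
      using s z by (intro convexD[OF convex_ball]) auto
    moreover have "(1 - s) *\<^sub>R z + s *\<^sub>R (z + of_real t * v) = z + of_real (s * t) * v"
      by (simp add: scaleR_conv_of_real algebra_simps)
    ultimately show "z + of_real (s * t) * v \<noteq> 0" using \<rho>(1) by metis
  qed
  have const: "Im (a t / v) = Im (a T / v)" if "t \<ge> T" for t
    by (rule connected_subset_parallel[OF open_ball v0 binv interior_Jh conn SJ]) (use that in \<open>auto simp: S_def\<close>)
  have "isCont \<psi> 0" using holomorphic_on_imp_continuous_on[OF \<psi>(1)] \<eta>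
    unfolding continuous_on_eq_continuous_at[OF open_ball] by simp
  from isCont_tendsto_compose[OF this qlim] have alim: "(a \<longlongrightarrow> \<xi>) at_top" by (simp add: a_def[abs_def] \<psi>(2))
  have "((\<lambda>t. Im (a t / v)) \<longlongrightarrow> Im (\<xi> / v)) at_top" using v0 by (intro tendsto_intros alim) auto
  moreover have "((\<lambda>t. Im (a t / v)) \<longlongrightarrow> Im (a T / v)) at_top"
  proof (rule tendsto_eventually)
    show "\<forall>\<^sub>F t in at_top. Im (a t / v) = Im (a T / v)"
      unfolding eventually_at_top_linorder using const by blast
  qed
  ultimately have "Im (\<xi> / v) = Im (a T / v)" by (rule tendsto_unique[rotated]) simp
  then have zero: "Im ((a t - \<xi>) / of_real (r t) / v) = 0" if "t \<ge> T" for t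
  proof -
    have "(a t - \<xi>) / of_real (r t) / v = (a t / v - \<xi> / v) / of_real (r t)" by (simp add: diff_divide_distrib mult.commute)
    then show ?thesis using const[OF that] \<open>Im (\<xi> / v) = Im (a T / v)\<close> by (simp add: Im_divide_of_real)
  qed
  have "(\<psi> has_field_derivative deriv \<psi> 0) (at 0)" using \<psi>(1) \<eta> by (intro holomorphic_derivI[of _ "ball 0 \<eta>"]) auto
  then have dlim: "((\<lambda>x. (\<psi> x - \<psi> 0) / (x - 0)) \<longlongrightarrow> deriv \<psi> 0) (at 0)" by (simp add: has_field_derivative_iff)
  have "filterlim q (at 0) at_top" unfolding filterlim_at
    using qlim q0 by (auto simp: eventually_at_top_linorder)
  from filterlim_compose[OF dlim this] have "((\<lambda>t. (a t - \<xi>) / q t) \<longlongrightarrow> deriv \<psi> 0) at_top"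
    by (simp add: a_def \<psi>(2))
  then have "((\<lambda>t. (a t - \<xi>) / q t * e t / v) \<longlongrightarrow> deriv \<psi> 0 * \<nu> / v) at_top"
    using v0 by (intro tendsto_intros elim) auto
  then have "((\<lambda>t. Im ((a t - \<xi>) / q t * e t / v)) \<longlongrightarrow> Im (deriv \<psi> 0 * \<nu> / v)) at_top" by (rule tendsto_Im)
  \<comment> \<open>Multiplication by \<open>e\<close> replaces the divisor \<open>q\<close> by the
    real number \<open>r\<close>, and division by a real number keeps the imaginary part 0.\<close>
  moreover have "((\<lambda>t. Im ((a t - \<xi>) / q t * e t / v)) \<longlongrightarrow> 0) at_top"
  proof (rule tendsto_eventually)
    have "Im ((a t - \<xi>) / q t * e t / v) = 0" if t: "t \<ge> T" for t
    proof -
      have "e t \<noteq> 0" "r t \<noteq> 0" using q0[OF T(1)[OF t]] by (auto simp: q_def)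
      then have "(a t - \<xi>) / q t * e t = (a t - \<xi>) / of_real (r t)" by (simp add: q_def)
      then show ?thesis using zero[OF t] by simp
    qed
    then show "\<forall>\<^sub>F t in at_top. Im ((a t - \<xi>) / q t * e t / v) = 0" unfolding eventually_at_top_linorder by blast
  qed
  ultimately show ?thesis by (rule tendsto_unique[rotated]) simp
qed

text \<open>The flow in direction \<open>\<sigma> v\<close> can be stopped only by 0, that is for
  points on the opposite ray from 0. Such a point is first moved off that ray by the exact rotation
  \<open>\<alpha>\<close>.\<close>

lemma rays:
  assumes v: "cmod v = 1"
    and inv: "\<And>y t. y \<in> Jh \<Longrightarrow> (\<And>s. 0 \<le> s \<Longrightarrow> s \<le> 1 \<Longrightarrow> y + of_real (s * t) * v \<noteq> 0) \<Longrightarrow> y + of_real t * v \<in> Jh"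
    and \<sigma>: "\<sigma> = 1 \<or> \<sigma> = - (1::complex)" and ne: "Jh \<noteq> {}"
  shows "\<exists>y1. \<forall>t\<ge>0. y1 + of_real t * (\<sigma> * v) \<in> Jh"
proof -
  have v0: "v \<noteq> 0" using v by auto
  have s0: "\<sigma> \<noteq> 0" using \<sigma> by auto
  have ray: "\<forall>t\<ge>0. y + of_real t * (\<sigma> * v) \<in> Jh" if y: "y \<in> Jh" and dir: "\<not> (\<exists>t\<ge>0. y = of_real (- t) * (\<sigma> * v))" for y
  proof (intro allI impI)
    fix t :: real assume t: "t \<ge> 0"
    define u where "u = (if \<sigma> = 1 then t else - t)"
    have u: "of_real u * v = of_real t * (\<sigma> * v)" "of_real (s * u) * v = of_real (s * t) * (\<sigma> * v)" for s
      using \<sigma> by (auto simp: u_def)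
    have "y + of_real u * v \<in> Jh"
    proof (rule inv[OF y])
      fix s :: real assume s: "0 \<le> s" "s \<le> 1"
      have "s * t \<ge> 0" using s t by simp
      then have "y \<noteq> of_real (- (s * t)) * (\<sigma> * v)" using dir by blast
      then show "y + of_real (s * u) * v \<noteq> 0" unfolding u(2) by (metis add_eq_0_iff mult_minus_left of_real_minus add.commute)
    qed
    then show "y + of_real t * (\<sigma> * v) \<in> Jh" unfolding u(1) .
  qed
  obtain y where y: "y \<in> Jh" using ne by auto
  show ?thesis
  proof (cases "\<exists>t\<ge>0. y = of_real (- t) * (\<sigma> * v)")
    case False
    then show ?thesis using ray[OF y] by blast
  next
    case True
    then obtain t where t: "t \<ge> 0" "y = of_real (- t) * (\<sigma> * v)" by blast
    have t0: "t \<noteq> 0" using t(2) Jh_nonzero[OF y] by auto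
    have ay: "\<alpha> * y \<in> Jh" by (rule exact_rotation[OF \<alpha>(1) X_rotate' y])
    have "\<not> (\<exists>t'\<ge>0. \<alpha> * y = of_real (- t') * (\<sigma> * v))"
    proof
      assume "\<exists>t'\<ge>0. \<alpha> * y = of_real (- t') * (\<sigma> * v)"
      then obtain t' where t': "t' \<ge> 0" "\<alpha> * y = of_real (- t') * (\<sigma> * v)" by blast
      then have "\<alpha> * of_real t * (\<sigma> * v) = of_real t' * (\<sigma> * v)" using t(2) by simp
      then have at: "\<alpha> * of_real t = of_real t'" using s0 v0 by simp
      then have "cmod (\<alpha> * of_real t) = cmod (of_real t')" by simp
      then have "t = t'" using \<alpha>(1) t(1) t'(1) by (simp add: norm_mult)
      then have "\<alpha> = 1" using at t0 by simp
      then show False using \<alpha>(2) by simp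
    qed
    then show ?thesis using ray[OF ay] by blast
  qed
qed

text \<open>Rays along \<open>v\<close> and along \<open>- v\<close> give two arcs ending at the
  same point \<open>\<xi>\<close>. Their tangents differ by the factor \<open>\<zeta>\<close>, a
  \<open>D\<close>-th root of -1, and yet both are parallel to \<open>v\<close>.\<close>

theorem no_extra_rotation: False
proof (rule flow)
  fix v assume v: "cmod v = 1"
    and inv: "\<And>y t. y \<in> Jh \<Longrightarrow> (\<And>s. 0 \<le> s \<Longrightarrow> s \<le> 1 \<Longrightarrow> y + of_real (s * t) * v \<noteq> 0) \<Longrightarrow> y + of_real t * v \<in> Jh"
  have v0: "v \<noteq> 0" using v by auto
  obtain \<xi> k where \<xi>R: "cmod \<xi> > R" and \<xi>k: "\<forall>i<k. d * (M ^^ i) (P \<xi>) \<noteq> of_nat m" "(M ^^ k) (P \<xi>) = xp"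
    using P_orbit_hits by blast
  define g where "g = (\<lambda>y. (M ^^ k) (P y))"
  have \<xi>U: "\<xi> \<in> U k" using \<xi>R \<xi>k(1) by (simp add: U_def)
  have gU: "open (U k)" "g holomorphic_on U k" using iterate_on_U unfolding g_def by blast+
  obtain V H where V: "open V" "xp \<in> V" "H holomorphic_on V" "H xp = 0" "deriv H xp = 0"
    and HV: "\<And>x. x \<in> V \<Longrightarrow> H x = 0 \<Longrightarrow> x = xp" "\<And>x. x \<in> V \<Longrightarrow> H x \<noteq> 0 \<Longrightarrow> x \<in> X \<longleftrightarrow> 1 / H x \<in> X"
    by (rule double_pole) (rule that, assumption, assumption, assumption, assumption, assumption, blast+)
  have g\<xi>: "g \<xi> = xp" by (simp add: g_def \<xi>k)
  have "open (U k \<inter> g -` V)" using gU V(1) holomorphic_on_imp_continuous_on continuous_open_preimage by blast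
  moreover have "\<xi> \<in> U k \<inter> g -` V" using \<xi>U g\<xi> V(2) by simp
  ultimately obtain \<rho> where \<rho>: "\<rho> > 0" "ball \<xi> \<rho> \<subseteq> U k \<inter> g -` V" by (meson open_contains_ball)
  have ghol: "g holomorphic_on ball \<xi> \<rho>" using gU(2) \<rho>(2) by (intro holomorphic_on_subset[OF gU(2)]) auto
  define f where "f = (\<lambda>y. H (g y))"
  have fhol: "f holomorphic_on ball \<xi> \<rho>"
    using holomorphic_on_compose_gen[OF ghol V(3)] \<rho>(2) by (auto simp: f_def o_def)
  have f0: "f \<xi> = 0" by (simp add: f_def g\<xi> V(4))
  have f1: "deriv f \<xi> = 0"
  proof -
    have "(g has_field_derivative deriv g \<xi>) (at \<xi>)" using ghol \<rho>(1) by (intro holomorphic_derivI[of _ "ball \<xi> \<rho>"]) auto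
    moreover have "(H has_field_derivative deriv H (g \<xi>)) (at (g \<xi>))"
      using V g\<xi> by (intro holomorphic_derivI[of _ V]) auto
    ultimately have "(f has_field_derivative deriv H (g \<xi>) * deriv g \<xi>) (at \<xi>)"
      unfolding f_def by (rule DERIV_chain2[rotated])
    then show ?thesis using V(5) g\<xi> by (simp add: DERIV_imp_deriv)
  qed
  have fz: "g y = xp" if "y \<in> ball \<xi> \<rho>" "f y = 0" for y
    using HV(1)[of "g y"] that \<rho>(2) by (auto simp: f_def)
  have nc: "\<not> f constant_on ball \<xi> \<rho>"
  proof
    assume "f constant_on ball \<xi> \<rho>"
    then have "f y = 0" if "y \<in> ball \<xi> \<rho>" for y using f0 that \<rho>(1) unfolding constant_on_def by (metis centre_in_ball)
    then have "g y = xp" if "y \<in> ball \<xi> \<rho>" for y using fz that by blast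
    then have "g constant_on ball \<xi> \<rho>" unfolding constant_on_def by blast
    moreover have "ball \<xi> \<rho> \<subseteq> U k" using \<rho>(2) by blast
    ultimately show False using iterate_not_constant[OF \<rho>(1)] unfolding g_def by blast
  qed
  obtain D \<psi> \<eta> where D: "D \<ge> 2" "\<eta> > 0" "\<psi> holomorphic_on ball 0 \<eta>" "\<psi> 0 = \<xi>" "deriv \<psi> 0 \<noteq> 0"
    "\<And>q. q \<in> ball 0 \<eta> \<Longrightarrow> \<psi> q \<in> ball \<xi> \<rho>" "\<And>q. q \<in> ball 0 \<eta> \<Longrightarrow> f (\<psi> q) = q ^ D"
    by (rule zero_power_coordinate[OF fhol \<rho>(1) f0 f1 nc])
       (rule that, assumption, assumption, assumption, assumption, assumption, blast+)
  have \<psi>J: "\<psi> q \<in> Jh \<longleftrightarrow> 1 / q ^ D \<in> X" if q: "q \<in> ball 0 \<eta>" "q \<noteq> 0" for q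
  proof -
    have b: "\<psi> q \<in> ball \<xi> \<rho>" by (rule D(6)[OF q(1)])
    then have Uq: "\<psi> q \<in> U k" "g (\<psi> q) \<in> V" using \<rho>(2) by auto
    have "H (g (\<psi> q)) = q ^ D" using D(7)[OF q(1)] by (simp add: f_def)
    moreover have "q ^ D \<noteq> 0" using q(2) by simp
    ultimately show ?thesis using Jh_iff_U[OF Uq(1)] HV(2)[OF Uq(2)] by (simp add: g_def)
  qed
  have zero: "0 \<notin> ball \<xi> \<rho>"
  proof
    assume "0 \<in> ball \<xi> \<rho>"
    then have "0 \<in> U k" using \<rho>(2) by blast
    then show False using R by (simp add: U_def)
  qed
  have "xp \<in> X"
  proof (cases "m = 0")
    case False
    then show ?thesis using X_pole[of xp] xp_pos[OF False] d_nonzero by simp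
  next
    case True
    have M0: "M xp = 0"
    proof -
      have "kap / (d * xp) = - lam" using kap_nonzero d_nonzero lam_nonzero by (simp add: xp_zero[OF True])
      moreover have "d * xp - of_nat m = d * xp" using True by simp
      ultimately have "M xp = xp * (lam + - lam) ^ n" unfolding M_def by (simp only:)
      then show ?thesis using n by (simp add: power_0_left)
    qed
    have "xp \<noteq> 0" using kap_nonzero d_nonzero lam_nonzero by (simp add: xp_zero[OF True])
    then have "d * xp \<noteq> of_nat m" using True d_nonzero by simp
    moreover have "(0::complex) \<in> X" using X_pole[of 0] True by simp
    ultimately show ?thesis using X_M[of xp] M0 by simp
  qed
  then have "\<xi> \<in> Jh" using Jh_iff_U[OF \<xi>U] \<xi>k(2) by simp
  then have ne: "Jh \<noteq> {}" by auto
  obtain y1 where y1: "\<And>t. t \<ge> 0 \<Longrightarrow> y1 + of_real t * (1 * v) \<in> Jh" using rays[OF v inv _ ne, of 1] by auto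
  obtain y2 where y2: "\<And>t. t \<ge> 0 \<Longrightarrow> y2 + of_real t * (- 1 * v) \<in> Jh" using rays[OF v inv _ ne, of "- 1"] by auto
  have D0: "D \<noteq> 0" using D(1) by simp
  obtain \<nu> where \<nu>: "1 / v = \<nu> ^ D" using exists_complex_root[OF D0] by metis
  \<comment> \<open>As \<open>D >= 2\<close>, this root of -1 has imaginary part
    \<open>sin (pi / D) > 0\<close>.\<close>
  define \<zeta> where "\<zeta> = cis (pi / D)"
  have \<zeta>D: "\<zeta> ^ D = - 1"
  proof -
    have "real D * (pi / real D) = pi" using D0 by simp
    then show ?thesis unfolding \<zeta>_def using Complex.DeMoivre[of "pi / real D" D] by (metis cis_pi)
  qed
  have 1: "Im (deriv \<psi> 0 * \<nu> / v) = 0"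
    by (rule arc_direction[OF v inv D(1-4) zero D(6) \<psi>J _ y1]) (use \<nu> in auto)
  have 2: "Im (deriv \<psi> 0 * (\<zeta> * \<nu>) / v) = 0"
    by (rule arc_direction[OF v inv D(1-4) zero D(6) \<psi>J _ y2]) (use \<nu> \<zeta>D in \<open>auto simp: power_mult_distrib\<close>)
  define x where "x = deriv \<psi> 0 * \<nu> / v"
  have "\<nu> \<noteq> 0" using \<nu> v0 D0 by (auto simp: power_0_left)
  then have "x \<noteq> 0" using D(5) v0 by (simp add: x_def)
  moreover have "Im x = 0" using 1 by (simp add: x_def)
  ultimately have "Re x \<noteq> 0" by (auto simp: complex_eq_iff)
  moreover have "Im (\<zeta> * x) = 0" using 2 by (simp add: x_def mult_ac)
  then have "sin (pi / D) * Re x = 0" using \<open>Im x = 0\<close> by (simp add: \<zeta>_def)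
  moreover have "sin (pi / D) > 0"
  proof (rule sin_gt_zero)
    show "0 < pi / D" using D0 by simp
    have "pi / D \<le> pi / 2" using D(1) by (intro divide_left_mono) auto
    then show "pi / D < pi" using pi_gt_zero by linarith
  qed
  ultimately show False by simp
qed

end

section \<open>The symmetry group of the Newton map and the comparison with the polynomial\<close>

context newton_pmn
begin

text \<open>A rotation of the Julia set by \<open>a\<close> acts on \<open>X\<close> as the rotation
  by \<open>a^n\<close>, so a symmetry with \<open>a^n\<close> different from 1 is an extra rotation
  in the coordinate \<open>x\<close>.\<close>

lemma rotation_symmetry:
  assumes a: "cmod a = 1" and sym: "\<And>z. z \<in> J \<longleftrightarrow> a * z \<in> J"
  shows "a ^ n = 1"
proof (rule ccontr)
  assume ne: "a ^ n \<noteq> 1"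
  have Xa: "x \<in> X \<longleftrightarrow> a ^ n * x \<in> X" for x
  proof -
    obtain z where z: "z ^ n = x" using nth_root_exists by blast
    then have "a ^ n * x = (a * z) ^ n" by (simp add: power_mult_distrib)
    then show ?thesis using power_in_X[of z] power_in_X[of "a * z"] sym[of z] z by simp
  qed
  show False
  proof (rule koenigs)
    fix P R K
    assume "R \<ge> 1" "K \<ge> 0" "R \<ge> K" "P holomorphic_on {y. cmod y > R}"
      "\<And>y. cmod y > R \<Longrightarrow> cmod (P y - (y + x0)) \<le> K / cmod y"
      "\<And>y. cmod y > R \<Longrightarrow> cmod (P y) > 2"
      "\<And>y. cmod (Lam * y) > R \<Longrightarrow> M (P y) = P (Lam * y)"
      "\<And>x. cmod x \<ge> R \<Longrightarrow> cmod (M x) < cmod x"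
    then interpret newton_extra_rotation m n h P R K "a ^ n"
      by unfold_locales (use a ne Xa in \<open>auto simp: norm_power\<close>)
    show False by (rule no_extra_rotation)
  qed
qed

theorem sym_group_newton:
  assumes "\<not> is_line (julia F)"
  shows "(\<lambda>z. a * z + b) \<in> sym_group (julia F) \<longleftrightarrow> b = 0 \<and> a ^ n = 1"
proof
  assume "b = 0 \<and> a ^ n = 1"
  moreover from this have "cmod a ^ n = 1" by (metis norm_one norm_power)
  then have "cmod a = 1" using n power_eq_imp_eq_base[of "cmod a" n 1] by simp
  ultimately show "(\<lambda>z. a * z + b) \<in> sym_group (julia F)"
    unfolding sym_group_julia using julia_rotate by simp
next
  assume "(\<lambda>z. a * z + b) \<in> sym_group (julia F)"
  then have a: "cmod a = 1" and sym: "\<And>z. z \<in> J \<longleftrightarrow> a * z + b \<in> J" unfolding sym_group_julia by auto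
  have b: "b = 0" by (rule symmetry_fixes_zero[OF assms a sym])
  then have "a ^ n = 1" using sym by (intro rotation_symmetry[OF a]) simp
  with b show "b = 0 \<and> a ^ n = 1" by simp
qed

end

theorem theoremD:
  fixes m n :: nat and h :: complex
  assumes "n \<ge> 2"
    and "cmod (h - 1) < 1"
    and "\<not> is_line (julia (relaxed_newton h (pmn m n)))"
  shows "sym_group (julia (poly_sphere (pmn m n))) = sym_group (julia (relaxed_newton h (pmn m n)))"
proof -
  interpret newton_pmn m n h using assms(1,2) by unfold_locales
  have eq: "(\<lambda>z. a * z + b) \<in> sym_group (julia (poly_sphere (pmn m n))) \<longleftrightarrow>
      (\<lambda>z. a * z + b) \<in> sym_group (julia (relaxed_newton h (pmn m n)))" for a b
    using sym_group_pmn[OF assms(1)] sym_group_newton assms(3) unfolding F_def by blast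
  have aff: "\<exists>a b. \<sigma> = (\<lambda>z. a * z + b)" if "\<sigma> \<in> sym_group S" for \<sigma> S
    using that unfolding sym_group_def by blast
  show ?thesis
  proof (rule set_eqI, rule iffI)
    fix \<sigma> assume s: "\<sigma> \<in> sym_group (julia (poly_sphere (pmn m n)))"
    obtain a b where "\<sigma> = (\<lambda>z. a * z + b)" using aff[OF s] by blast
    then show "\<sigma> \<in> sym_group (julia (relaxed_newton h (pmn m n)))" using s eq[of a b] by simp
  next
    fix \<sigma> assume s: "\<sigma> \<in> sym_group (julia (relaxed_newton h (pmn m n)))"
    obtain a b where "\<sigma> = (\<lambda>z. a * z + b)" using aff[OF s] by blast
    then show "\<sigma> \<in> sym_group (julia (poly_sphere (pmn m n)))" using s eq[of a b] by simp
  qed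
qed

end
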